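(* Consider the SPARC with flat power allocation and maximum-likelihood decoding over the AWGN channel (see context), with rate $R$ (nats), $\textsf{snr}=P/\sigma^2$, capacity $\mathcal{C}=\frac12\log(1+\textsf{snr})$, and $M=L^{\mathsf a}$ with $L\log M=nR$. Assume $\mathsf a\ge \mathsf a^*_L(\textsf{snr})$ and $\Delta:=\mathcal{C}-R>0$. Then for every $\epsilon>0$, $$\mathbb{P}(\mathcal{E}_{\textsf{sec}}\ge\epsilon)\le \exp\Big(-n\Big[h(\epsilon,\Delta)-\frac{\log 2L}{n}\Big]\Big),\qquad h(\epsilon,\Delta)=\min\Big\{\epsilon\Delta\, w(\textsf{snr}),\ \tfrac14 g\Big(\tfrac{\Delta}{2\sqrt{\textsf{snr}}}\Big)\Big\}.$$
   Context: Channel: $y=A\beta+w$, $w$ i.i.d. $\mathcal{N}(0,\sigma^2)$. $A\in\mathbb{R}^{n\times ML}$ has i.i.d. $\mathcal{N}(0,1/n)$ entries, columns grouped into $L$ sections of $M$ columns; messages are vectors $\beta$ with exactly one non-zero entry per section, equal to $\sqrt{nP/L}$; the message is uniformly distributed. ML decoder $\hat\beta=\arg\min\|y-A\beta'\|^2$ over valid message vectors. Section error rate $\mathcal{E}_{\textsf{sec}}=\frac1L\sum_\ell\mathbf 1\{\hat\beta_\ell\ne\beta_\ell\}$. Logs are natural. Definitions: $g(x)=\sqrt{1+4x^2}-1$; $w(\textsf{snr})=\frac{\textsf{snr}}{2(1+\textsf{snr})^2\sqrt{4+\textsf{snr}^3/(1+\textsf{snr})}}$; $\mathcal{C}_\alpha=\frac12\log(1+\alpha\,\textsf{snr})$;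 $D_1(\Delta,1-\rho^2)=\max_{0\le\lambda\le1}\{\lambda\Delta+\frac12\log(1-\lambda^2(1-\rho^2))\}$; $$\mathsf a^*_L(\textsf{snr})=\max_{\alpha\in\{\frac1L,\dots,1-\frac1L\}}\frac{R\log\binom{L}{L\alpha}}{D_1\big(\mathcal{C}_\alpha-\alpha\mathcal{C},\ \frac{\alpha(1-\alpha)\textsf{snr}}{1+\alpha\,\textsf{snr}}\big)\,L\log L}.$$ *)

theory Defs
  imports "HOL-Probability.Probability"
begin

(* Valid messages: for each section l < L, the position (< M) of its non-zero entry. *)
definition sparc_msgs :: "nat \<Rightarrow> nat \<Rightarrow> (nat \<Rightarrow> nat) set" where
  "sparc_msgs L M = {..<L} \<rightarrow>\<^sub>E {..<M}"

definition sparc_codeword :: "nat \<Rightarrow> real \<Rightarrow> nat \<Rightarrow> nat \<Rightarrow> (nat \<times> nat \<Rightarrow> real) \<Rightarrow> (nat \<Rightarrow> nat) \<Rightarrow> nat \<Rightarrow> real" where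
  "sparc_codeword n P L M A m i = (\<Sum>j<M*L. A (i, j) *
      (if (\<exists>l<L. j = l * M + m l) then sqrt (real n * P / real L) else 0))"

definition sparc_sqdist :: "nat \<Rightarrow> real \<Rightarrow> nat \<Rightarrow> nat \<Rightarrow> (nat \<times> nat \<Rightarrow> real) \<Rightarrow> (nat \<Rightarrow> real) \<Rightarrow> (nat \<Rightarrow> nat) \<Rightarrow> real" where
  "sparc_sqdist n P L M A y m' = (\<Sum>i<n. (y i - sparc_codeword n P L M A m' i)^2)"

definition sec_err :: "nat \<Rightarrow> (nat \<Rightarrow> nat) \<Rightarrow> (nat \<Rightarrow> nat) \<Rightarrow> real" where
  "sec_err L m m' = real (card {l\<in>{..<L}. m' l \<noteq> m l}) / real L"

definition sparc_space :: "nat \<Rightarrow> nat \<Rightarrow> nat \<Rightarrow> real \<Rightarrow>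
    ((nat \<Rightarrow> nat) \<times> (nat \<times> nat \<Rightarrow> real) \<times> (nat \<Rightarrow> real)) measure" where
  "sparc_space n L M \<sigma> =
     uniform_count_measure (sparc_msgs L M) \<Otimes>\<^sub>M
     ((\<Pi>\<^sub>M ij\<in>{..<n} \<times> {..<M*L}. density lborel (normal_density 0 (sqrt (1 / real n))))
      \<Otimes>\<^sub>M (\<Pi>\<^sub>M i\<in>{..<n}. density lborel (normal_density 0 \<sigma>)))"

definition sparc_err_event :: "nat \<Rightarrow> real \<Rightarrow> nat \<Rightarrow> nat \<Rightarrow> real \<Rightarrow> real \<Rightarrow>
    ((nat \<Rightarrow> nat) \<times> (nat \<times> nat \<Rightarrow> real) \<times> (nat \<Rightarrow> real)) set" where
  "sparc_err_event n P L M \<sigma> \<epsilon> =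
     {(m, A, w) \<in> space (sparc_space n L M \<sigma>).
        let y = (\<lambda>i. sparc_codeword n P L M A m i + w i) in
        \<exists>m'\<in>sparc_msgs L M. (\<forall>m''\<in>sparc_msgs L M. sparc_sqdist n P L M A y m' \<le> sparc_sqdist n P L M A y m'')
                            \<and> sec_err L m m' \<ge> \<epsilon>}"

definition g_fun :: "real \<Rightarrow> real" where
  "g_fun x = sqrt (1 + 4 * x^2) - 1"

definition w_fun :: "real \<Rightarrow> real" where
  "w_fun snr = snr / (2 * (1 + snr)^2 * sqrt (4 + snr^3 / (1 + snr)))"

definition cap_alpha :: "real \<Rightarrow> real \<Rightarrow> real" where
  "cap_alpha \<alpha> snr = ln (1 + \<alpha> * snr) / 2"

definition D1 :: "real \<Rightarrow> real \<Rightarrow> real" where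
  "D1 \<Delta> v = (SUP t\<in>{0..1::real}. t * \<Delta> + ln (1 - t^2 * v) / 2)"

(* a*_L(snr); alpha = k/L with k = 1..L-1, so binom(L, L alpha) = L choose k *)
definition a_star :: "nat \<Rightarrow> real \<Rightarrow> real \<Rightarrow> real" where
  "a_star L R snr = Max ((\<lambda>k. let \<alpha> = real k / real L in
        R * ln (real (L choose k)) /
        (D1 (cap_alpha \<alpha> snr - \<alpha> * cap_alpha 1 snr) (\<alpha> * (1 - \<alpha>) * snr / (1 + \<alpha> * snr))
         * real L * ln (real L))) ` {1..L-1})"

end

theory Submission
  imports Defs
begin

text \<open>Fix the message and count wrong sections: let \<open>k = \<alpha> L\<close> be that number. For a fixed set of wrong
  sections, the wrong columns are independent of the true codeword and the noise, so conditioning on the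
  latter and Gallager's \<open>min 1 x \<le> x powr \<theta>\<close> reduce the error probability to Gaussian moment
  generating functions. There are two ways to do so. The direct one compares the distance to the
  candidate with the noise, and yields the exponent
  \<open>\<theta> (\<delta> + \<alpha> \<Delta>) + ln (1 - \<theta>^2 u') / 2\<close> with \<open>\<delta> = C\<^sub>\<alpha> - \<alpha> C\<close> and \<open>u' = \<alpha> snr / (1 + \<alpha> snr)\<close>. The other one
  first splits off a statistic common to all candidates, at the price of its own large deviation
  term, and improves \<open>u'\<close> to \<open>u = \<alpha> (1 - \<alpha>) snr / (1 + \<alpha> snr)\<close>. The condition on \<open>a\<close> says that the number of sets of
  wrong sections is at most \<open>exp (n D1 \<delta> u)\<close>.

  For small snr the split alone loses a factor 2 against \<open>w_fun\<close>. It is used only when \<open>\<Delta>\<close> is small compared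
  with \<open>\<alpha> snr \<theta>\<close>, where the \<open>g_fun\<close> term governs. Otherwise the direct bound is used, in which all of
  \<open>\<alpha> \<Delta> \<theta>\<close> counts; its disadvantage \<open>u' - u\<close> is of order \<open>\<alpha>\<^sup>2 snr\<close>. It is absorbed by a larger \<open>\<theta>\<close> if
  \<open>\<alpha>\<close> is bounded below, and by the factor \<open>k!\<close> in \<open>L choose k \<le> L ^ k / k!\<close> if \<open>\<alpha>\<close> and snr are small.\<close>

section \<open>Gaussian integrals\<close>

text \<open>Both mechanisms rest on one formula: for jointly centred normal Z1, Z2 of unit variance
  and correlation \<rho>, the expectation of exp (\<theta> (Z1^2 - Z2^2) / 2) is (1 - \<theta>^2 (1
  - \<rho>^2)) to the power -1/2. Let w be the noise, X the part of the true codeword in the wrong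
  sections and Y the whole true codeword. Against w + X, the noise has 1 - \<rho>^2 = u', whereas w
  + \<alpha> Y, the conditional mean of w + X given w and Y, has 1 - \<rho>^2 = u. This is the
  second argument of \<open>D1\<close> in the condition on \<open>a\<close>. The statistic w +
  \<alpha> Y does not depend on which \<alpha> L sections are wrong, so its deviation is paid for
  once, without the factor \<open>L choose k\<close>.

  The obstacle is that \<open>a\<close> may sit exactly at its threshold: counting the sets of wrong
  sections can then use up all of \<open>D1\<close>, and the whole exponent has to come from the gap
  \<alpha> \<Delta>, of which the split spends half on the common statistic. In log 2L, the L counts
  the values of \<open>k\<close>, and the 2 the two exponentials of the split. Where the direct
  bound is used this 2 is spare; for a single wrong section at small \<alpha> and snr it is the only
  margin.\<close>

abbreviation gauss :: "real \<Rightarrow> real measure" where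
  "gauss \<tau> \<equiv> density lborel (normal_density 0 \<tau>)"

lemma prob_space_gauss: "0 < \<tau> \<Longrightarrow> prob_space (gauss \<tau>)"
  by (rule prob_space_normal_density)

lemma nn_integral_gauss_exp_quadratic:
  fixes a b d \<tau> :: real
  assumes \<tau>: "0 < \<tau>" and pos: "0 < 1 + a * \<tau>\<^sup>2"
  shows "(\<integral>\<^sup>+x. ennreal (exp (- (a * x\<^sup>2 + 2 * b * x + d) / 2)) \<partial>gauss \<tau>)
    = ennreal (exp (- (d - b\<^sup>2 * \<tau>\<^sup>2 / (1 + a * \<tau>\<^sup>2)) / 2) / sqrt (1 + a * \<tau>\<^sup>2))"
proof -
  define q where "q = 1 + a * \<tau>\<^sup>2"
  define s where "s = \<tau> / sqrt q"
  define m where "m = - b * \<tau>\<^sup>2 / q"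
  have q: "q > 0" using pos by (simp add: q_def)
  have s: "s > 0" using \<tau> q by (simp add: s_def)
  have s2: "s\<^sup>2 = \<tau>\<^sup>2 / q" using q by (simp add: s_def power_divide)
  have a: "a = (q - 1) / \<tau>\<^sup>2" using \<tau> by (simp add: q_def)
  have sq: "sqrt (2 * pi * s\<^sup>2) = sqrt (2 * pi * \<tau>\<^sup>2) / sqrt q"
    by (simp add: s2 real_sqrt_divide)
  have expo: "- (a * x\<^sup>2 + 2 * b * x + d) / 2 - x\<^sup>2 / (2 * \<tau>\<^sup>2)
      = - (d - b\<^sup>2 * \<tau>\<^sup>2 / q) / 2 - (x - m)\<^sup>2 / (2 * s\<^sup>2)" for x
    using q \<tau> unfolding s2 m_def a
    by (simp add: field_simps power2_eq_square)
  have eq: "normal_density 0 \<tau> x * exp (- (a * x\<^sup>2 + 2 * b * x + d) / 2)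
      = exp (- (d - b\<^sup>2 * \<tau>\<^sup>2 / q) / 2) / sqrt q * normal_density m s x" for x
  proof -
    have "normal_density 0 \<tau> x * exp (- (a * x\<^sup>2 + 2 * b * x + d) / 2)
        = 1 / sqrt (2 * pi * \<tau>\<^sup>2) * exp (- (a * x\<^sup>2 + 2 * b * x + d) / 2 - x\<^sup>2 / (2 * \<tau>\<^sup>2))"
      by (simp add: normal_density_def mult_exp_exp)
    also have "\<dots> = 1 / sqrt (2 * pi * \<tau>\<^sup>2) *
        (exp (- (d - b\<^sup>2 * \<tau>\<^sup>2 / q) / 2) * exp (- (x - m)\<^sup>2 / (2 * s\<^sup>2)))"
      unfolding expo by (simp add: exp_add[symmetric])
    finally show ?thesis
      using q \<tau> unfolding normal_density_def sq by simp
  qed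
  have "(\<integral>\<^sup>+x. ennreal (exp (- (a * x\<^sup>2 + 2 * b * x + d) / 2)) \<partial>gauss \<tau>)
      = (\<integral>\<^sup>+x. ennreal (normal_density 0 \<tau> x * exp (- (a * x\<^sup>2 + 2 * b * x + d) / 2)) \<partial>lborel)"
    by (subst nn_integral_density) (auto simp: ennreal_mult')
  also have "\<dots> = (\<integral>\<^sup>+x. ennreal (exp (- (d - b\<^sup>2 * \<tau>\<^sup>2 / q) / 2) / sqrt q)
      * ennreal (normal_density m s x) \<partial>lborel)"
    using q unfolding eq by (subst ennreal_mult'[symmetric]) auto
  also have "\<dots> = ennreal (exp (- (d - b\<^sup>2 * \<tau>\<^sup>2 / q) / 2) / sqrt q)
      * (\<integral>\<^sup>+x. ennreal (normal_density m s x) \<partial>lborel)"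
    by (rule nn_integral_cmult) auto
  also have "(\<integral>\<^sup>+x. ennreal (normal_density m s x) \<partial>lborel) = 1"
    using s by (subst nn_integral_eq_integral) auto
  finally show ?thesis by (simp add: q_def)
qed

section \<open>Gaussian vectors and sums of independent Gaussian entries\<close>

abbreviation gauss_vec :: "nat \<Rightarrow> real \<Rightarrow> (nat \<Rightarrow> real) measure" where
  "gauss_vec n \<tau> \<equiv> \<Pi>\<^sub>M i\<in>{..<n}. gauss \<tau>"

lemma prob_space_gauss_vec: "0 < \<tau> \<Longrightarrow> prob_space (gauss_vec n \<tau>)"
  by (intro prob_space_PiM prob_space_gauss)

text \<open>The coefficients \<open>b\<close> and \<open>d\<close> vary with the coordinate because
  they hold the variables on which one conditions, such as the noise.\<close>

lemma nn_integral_gauss_vec_exp_quadratic: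
  fixes a \<tau> :: real and b d :: "nat \<Rightarrow> real"
  assumes \<tau>: "0 < \<tau>" and pos: "0 < 1 + a * \<tau>\<^sup>2"
  shows "(\<integral>\<^sup>+x. ennreal (exp (- (\<Sum>i<n. a * (x i)\<^sup>2 + 2 * b i * x i + d i) / 2)) \<partial>gauss_vec n \<tau>)
    = ennreal (exp (- (\<Sum>i<n. d i - (b i)\<^sup>2 * \<tau>\<^sup>2 / (1 + a * \<tau>\<^sup>2)) / 2) / sqrt (1 + a * \<tau>\<^sup>2) ^ n)"
proof -
  interpret product_prob_space "\<lambda>_. gauss \<tau>" "{..<n}"
    by (intro product_prob_spaceI prob_space_gauss \<tau>)
  have e: "ennreal (exp (- (\<Sum>i<n. f i) / 2)) = (\<Prod>i<n. ennreal (exp (- f i / 2)))"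
    for f :: "nat \<Rightarrow> real"
    by (simp add: exp_sum[symmetric] prod_ennreal sum_negf[symmetric] sum_divide_distrib)
  have "(\<integral>\<^sup>+x. ennreal (exp (- (\<Sum>i<n. a * (x i)\<^sup>2 + 2 * b i * x i + d i) / 2)) \<partial>gauss_vec n \<tau>)
    = (\<Prod>i<n. \<integral>\<^sup>+x. ennreal (exp (- (a * x\<^sup>2 + 2 * b i * x + d i) / 2)) \<partial>gauss \<tau>)"
    unfolding e by (intro product_nn_integral_prod) auto
  also have "\<dots> = (\<Prod>i<n. ennreal (exp (- (d i - (b i)\<^sup>2 * \<tau>\<^sup>2 / (1 + a * \<tau>\<^sup>2)) / 2) / sqrt (1 + a * \<tau>\<^sup>2)))"
    by (intro prod.cong refl nn_integral_gauss_exp_quadratic assms)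
  also have "\<dots> = ennreal (\<Prod>i<n. exp (- (d i - (b i)\<^sup>2 * \<tau>\<^sup>2 / (1 + a * \<tau>\<^sup>2)) / 2) / sqrt (1 + a * \<tau>\<^sup>2))"
    using pos by (intro prod_ennreal) auto
  also have "(\<Prod>i<n. exp (- (d i - (b i)\<^sup>2 * \<tau>\<^sup>2 / (1 + a * \<tau>\<^sup>2)) / 2) / sqrt (1 + a * \<tau>\<^sup>2))
     = exp (- (\<Sum>i<n. d i - (b i)\<^sup>2 * \<tau>\<^sup>2 / (1 + a * \<tau>\<^sup>2)) / 2) / sqrt (1 + a * \<tau>\<^sup>2) ^ n"
    by (simp only: prod_dividef prod_constant card_lessThan exp_sum[symmetric, OF finite_lessThan]
        sum_negf[symmetric] sum_divide_distrib[symmetric])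
  finally show ?thesis .
qed

text \<open>What the columns in \<open>J\<close>, each scaled by \<open>c\<close>, contribute to the
  received vector. The restriction to \<open>{..<n}\<close> makes it a point of the product space,
  as an equality of image measures requires.\<close>

definition block_sum :: "nat \<Rightarrow> real \<Rightarrow> nat set \<Rightarrow> (nat \<times> nat \<Rightarrow> real) \<Rightarrow> nat \<Rightarrow> real" where
  "block_sum n c J A = (\<lambda>i\<in>{..<n}. c * (\<Sum>j\<in>J. A (i, j)))"

text \<open>The coordinates of a product measure are independent, functions of disjoint blocks of
  them stay so, and a sum of independent normals is normal. In the application \<open>b\<close> is a
  row and its block consists of the entries of that row in the chosen columns.\<close>

lemma distr_PiM_gauss_sum:
  fixes s c :: real and B :: "'b \<Rightarrow> 'a set"
  assumes s: "s > 0" and c: "c > 0" and I: "finite I"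
    and B: "\<And>b. b \<in> K \<Longrightarrow> B b \<subseteq> I \<and> B b \<noteq> {}" and dis: "disjoint_family_on B K"
    and K: "K \<noteq> {}"
  shows "distr (\<Pi>\<^sub>M x\<in>I. gauss s) (\<Pi>\<^sub>M b\<in>K. borel) (\<lambda>A. \<lambda>b\<in>K. c * (\<Sum>x\<in>B b. A x))
    = (\<Pi>\<^sub>M b\<in>K. gauss (c * s * sqrt (card (B b))))"
proof -
  let ?P = "\<Pi>\<^sub>M x\<in>I. gauss s"
  interpret P: prob_space ?P by (intro prob_space_PiM prob_space_gauss s)
  have I0: "I \<noteq> {}" using B K by blast
  \<comment> \<open>The criterion for independence compares the joint law with a product of laws on
    \<open>borel\<close>, so the identity is read as a map into that space.\<close>
  have id: "distr ?P (\<Pi>\<^sub>M x\<in>I. borel) (\<lambda>A. \<lambda>x\<in>I. A x) = ?P"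
  proof -
    have "distr ?P (\<Pi>\<^sub>M x\<in>I. borel) (\<lambda>A. \<lambda>x\<in>I. A x) = distr ?P ?P (\<lambda>A. A)"
      by (intro distr_cong refl sets_PiM_cong)
        (auto simp: space_PiM PiE_def extensional_def restrict_def fun_eq_iff)
    then show ?thesis by (simp add: distr_id)
  qed
  have comp: "distr ?P borel (\<lambda>A. A x) = gauss s" if "x \<in> I" for x
  proof -
    interpret product_prob_space "\<lambda>_. gauss s" I by (intro product_prob_spaceI prob_space_gauss s)
    have "distr ?P borel (\<lambda>A. A x) = distr ?P (gauss s) (\<lambda>A. A x)"
      by (rule distr_cong) auto
    then show ?thesis using PiM_component[of x] that by simp
  qed
  have ind: "P.indep_vars (\<lambda>_. borel) (\<lambda>x A. A x) I"
    by (subst P.indep_vars_iff_distr_eq_PiM'[OF I0])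
      (auto simp: id comp cong: PiM_cong intro!: measurable_component_singleton)
  have normal: "distributed ?P lborel (\<lambda>A. A x) (normal_density 0 s)" if "x \<in> I" for x
    using comp[OF that] that
    by (auto simp: distributed_def cong: distr_cong)
  have distrB: "distr ?P borel (\<lambda>A. c * (\<Sum>x\<in>B b. A x)) = gauss (c * s * sqrt (card (B b)))"
    if b: "b \<in> K" for b
  proof -
    have fb: "finite (B b)" and nb: "B b \<noteq> {}" and sb: "B b \<subseteq> I"
      using B[OF b] I finite_subset by auto
    have "distributed ?P lborel (\<lambda>A. \<Sum>x\<in>B b. A x)
        (normal_density (\<Sum>x\<in>B b. 0) (sqrt (\<Sum>x\<in>B b. s\<^sup>2)))"
      using sb s by (intro P.sum_indep_normal fb nb P.indep_vars_subset[OF ind sb] normal) auto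
    then have "distributed ?P lborel (\<lambda>A. 0 + c * (\<Sum>x\<in>B b. A x))
        (normal_density (0 + c * 0) (\<bar>c\<bar> * sqrt (\<Sum>x\<in>B b. s\<^sup>2)))"
      using s c fb nb by (intro P.normal_density_affine) (auto simp: card_gt_0_iff)
    moreover have "\<bar>c\<bar> * sqrt (\<Sum>x\<in>B b. s\<^sup>2) = c * s * sqrt (card (B b))"
      using s c by (simp add: real_sqrt_mult)
    ultimately have "distr ?P lborel (\<lambda>A. c * (\<Sum>x\<in>B b. A x)) = gauss (c * s * sqrt (card (B b)))"
      by (simp add: distributed_def)
    then show ?thesis by (simp cong: distr_cong)
  qed
  have "P.indep_vars (\<lambda>b. PiM (B b) (\<lambda>_. borel)) (\<lambda>b A. restrict (\<lambda>x. A x) (B b)) K"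
    by (rule P.indep_vars_restrict[OF ind _ dis]) (use B in auto)
  then have "P.indep_vars (\<lambda>_. borel) (\<lambda>b A. c * (\<Sum>x\<in>B b. restrict (\<lambda>x. A x) (B b) x)) K"
    by (rule P.indep_vars_compose2[where Y="\<lambda>b A. c * (\<Sum>x\<in>B b. A x)"])
      (auto intro!: borel_measurable_times borel_measurable_sum measurable_component_singleton)
  then have ind2: "P.indep_vars (\<lambda>_. borel) (\<lambda>b A. c * (\<Sum>x\<in>B b. A x)) K"
    by simp
  have "distr ?P (\<Pi>\<^sub>M b\<in>K. borel) (\<lambda>A. \<lambda>b\<in>K. c * (\<Sum>x\<in>B b. A x))
      = (\<Pi>\<^sub>M b\<in>K. distr ?P borel (\<lambda>A. c * (\<Sum>x\<in>B b. A x)))"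
    by (rule P.indep_vars_iff_distr_eq_PiM'[OF K, THEN iffD1])
      (use ind2 in \<open>auto simp: P.indep_vars_def\<close>)
  also have "\<dots> = (\<Pi>\<^sub>M b\<in>K. gauss (c * s * sqrt (card (B b))))"
    by (intro PiM_cong refl distrB)
  finally show ?thesis .
qed

section \<open>Resampling a block of columns\<close>

lemma block_sum_cong:
  "(\<And>i j. j \<in> J \<Longrightarrow> A (i, j) = A' (i, j)) \<Longrightarrow> block_sum n c J A = block_sum n c J A'"
  unfolding block_sum_def by (intro restrict_ext arg_cong2[where f="(*)"] sum.cong) auto

text \<open>Nothing at this level refers to sections: only the number of columns in a block matters
  for the law of its sum. The code will be the instance with \<open>C = M * L\<close> and
  \<open>s = sqrt (1 / real n)\<close>.\<close>

locale gauss_channel =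
  fixes n C :: nat and s \<sigma> :: real
  assumes n: "n \<ge> 1" and s: "s > 0" and \<sigma>: "\<sigma> > 0"
begin

abbreviation design :: "(nat \<times> nat \<Rightarrow> real) measure" where
  "design \<equiv> \<Pi>\<^sub>M ij\<in>{..<n} \<times> {..<C}. gauss s"

abbreviation chan :: "((nat \<times> nat \<Rightarrow> real) \<times> (nat \<Rightarrow> real)) measure" where
  "chan \<equiv> design \<Otimes>\<^sub>M gauss_vec n \<sigma>"

abbreviation rows :: "(nat \<Rightarrow> real) measure" where
  "rows \<equiv> \<Pi>\<^sub>M i\<in>{..<n}. borel"

lemma prob_space_mat: "prob_space design"
  by (intro prob_space_PiM prob_space_gauss s)

lemma prob_space_chan: "prob_space chan"
proof -
  interpret a: prob_space design by (rule prob_space_mat)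
  interpret b: prob_space "gauss_vec n \<sigma>" by (rule prob_space_gauss_vec[OF \<sigma>])
  interpret pair_prob_space design "gauss_vec n \<sigma>" ..
  show ?thesis by unfold_locales
qed

lemma distr_block_sum:
  assumes J: "J \<subseteq> {..<C}" "J \<noteq> {}" and c: "c > 0"
  shows "distr (\<Pi>\<^sub>M ij\<in>{..<n} \<times> J. gauss s) rows (block_sum n c J) = gauss_vec n (c * s * sqrt (card J))"
proof -
  have fJ: "finite J" using J finite_subset by blast
  have sum: "(\<Sum>x\<in>{i} \<times> J. A x) = (\<Sum>j\<in>J. A (i, j))" for i and A :: "nat \<times> nat \<Rightarrow> real"
    by (rule sum.reindex_bij_witness[where i="\<lambda>j. (i, j)" and j=snd]) auto
  have "distr (\<Pi>\<^sub>M ij\<in>{..<n} \<times> J. gauss s) rows (\<lambda>A. \<lambda>i\<in>{..<n}. c * (\<Sum>x\<in>{i} \<times> J. A x))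
    = (\<Pi>\<^sub>M i\<in>{..<n}. gauss (c * s * sqrt (card ({i} \<times> J))))"
    using n J by (intro distr_PiM_gauss_sum s c finite_cartesian_product fJ finite_lessThan)
      (auto simp: disjoint_family_on_def lessThan_empty_iff)
  then show ?thesis
    by (simp add: sum block_sum_def[abs_def] card_cartesian_product_singleton)
qed

lemma measurable_block_sum [measurable]:
  assumes "J \<subseteq> {..<C}"
  shows "block_sum n c J \<in> measurable design rows"
  unfolding block_sum_def
proof (intro measurable_restrict borel_measurable_times borel_measurable_sum)
  fix i j assume "i \<in> {..<n}" "j \<in> J"
  then have "(\<lambda>A. A (i, j)) \<in> measurable design (gauss s)"
    using assms by (intro measurable_component_singleton) auto
  then show "(\<lambda>A. A (i, j)) \<in> borel_measurable design" by simp
qed auto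

text \<open>Resampling: the entries in the columns \<open>J\<close> are independent of everything else, so their
  block sum may be replaced by a fresh Gaussian vector.\<close>

lemma nn_integral_resample_mat:
  assumes J: "J \<subseteq> {..<C}" "J \<noteq> {}" and c: "c > 0"
    and [measurable]: "case_prod \<Phi> \<in> borel_measurable (design \<Otimes>\<^sub>M rows)"
    and inv: "\<And>A A' x. (\<And>i j. j \<notin> J \<Longrightarrow> A (i, j) = A' (i, j)) \<Longrightarrow> \<Phi> A x = \<Phi> A' x"
  shows "(\<integral>\<^sup>+A. \<Phi> A (block_sum n c J A) \<partial>design)
    = (\<integral>\<^sup>+A. \<integral>\<^sup>+x. \<Phi> A x \<partial>gauss_vec n (c * s * sqrt (card J)) \<partial>design)"
proof -
  note measurable_block_sum[OF J(1), measurable]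
  interpret product_prob_space "\<lambda>_. gauss s" "{..<n} \<times> {..<C}"
    by (intro product_prob_spaceI prob_space_gauss s)
  let ?I1 = "{..<n} \<times> ({..<C} - J)" and ?I2 = "{..<n} \<times> J"
  let ?M1 = "\<Pi>\<^sub>M ij\<in>?I1. gauss s" and ?M2 = "\<Pi>\<^sub>M ij\<in>?I2. gauss s"
  let ?G = "gauss_vec n (c * s * sqrt (card J))"
  have fJ: "finite J" using J finite_subset by blast
  have I: "{..<n} \<times> {..<C} = ?I1 \<union> ?I2" "?I1 \<inter> ?I2 = {}" using J by auto
  have \<tau>: "c * s * sqrt (card J) > 0" using c s fJ J by (simp add: card_gt_0_iff)
  interpret G: prob_space ?G by (rule prob_space_gauss_vec[OF \<tau>])
  interpret M2: prob_space ?M2 by (intro prob_space_PiM prob_space_gauss s)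
  have setsG [measurable_cong]: "sets ?G = sets rows" by (intro sets_PiM_cong) auto
  \<comment> \<open>By \<open>inv\<close> the columns in \<open>J\<close> may be set to any value
    inside \<open>\<Phi>\<close>. With zeros there, \<open>\<Phi>0\<close> is a function of the
    other columns.\<close>
  define z :: "nat \<times> nat \<Rightarrow> real" where "z = (\<lambda>_\<in>?I2. 0)"
  have z: "z \<in> space ?M2" by (auto simp: z_def space_PiM)
  have mz: "(\<lambda>A1. merge ?I1 ?I2 (A1, z)) \<in> measurable ?M1 design"
    unfolding I(1) using z by measurable
  define \<Phi>0 where "\<Phi>0 A1 = \<Phi> (merge ?I1 ?I2 (A1, z))" for A1
  have inv0: "\<Phi> (merge ?I1 ?I2 (A1, A2)) x = \<Phi>0 A1 x" for A1 A2 x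
    unfolding \<Phi>0_def by (rule inv) (auto simp: merge_def)
  have bs: "block_sum n c J (merge ?I1 ?I2 (A1, A2)) = block_sum n c J A2" for A1 A2
    unfolding block_sum_def
    by (intro restrict_ext arg_cong2[where f="(*)"] sum.cong refl) (auto simp: merge_def)
  have "(\<lambda>A. \<Phi> A (block_sum n c J A)) \<in> borel_measurable design"
    by measurable
  then have "(\<integral>\<^sup>+A. \<Phi> A (block_sum n c J A) \<partial>design)
    = (\<integral>\<^sup>+A1. \<integral>\<^sup>+A2. \<Phi> (merge ?I1 ?I2 (A1, A2)) (block_sum n c J (merge ?I1 ?I2 (A1, A2))) \<partial>?M2 \<partial>?M1)"
    using I(2) fJ unfolding I(1) by (intro product_nn_integral_fold) auto
  also have "\<dots> = (\<integral>\<^sup>+A1. \<integral>\<^sup>+A2. \<Phi>0 A1 (block_sum n c J A2) \<partial>?M2 \<partial>?M1)"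
    by (simp add: bs inv0)
  also have "\<dots> = (\<integral>\<^sup>+A1. \<integral>\<^sup>+x. \<Phi>0 A1 x \<partial>?G \<partial>?M1)"
  proof (intro nn_integral_cong)
    fix A1 assume A1: "A1 \<in> space ?M1"
    then have sp: "merge ?I1 ?I2 (A1, z) \<in> space design"
      using mz by (auto dest: measurable_space)
    have m: "\<Phi>0 A1 \<in> borel_measurable rows"
      using measurable_Pair2[OF assms(4) sp] by (simp add: \<Phi>0_def)
    have mb: "block_sum n c J \<in> measurable ?M2 rows"
      unfolding block_sum_def
    proof (intro measurable_restrict borel_measurable_times borel_measurable_sum)
      fix i j assume "i \<in> {..<n}" "j \<in> J"
      then have "(\<lambda>A. A (i, j)) \<in> measurable ?M2 (gauss s)"
        by (intro measurable_component_singleton) auto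
      then show "(\<lambda>A. A (i, j)) \<in> borel_measurable ?M2" by simp
    qed auto
    show "(\<integral>\<^sup>+A2. \<Phi>0 A1 (block_sum n c J A2) \<partial>?M2) =
        (\<integral>\<^sup>+x. \<Phi>0 A1 x \<partial>?G)"
      unfolding distr_block_sum[OF J c, symmetric]
      by (rule nn_integral_distr[symmetric, OF mb]) (use m in simp)
  qed
  \<comment> \<open>The inner integrand is constant in \<open>A2\<close> and \<open>?M2\<close> has
    mass 1, so the integral over \<open>A2\<close> can be put back to restore the full
    matrix.\<close>
  also have "\<dots> = (\<integral>\<^sup>+A1. \<integral>\<^sup>+A2. \<integral>\<^sup>+x. \<Phi> (merge ?I1 ?I2 (A1, A2)) x \<partial>?G \<partial>?M2 \<partial>?M1)"
    by (simp add: inv0 M2.emeasure_space_1)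
  also have "\<dots> = (\<integral>\<^sup>+A. \<integral>\<^sup>+x. \<Phi> A x \<partial>?G \<partial>design)"
  proof -
    have "(\<lambda>A. \<integral>\<^sup>+x. \<Phi> A x \<partial>?G) \<in> borel_measurable design" by measurable
    then show ?thesis
      using I(2) fJ unfolding I(1) by (intro product_nn_integral_fold[symmetric]) auto
  qed
  finally show ?thesis .
qed

lemma nn_integral_resample:
  assumes J: "J \<subseteq> {..<C}" "J \<noteq> {}" and c: "c > 0"
    and meas: "case_prod \<Phi> \<in> borel_measurable (chan \<Otimes>\<^sub>M rows)"
    and inv: "\<And>A A' w x. (\<And>i j. j \<notin> J \<Longrightarrow> A (i, j) = A' (i, j)) \<Longrightarrow> \<Phi> (A, w) x = \<Phi> (A', w) x"
  shows "(\<integral>\<^sup>+\<omega>. \<Phi> \<omega> (block_sum n c J (fst \<omega>)) \<partial>chan)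
    = (\<integral>\<^sup>+\<omega>. \<integral>\<^sup>+x. \<Phi> \<omega> x \<partial>gauss_vec n (c * s * sqrt (card J)) \<partial>chan)"
proof -
  note meas[measurable] measurable_block_sum[OF J(1), measurable]
  let ?G = "gauss_vec n (c * s * sqrt (card J))"
  have fJ: "finite J" using J finite_subset by blast
  have \<tau>: "c * s * sqrt (card J) > 0" using c s fJ J by (simp add: card_gt_0_iff)
  interpret G: prob_space ?G by (rule prob_space_gauss_vec[OF \<tau>])
  have setsG [measurable_cong]: "sets ?G = sets rows" by (intro sets_PiM_cong) auto
  interpret a: prob_space design by (rule prob_space_mat)
  interpret b: prob_space "gauss_vec n \<sigma>" by (rule prob_space_gauss_vec[OF \<sigma>])
  interpret pair_prob_space design "gauss_vec n \<sigma>" ..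
  have "(\<integral>\<^sup>+\<omega>. \<Phi> \<omega> (block_sum n c J (fst \<omega>)) \<partial>chan)
    = (\<integral>\<^sup>+w. \<integral>\<^sup>+A. \<Phi> (A, w) (block_sum n c J A) \<partial>design \<partial>gauss_vec n \<sigma>)"
    by (subst nn_integral_snd[symmetric]) (auto simp: case_prod_beta')
  also have "\<dots> = (\<integral>\<^sup>+w. \<integral>\<^sup>+A. \<integral>\<^sup>+x. \<Phi> (A, w) x \<partial>?G \<partial>design \<partial>gauss_vec n \<sigma>)"
    by (intro nn_integral_cong nn_integral_resample_mat[OF J c]) (measurable, rule inv, simp)
  also have "\<dots> = (\<integral>\<^sup>+\<omega>. \<integral>\<^sup>+x. \<Phi> \<omega> x \<partial>?G \<partial>chan)"
    by (subst nn_integral_snd[symmetric]) (auto simp: case_prod_beta')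
  finally show ?thesis .
qed

lemma nn_integral_chan_noise:
  assumes [measurable]: "\<phi> \<in> borel_measurable (gauss_vec n \<sigma>)"
  shows "(\<integral>\<^sup>+\<omega>. \<phi> (snd \<omega>) \<partial>chan) = (\<integral>\<^sup>+w. \<phi> w \<partial>gauss_vec n \<sigma>)"
proof -
  interpret a: prob_space design by (rule prob_space_mat)
  interpret b: prob_space "gauss_vec n \<sigma>" by (rule prob_space_gauss_vec[OF \<sigma>])
  interpret pair_prob_space design "gauss_vec n \<sigma>" ..
  show ?thesis
    by (subst nn_integral_snd[symmetric]) (auto simp: case_prod_beta' a.emeasure_space_1)
qed

end

section \<open>Exponential bounds\<close>

text \<open>In the application \<open>K * h\<close> bounds the conditional expected number of wrong candidates. Bounding the
  conditional error probability by \<open>min 1 (K * h) \<le> (K * h) powr \<theta>\<close> is Gallager's device for weakening the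
  union bound.\<close>

lemma union_powr_bound:
  fixes K :: real and h :: "'a \<Rightarrow> real" and M :: "'a measure"
  assumes Ms: "finite Ms" "card Ms \<le> K" and K: "K > 0" and \<theta>: "0 \<le> \<theta>" "\<theta> \<le> 1"
    and [measurable]: "h \<in> borel_measurable M" and h: "\<And>x. h x > 0"
    and E: "\<And>m. m \<in> Ms \<Longrightarrow> E m \<in> sets M"
    and le: "\<And>m. m \<in> Ms \<Longrightarrow> (\<integral>\<^sup>+x. indicator (E m) x * indicator {x. K * h x < 1} x \<partial>M)
      \<le> (\<integral>\<^sup>+x. ennreal (h x) * indicator {x. K * h x < 1} x \<partial>M)"
  shows "emeasure M (\<Union>m\<in>Ms. E m) \<le> (\<integral>\<^sup>+x. ennreal ((K * h x) powr \<theta>) \<partial>M)"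
proof -
  note E[measurable]
  let ?I = "\<lambda>x. indicator {x. K * h x < 1} x :: ennreal"
  let ?J = "\<lambda>x. indicator {x. 1 \<le> K * h x} x :: ennreal"
  have U: "(\<Union>m\<in>Ms. E m) \<in> sets M" using Ms E by (intro sets.finite_UN) auto
  have "emeasure M (\<Union>m\<in>Ms. E m) = (\<integral>\<^sup>+x. indicator (\<Union>m\<in>Ms. E m) x \<partial>M)"
    using U by simp
  \<comment> \<open>Where K h is at least 1 the claimed bound is at least 1 by itself; the union
    bound serves on the complement only. The indicator of that complement depends on the data
    conditioned on, so the integrated hypothesis \<open>le\<close> acts as a bound on a conditional
    probability.\<close>
  also have "\<dots> \<le> (\<integral>\<^sup>+x. ?J x + (\<Sum>m\<in>Ms. indicator (E m) x * ?I x) \<partial>M)"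
  proof (intro nn_integral_mono)
    fix x
    show "(indicator (\<Union>m\<in>Ms. E m) x :: ennreal) \<le> ?J x + (\<Sum>m\<in>Ms. indicator (E m) x * ?I x)"
    proof (cases "x \<in> (\<Union>m\<in>Ms. E m) \<and> K * h x < 1")
      case True
      then obtain m where m: "m \<in> Ms" "x \<in> E m" by auto
      have "(1::ennreal) = indicator (E m) x * ?I x" using m True by simp
      also have "\<dots> \<le> (\<Sum>m\<in>Ms. indicator (E m) x * ?I x)"
        by (rule member_le_sum) (use m Ms in auto)
      finally show ?thesis using True by simp
    next
      case False
      then show ?thesis by (auto simp: indicator_def)
    qed
  qed
  also have "\<dots> = (\<integral>\<^sup>+x. ?J x \<partial>M) + (\<Sum>m\<in>Ms. \<integral>\<^sup>+x. indicator (E m) x * ?I x \<partial>M)"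
    by (subst nn_integral_add) (auto simp: nn_integral_sum E intro!: borel_measurable_sum)
  also have "\<dots> \<le> (\<integral>\<^sup>+x. ?J x \<partial>M) + (\<Sum>m\<in>Ms. \<integral>\<^sup>+x. ennreal (h x) * ?I x \<partial>M)"
    by (intro add_left_mono sum_mono le)
  also have "\<dots> = (\<integral>\<^sup>+x. ?J x \<partial>M) + of_nat (card Ms) * (\<integral>\<^sup>+x. ennreal (h x) * ?I x \<partial>M)"
    by simp
  also have "\<dots> \<le> (\<integral>\<^sup>+x. ?J x \<partial>M) + ennreal K * (\<integral>\<^sup>+x. ennreal (h x) * ?I x \<partial>M)"
    using Ms K by (intro add_left_mono mult_right_mono)
      (auto simp: ennreal_of_nat_eq_real_of_nat intro!: ennreal_leI)
  also have "\<dots> = (\<integral>\<^sup>+x. ?J x + ennreal K * (ennreal (h x) * ?I x) \<partial>M)"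
    by (simp add: nn_integral_add nn_integral_cmult)
  also have "\<dots> \<le> (\<integral>\<^sup>+x. ennreal ((K * h x) powr \<theta>) \<partial>M)"
  proof (intro nn_integral_mono)
    fix x
    show "?J x + ennreal K * (ennreal (h x) * ?I x) \<le> ennreal ((K * h x) powr \<theta>)"
    proof (cases "K * h x < 1")
      case True
      have "(K * h x) powr 1 \<le> (K * h x) powr \<theta>"
        using True \<theta> K h[of x] by (intro powr_mono') auto
      then have "K * h x \<le> (K * h x) powr \<theta>"
        using K h[of x] by simp
      then show ?thesis
        using True K h[of x] by (auto simp: ennreal_mult'[symmetric] intro!: ennreal_leI)
    next
      case False
      have "1 \<le> (K * h x) powr \<theta>" using False \<theta> by (intro ge_one_powr_ge_zero) auto
      then show ?thesis using False by (auto intro: ennreal_leI simp flip: ennreal_1)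
    qed
  qed
  finally show ?thesis .
qed

context gauss_channel
begin

text \<open>\<open>U\<close> is the noise plus the true columns; the candidate's columns are
  resampled as an independent vector \<open>x\<close>. Bounding the indicator by exp (T + Q - D) and
  integrating over \<open>x\<close> gives \<open>h\<close>. The reference \<open>Q\<close> may
  depend on everything except the candidates' columns: it will be the noise energy in the direct
  bound and the common statistic in the split.\<close>

lemma union_bound:
  fixes K :: real and Q :: "(nat \<times> nat \<Rightarrow> real) \<times> (nat \<Rightarrow> real) \<Rightarrow> real" and J' :: "'m \<Rightarrow> nat set"
  assumes Ms: "finite Ms" "card Ms \<le> K" and K: "K > 0" and \<theta>: "0 \<le> \<theta>" "\<theta> \<le> 1"
    and J: "J \<subseteq> {..<C}" and c: "c > 0" and k: "k \<ge> 1"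
    and Q [measurable]: "Q \<in> borel_measurable chan"
    and J': "\<And>m. m \<in> Ms \<Longrightarrow> J' m \<subseteq> {..<C} \<and> card (J' m) = k \<and> J' m \<inter> J = {}"
    and inv: "\<And>m A A' w. m \<in> Ms \<Longrightarrow> (\<And>i j. j \<notin> J' m \<Longrightarrow> A (i, j) = A' (i, j)) \<Longrightarrow> Q (A, w) = Q (A', w)"
  defines "U \<equiv> \<lambda>\<omega> i. snd \<omega> i + block_sum n c J (fst \<omega>) i"
    and "\<tau> \<equiv> c * s * sqrt k"
  shows "emeasure chan {\<omega> \<in> space chan. \<exists>m\<in>Ms.
      (\<Sum>i<n. (U \<omega> i - block_sum n c (J' m) (fst \<omega>) i)\<^sup>2) / (2 * \<sigma>\<^sup>2) - Q \<omega> \<le> T}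
    \<le> (\<integral>\<^sup>+\<omega>. ennreal ((K * (exp (T + Q \<omega> - (\<Sum>i<n. (U \<omega> i)\<^sup>2) / (2 * (\<sigma>\<^sup>2 + \<tau>\<^sup>2)))
        / sqrt (1 + \<tau>\<^sup>2 / \<sigma>\<^sup>2) ^ n)) powr \<theta>) \<partial>chan)"
proof -
  have \<tau>: "\<tau> > 0" using c s k by (simp add: \<tau>_def)
  have q: "1 + 1 / \<sigma>\<^sup>2 * \<tau>\<^sup>2 > 0" using \<sigma> \<tau> by (simp add: add_pos_nonneg)
  note measurable_block_sum[OF J, measurable]
  have mw [measurable]: "(\<lambda>\<omega>. snd \<omega> i) \<in> borel_measurable chan" if "i < n" for i
  proof -
    have "(\<lambda>w. w i) \<in> measurable (gauss_vec n \<sigma>) (gauss \<sigma>)" using that by simp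
    then have "(\<lambda>w. w i) \<in> borel_measurable (gauss_vec n \<sigma>)" by simp
    then show ?thesis by measurable
  qed
  have mb [measurable]: "(\<lambda>\<omega>. block_sum n c J0 (fst \<omega>) i) \<in> borel_measurable chan"
    if "i < n" "J0 \<subseteq> {..<C}" for i J0
  proof -
    have "(\<lambda>x. x i) \<in> borel_measurable rows" using that by simp
    from measurable_compose[OF measurable_compose[OF measurable_fst measurable_block_sum[OF that(2)]] this]
    show ?thesis .
  qed
  have mU [measurable]: "(\<lambda>\<omega>. U \<omega> i) \<in> borel_measurable chan" if "i < n" for i
    unfolding U_def using that J by measurable
  have mx [measurable]: "(\<lambda>x. x i) \<in> borel_measurable rows" if "i < n" for i
    using that by simp
  define D where "D \<omega> x = (\<Sum>i<n. (U \<omega> i - x i)\<^sup>2) / (2 * \<sigma>\<^sup>2)" for \<omega> x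
  \<comment> \<open>The conditional mean of exp (T + Q - D): averaging over \<open>x\<close> widens
    the variance from \<sigma>^2 to \<sigma>^2 + \<tau>^2, and the power of the root is the
    normalisation.\<close>
  define h where "h \<omega> = exp (T + Q \<omega> - (\<Sum>i<n. (U \<omega> i)\<^sup>2) / (2 * (\<sigma>\<^sup>2 + \<tau>\<^sup>2)))
        / sqrt (1 + \<tau>\<^sup>2 / \<sigma>\<^sup>2) ^ n" for \<omega>
  have hpos: "h \<omega> > 0" for \<omega> unfolding h_def using \<sigma> \<tau> by (simp add: add_pos_nonneg)
  have mh [measurable]: "h \<in> borel_measurable chan"
    unfolding h_def by measurable
  define E where "E m = {\<omega> \<in> space chan. D \<omega> (block_sum n c (J' m) (fst \<omega>)) - Q \<omega> \<le> T}" for m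
  have mD: "(\<lambda>\<omega>. D \<omega> (block_sum n c (J' m) (fst \<omega>))) \<in> borel_measurable chan" if "m \<in> Ms" for m
    unfolding D_def using J'[OF that]
    by (intro borel_measurable_divide borel_measurable_sum borel_measurable_power
        borel_measurable_diff mU mb borel_measurable_const) auto
  have mE: "E m \<in> sets chan" if "m \<in> Ms" for m
    using mD[OF that] unfolding E_def by measurable
  have inner: "(\<integral>\<^sup>+x. ennreal (exp (T + Q \<omega> - D \<omega> x)) \<partial>gauss_vec n \<tau>) = ennreal (h \<omega>)" for \<omega>
  proof -
    have "(\<integral>\<^sup>+x. ennreal (exp (T + Q \<omega> - D \<omega> x)) \<partial>gauss_vec n \<tau>)
      = (\<integral>\<^sup>+x. ennreal (exp (T + Q \<omega>)) * ennreal (exp (- (\<Sum>i<n. 1 / \<sigma>\<^sup>2 * (x i)\<^sup>2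
          + 2 * (- U \<omega> i / \<sigma>\<^sup>2) * x i + (U \<omega> i)\<^sup>2 / \<sigma>\<^sup>2) / 2)) \<partial>gauss_vec n \<tau>)"
    proof (intro nn_integral_cong)
      fix x
      have "D \<omega> x = (\<Sum>i<n. 1 / \<sigma>\<^sup>2 * (x i)\<^sup>2 + 2 * (- U \<omega> i / \<sigma>\<^sup>2) * x i + (U \<omega> i)\<^sup>2 / \<sigma>\<^sup>2) / 2"
        unfolding D_def sum_divide_distrib
        by (intro sum.cong refl) (use \<sigma> in \<open>simp add: field_simps power2_eq_square\<close>)
      then show "ennreal (exp (T + Q \<omega> - D \<omega> x)) = ennreal (exp (T + Q \<omega>)) * ennreal (exp (- (\<Sum>i<n. 1 / \<sigma>\<^sup>2 * (x i)\<^sup>2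
          + 2 * (- U \<omega> i / \<sigma>\<^sup>2) * x i + (U \<omega> i)\<^sup>2 / \<sigma>\<^sup>2) / 2))"
        by (simp add: ennreal_mult'[symmetric] mult_exp_exp)
    qed
    also have "\<dots> = ennreal (exp (T + Q \<omega>)) * ennreal (exp (- (\<Sum>i<n. (U \<omega> i)\<^sup>2 / \<sigma>\<^sup>2
        - (- U \<omega> i / \<sigma>\<^sup>2)\<^sup>2 * \<tau>\<^sup>2 / (1 + 1 / \<sigma>\<^sup>2 * \<tau>\<^sup>2)) / 2) / sqrt (1 + 1 / \<sigma>\<^sup>2 * \<tau>\<^sup>2) ^ n)"
      by (subst nn_integral_cmult, measurable, subst nn_integral_gauss_vec_exp_quadratic[OF \<tau> q]) simp
    also have "- (\<Sum>i<n. (U \<omega> i)\<^sup>2 / \<sigma>\<^sup>2 - (- U \<omega> i / \<sigma>\<^sup>2)\<^sup>2 * \<tau>\<^sup>2 / (1 + 1 / \<sigma>\<^sup>2 * \<tau>\<^sup>2)) / 2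
      = - ((\<Sum>i<n. (U \<omega> i)\<^sup>2) / (2 * (\<sigma>\<^sup>2 + \<tau>\<^sup>2)))"
      unfolding minus_divide_left[symmetric] neg_equal_iff_equal sum_divide_distrib
    proof (intro sum.cong refl)
      fix i
      have p: "\<sigma>\<^sup>2 + \<tau>\<^sup>2 > 0" "\<sigma>\<^sup>2 > 0" using \<sigma> by (auto simp: add_pos_nonneg)
      have e: "1 + 1 / \<sigma>\<^sup>2 * \<tau>\<^sup>2 = (\<sigma>\<^sup>2 + \<tau>\<^sup>2) / \<sigma>\<^sup>2" using p by (simp add: field_simps)
      have "u / a - (- U \<omega> i / a)\<^sup>2 * t / ((a + t) / a) = u / (a + t)"
        if "u = (U \<omega> i)\<^sup>2" "a > 0" "a + t > 0" for u a t
      proof -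
        define p where "p = a + t"
        have t: "t = p - a" and "p > 0" using that by (auto simp: p_def)
        then show ?thesis using that by (simp add: t field_simps power2_eq_square)
      qed
      then show "((U \<omega> i)\<^sup>2 / \<sigma>\<^sup>2 - (- (U \<omega> i / \<sigma>\<^sup>2))\<^sup>2 * \<tau>\<^sup>2 / (1 + 1 / \<sigma>\<^sup>2 * \<tau>\<^sup>2)) / 2
        = (U \<omega> i)\<^sup>2 / (2 * (\<sigma>\<^sup>2 + \<tau>\<^sup>2))"
        unfolding e using p by simp
    qed
    finally show ?thesis
      by (simp add: ennreal_mult'[symmetric] h_def exp_diff exp_minus field_simps)
  qed
  have setsG: "sets (gauss_vec n \<tau>) = sets rows" by (intro sets_PiM_cong) auto
  have "emeasure chan (\<Union>m\<in>Ms. E m) \<le> (\<integral>\<^sup>+\<omega>. ennreal ((K * h \<omega>) powr \<theta>) \<partial>chan)"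
  proof (rule union_powr_bound[OF Ms K \<theta> mh hpos mE])
    fix m assume m: "m \<in> Ms"
    note Jm = J'[OF m]
    have Jne: "J' m \<noteq> {}" using Jm k by auto
    let ?I = "\<lambda>\<omega>. indicator {x. K * h x < 1} \<omega> :: ennreal"
    let ?\<Phi> = "\<lambda>\<omega> x. ennreal (exp (T + Q \<omega> - D \<omega> x)) * ?I \<omega>"
    have "(\<integral>\<^sup>+\<omega>. indicator (E m) \<omega> * ?I \<omega> \<partial>chan)
      \<le> (\<integral>\<^sup>+\<omega>. ?\<Phi> \<omega> (block_sum n c (J' m) (fst \<omega>)) \<partial>chan)"
      by (intro nn_integral_mono mult_right_mono)
        (auto simp: E_def indicator_def simp flip: ennreal_1 intro!: ennreal_leI)
    also have "\<dots> = (\<integral>\<^sup>+\<omega>. \<integral>\<^sup>+x. ?\<Phi> \<omega> x \<partial>gauss_vec n (c * s * sqrt (card (J' m))) \<partial>chan)"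
    proof (rule nn_integral_resample)
      show "case_prod ?\<Phi> \<in> borel_measurable (chan \<Otimes>\<^sub>M rows)"
        unfolding D_def case_prod_beta' by measurable
      fix A A' :: "nat \<times> nat \<Rightarrow> real" and w x
      assume eq: "\<And>i j. j \<notin> J' m \<Longrightarrow> A (i, j) = A' (i, j)"
      have Qeq: "Q (A, w) = Q (A', w)" by (rule inv[OF m]) (rule eq)
      have "block_sum n c J A = block_sum n c J A'"
        by (rule block_sum_cong) (use eq Jm in blast)
      then have Ueq: "U (A, w) = U (A', w)" by (simp add: U_def fun_eq_iff)
      have "D (A, w) x = D (A', w) x" "h (A, w) = h (A', w)"
        by (simp_all add: D_def h_def Ueq Qeq)
      then show "?\<Phi> (A, w) x = ?\<Phi> (A', w) x" by (simp add: Qeq indicator_def)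
    qed (use Jm Jne c in auto)
    also have "\<dots> = (\<integral>\<^sup>+\<omega>. (\<integral>\<^sup>+x. ennreal (exp (T + Q \<omega> - D \<omega> x)) \<partial>gauss_vec n \<tau>) * ?I \<omega> \<partial>chan)"
    proof (intro nn_integral_cong)
      fix \<omega>
      have "(\<lambda>x. ennreal (exp (T + Q \<omega> - D \<omega> x))) \<in> borel_measurable rows"
        unfolding D_def by measurable
      then have "(\<lambda>x. ennreal (exp (T + Q \<omega> - D \<omega> x))) \<in> borel_measurable (gauss_vec n \<tau>)"
        by (simp cong: measurable_cong_sets add: setsG)
      then show "(\<integral>\<^sup>+x. ?\<Phi> \<omega> x \<partial>gauss_vec n (c * s * sqrt (card (J' m))))
        = (\<integral>\<^sup>+x. ennreal (exp (T + Q \<omega> - D \<omega> x)) \<partial>gauss_vec n \<tau>) * ?I \<omega>"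
        using Jm by (simp add: \<tau>_def nn_integral_multc)
    qed
    finally show "(\<integral>\<^sup>+\<omega>. indicator (E m) \<omega> * ?I \<omega> \<partial>chan) \<le> (\<integral>\<^sup>+\<omega>. ennreal (h \<omega>) * ?I \<omega> \<partial>chan)"
      unfolding inner .
  qed
  moreover have "(\<Union>m\<in>Ms. E m) = {\<omega> \<in> space chan. \<exists>m\<in>Ms.
      (\<Sum>i<n. (U \<omega> i - block_sum n c (J' m) (fst \<omega>) i)\<^sup>2) / (2 * \<sigma>\<^sup>2) - Q \<omega> \<le> T}"
    by (auto simp: E_def D_def)
  ultimately show ?thesis by (simp add: h_def)
qed

end

section \<open>Moment generating functions of differences of Gaussian quadratic forms\<close>

lemma powr_exp_div_sqrt_power:
  fixes K T q Z \<theta> :: real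
  assumes "K > 0" "q > 0"
  shows "(K * (exp (T + Z) / sqrt q ^ n)) powr \<theta>
    = exp (\<theta> * (ln K + T) - n / 2 * (\<theta> * ln q)) * exp (\<theta> * Z)"
proof -
  have s: "sqrt q ^ n = exp (n / 2 * ln q)"
  proof -
    have "sqrt q ^ n = exp (n * ln (sqrt q))"
      using assms by (simp add: exp_of_nat_mult)
    then show ?thesis using assms by (simp add: ln_sqrt)
  qed
  have "K * (exp (T + Z) / sqrt q ^ n) = exp (ln K + T + Z - n / 2 * ln q)"
    using assms unfolding s by (simp add: exp_add exp_diff)
  then show ?thesis
    by (simp add: powr_def exp_add[symmetric] algebra_simps)
qed

lemma inverse_sqrt_power_eq_exp:
  assumes "q > 0"
  shows "1 / sqrt q ^ n = exp (- (real n / 2) * ln q)"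
proof -
  have "exp (- (real n / 2) * ln q) = 1 / exp (real n * ln (sqrt q))"
    using assms by (simp add: ln_sqrt exp_minus field_simps)
  also have "exp (real n * ln (sqrt q)) = sqrt q ^ n"
    using assms by (simp add: exp_of_nat_mult)
  finally show ?thesis by simp
qed

context gauss_channel
begin

lemma measurable_noise [measurable]:
  assumes "i < n" shows "(\<lambda>\<omega>. snd \<omega> i) \<in> borel_measurable chan"
proof -
  have "(\<lambda>w. w i) \<in> measurable (gauss_vec n \<sigma>) (gauss \<sigma>)" using assms by simp
  then have "(\<lambda>w. w i) \<in> borel_measurable (gauss_vec n \<sigma>)" by simp
  then show ?thesis by measurable
qed

lemma measurable_block_sum_comp:
  assumes "i < n" "J \<subseteq> {..<C}"
  shows "(\<lambda>\<omega>. block_sum n c J (fst \<omega>) i) \<in> borel_measurable chan"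
proof -
  have "(\<lambda>x. x i) \<in> borel_measurable rows" using assms by simp
  from measurable_compose[OF measurable_compose[OF measurable_fst measurable_block_sum[OF assms(2)]] this]
  show ?thesis .
qed

text \<open>Integrating out the block for fixed noise leaves a quadratic form in the noise with
  coefficient d - b^2 \<tau>^2 / (1 + a \<tau>^2). The product under the root is the determinant (1
  + a \<tau>^2) (1 + d \<sigma>^2) - b^2 \<tau>^2 \<sigma>^2.\<close>

lemma nn_integral_exp_quadratic_block:
  fixes a b d c :: real
  assumes J: "J \<subseteq> {..<C}" "J \<noteq> {}" and c: "c > 0"
  defines "\<tau> \<equiv> c * s * sqrt (card J)"
  assumes p1: "1 + a * \<tau>\<^sup>2 > 0" and p2: "1 + (d - b\<^sup>2 * \<tau>\<^sup>2 / (1 + a * \<tau>\<^sup>2)) * \<sigma>\<^sup>2 > 0"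
  shows "(\<integral>\<^sup>+\<omega>. ennreal (exp (- (\<Sum>i<n. a * (block_sum n c J (fst \<omega>) i)\<^sup>2
        + 2 * (b * snd \<omega> i) * block_sum n c J (fst \<omega>) i + d * (snd \<omega> i)\<^sup>2) / 2)) \<partial>chan)
    = ennreal (1 / sqrt ((1 + a * \<tau>\<^sup>2) * (1 + (d - b\<^sup>2 * \<tau>\<^sup>2 / (1 + a * \<tau>\<^sup>2)) * \<sigma>\<^sup>2)) ^ n)"
proof -
  have fJ: "finite J" using J finite_subset by blast
  have \<tau>: "\<tau> > 0" using c s fJ J by (simp add: card_gt_0_iff \<tau>_def)
  have mx [measurable]: "(\<lambda>x. x i) \<in> borel_measurable rows" if "i < n" for i
    using that by simp
  have mw [measurable]: "(\<lambda>x. x i) \<in> borel_measurable (gauss_vec n \<sigma>)" if "i < n" for i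
  proof -
    have "(\<lambda>w. w i) \<in> measurable (gauss_vec n \<sigma>) (gauss \<sigma>)" using that by simp
    then show ?thesis by simp
  qed
  define e where "e = d - b\<^sup>2 * \<tau>\<^sup>2 / (1 + a * \<tau>\<^sup>2)"
  let ?\<Phi> = "\<lambda>\<omega> x. ennreal (exp (- (\<Sum>i<n. a * (x i)\<^sup>2 + 2 * (b * snd \<omega> i) * x i + d * (snd \<omega> i)\<^sup>2) / 2))"
  have "(\<integral>\<^sup>+\<omega>. ?\<Phi> \<omega> (block_sum n c J (fst \<omega>)) \<partial>chan)
    = (\<integral>\<^sup>+\<omega>. \<integral>\<^sup>+x. ?\<Phi> \<omega> x \<partial>gauss_vec n \<tau> \<partial>chan)"
    unfolding \<tau>_def
  proof (rule nn_integral_resample[OF J c])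
    show "case_prod ?\<Phi> \<in> borel_measurable (chan \<Otimes>\<^sub>M rows)"
      unfolding case_prod_beta' by measurable
  qed simp
  also have "\<dots> = (\<integral>\<^sup>+\<omega>. ennreal (exp (- (\<Sum>i<n. d * (snd \<omega> i)\<^sup>2 - (b * snd \<omega> i)\<^sup>2 * \<tau>\<^sup>2 / (1 + a * \<tau>\<^sup>2)) / 2)
      / sqrt (1 + a * \<tau>\<^sup>2) ^ n) \<partial>chan)"
    by (intro nn_integral_cong nn_integral_gauss_vec_exp_quadratic \<tau> p1)
  also have "\<dots> = (\<integral>\<^sup>+\<omega>. ennreal (1 / sqrt (1 + a * \<tau>\<^sup>2) ^ n)
      * ennreal (exp (- (\<Sum>i<n. e * (snd \<omega> i)\<^sup>2 + 2 * 0 * snd \<omega> i + 0) / 2)) \<partial>chan)"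
  proof (intro nn_integral_cong)
    fix \<omega> :: "(nat \<times> nat \<Rightarrow> real) \<times> (nat \<Rightarrow> real)"
    have "(\<Sum>i<n. d * (snd \<omega> i)\<^sup>2 - (b * snd \<omega> i)\<^sup>2 * \<tau>\<^sup>2 / (1 + a * \<tau>\<^sup>2))
      = (\<Sum>i<n. e * (snd \<omega> i)\<^sup>2 + 2 * 0 * snd \<omega> i + 0)"
      by (intro sum.cong refl) (simp add: e_def power_mult_distrib left_diff_distrib)
    then show "ennreal (exp (- (\<Sum>i<n. d * (snd \<omega> i)\<^sup>2 - (b * snd \<omega> i)\<^sup>2 * \<tau>\<^sup>2 / (1 + a * \<tau>\<^sup>2)) / 2)
      / sqrt (1 + a * \<tau>\<^sup>2) ^ n) = ennreal (1 / sqrt (1 + a * \<tau>\<^sup>2) ^ n)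
      * ennreal (exp (- (\<Sum>i<n. e * (snd \<omega> i)\<^sup>2 + 2 * 0 * snd \<omega> i + 0) / 2))"
      using p1 by (simp only: ) (simp add: ennreal_mult''[symmetric])
  qed
  also have "\<dots> = ennreal (1 / sqrt (1 + a * \<tau>\<^sup>2) ^ n) *
      (\<integral>\<^sup>+\<omega>. ennreal (exp (- (\<Sum>i<n. e * (snd \<omega> i)\<^sup>2 + 2 * 0 * snd \<omega> i + 0) / 2)) \<partial>chan)"
    by (rule nn_integral_cmult) measurable
  also have "(\<integral>\<^sup>+\<omega>. ennreal (exp (- (\<Sum>i<n. e * (snd \<omega> i)\<^sup>2 + 2 * 0 * snd \<omega> i + 0) / 2)) \<partial>chan)
     = (\<integral>\<^sup>+w. ennreal (exp (- (\<Sum>i<n. e * (w i)\<^sup>2 + 2 * 0 * w i + 0) / 2)) \<partial>gauss_vec n \<sigma>)"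
    by (rule nn_integral_chan_noise) measurable
  also have "\<dots> = ennreal (exp (- (\<Sum>i<n. 0 - 0\<^sup>2 * \<sigma>\<^sup>2 / (1 + e * \<sigma>\<^sup>2)) / 2) / sqrt (1 + e * \<sigma>\<^sup>2) ^ n)"
    using p2 by (intro nn_integral_gauss_vec_exp_quadratic \<sigma>) (simp add: e_def)
  finally show ?thesis
    using p1 p2 unfolding e_def[symmetric]
    by (simp add: ennreal_mult'[symmetric] real_sqrt_mult power_mult_distrib)
qed

text \<open>The correlation formula for the noise w and w + X, whose squared correlation is
  \<sigma>^2 / (\<sigma>^2 + \<tau>^2). The hypothesis bounds \<theta>^2 (1 - \<rho>^2) instead of
  \<theta>, because the common statistic is later tilted by a multiplier that may exceed 1.\<close>

lemma noise_mgf: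
  assumes J: "J \<subseteq> {..<C}" "J \<noteq> {}" and c: "c > 0"
  defines "\<tau> \<equiv> c * s * sqrt (card J)"
  assumes \<theta>: "\<theta> \<ge> 0" and lt: "\<theta>\<^sup>2 * (\<tau>\<^sup>2 / (\<sigma>\<^sup>2 + \<tau>\<^sup>2)) < 1"
  shows "(\<integral>\<^sup>+\<omega>. ennreal (exp (\<theta> * ((\<Sum>i<n. (snd \<omega> i)\<^sup>2) / (2 * \<sigma>\<^sup>2)
      - (\<Sum>i<n. (snd \<omega> i + block_sum n c J (fst \<omega>) i)\<^sup>2) / (2 * (\<sigma>\<^sup>2 + \<tau>\<^sup>2))))) \<partial>chan)
    = ennreal (exp (- (real n / 2) * ln (1 - \<theta>\<^sup>2 * (\<tau>\<^sup>2 / (\<sigma>\<^sup>2 + \<tau>\<^sup>2)))))"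
proof -
  define a where "a = \<theta> / (\<sigma>\<^sup>2 + \<tau>\<^sup>2)"
  define d where "d = a - \<theta> / \<sigma>\<^sup>2"
  have pos: "\<sigma>\<^sup>2 + \<tau>\<^sup>2 > 0" "\<sigma>\<^sup>2 > 0" using \<sigma> by (auto simp: add_pos_nonneg)
  have a0: "a \<ge> 0" using \<theta> pos by (simp add: a_def)
  have p1: "1 + a * \<tau>\<^sup>2 > 0" using a0 by (simp add: add_pos_nonneg)
  have id: "(1 + a * \<tau>\<^sup>2) * (1 + (d - a\<^sup>2 * \<tau>\<^sup>2 / (1 + a * \<tau>\<^sup>2)) * \<sigma>\<^sup>2) = 1 - \<theta>\<^sup>2 * (\<tau>\<^sup>2 / (\<sigma>\<^sup>2 + \<tau>\<^sup>2))"
  proof -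
    have "(1 + a * \<tau>\<^sup>2) * (1 + (d - a\<^sup>2 * \<tau>\<^sup>2 / (1 + a * \<tau>\<^sup>2)) * \<sigma>\<^sup>2)
      = (1 + a * \<tau>\<^sup>2) + d * \<sigma>\<^sup>2 * (1 + a * \<tau>\<^sup>2) - a\<^sup>2 * \<tau>\<^sup>2 * \<sigma>\<^sup>2"
      using p1 by (simp add: field_simps)
    also have "d * \<sigma>\<^sup>2 = a * \<sigma>\<^sup>2 - \<theta>" using pos by (simp add: d_def left_diff_distrib)
    also have "1 + a * \<tau>\<^sup>2 + (a * \<sigma>\<^sup>2 - \<theta>) * (1 + a * \<tau>\<^sup>2) - a\<^sup>2 * \<tau>\<^sup>2 * \<sigma>\<^sup>2
      = 1 + a * (\<sigma>\<^sup>2 + \<tau>\<^sup>2) - \<theta> - \<theta> * (a * \<tau>\<^sup>2)"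
      by (simp add: algebra_simps power2_eq_square)
    also have "a * (\<sigma>\<^sup>2 + \<tau>\<^sup>2) = \<theta>" using pos by (simp add: a_def)
    finally show ?thesis by (simp add: a_def power2_eq_square)
  qed
  have p2: "1 + (d - a\<^sup>2 * \<tau>\<^sup>2 / (1 + a * \<tau>\<^sup>2)) * \<sigma>\<^sup>2 > 0"
    using id lt p1 by (metis diff_gt_0_iff_gt zero_less_mult_pos)
  have "(\<integral>\<^sup>+\<omega>. ennreal (exp (\<theta> * ((\<Sum>i<n. (snd \<omega> i)\<^sup>2) / (2 * \<sigma>\<^sup>2)
      - (\<Sum>i<n. (snd \<omega> i + block_sum n c J (fst \<omega>) i)\<^sup>2) / (2 * (\<sigma>\<^sup>2 + \<tau>\<^sup>2))))) \<partial>chan)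
    = (\<integral>\<^sup>+\<omega>. ennreal (exp (- (\<Sum>i<n. a * (block_sum n c J (fst \<omega>) i)\<^sup>2
        + 2 * (a * snd \<omega> i) * block_sum n c J (fst \<omega>) i + d * (snd \<omega> i)\<^sup>2) / 2)) \<partial>chan)"
  proof (intro nn_integral_cong arg_cong[where f="\<lambda>x. ennreal (exp x)"])
    fix \<omega> :: "(nat \<times> nat \<Rightarrow> real) \<times> (nat \<Rightarrow> real)"
    have "\<theta> * (w\<^sup>2 / (2 * \<sigma>\<^sup>2) - (w + x)\<^sup>2 / (2 * (\<sigma>\<^sup>2 + \<tau>\<^sup>2)))
        = - (a * x\<^sup>2 + 2 * (a * w) * x + d * w\<^sup>2) / 2" for w x :: real
      by (simp add: a_def d_def add_divide_distrib diff_divide_distrib algebra_simps power2_eq_square)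
    note * = this
    have "\<theta> * ((\<Sum>i<n. (snd \<omega> i)\<^sup>2) / (2 * \<sigma>\<^sup>2)
      - (\<Sum>i<n. (snd \<omega> i + block_sum n c J (fst \<omega>) i)\<^sup>2) / (2 * (\<sigma>\<^sup>2 + \<tau>\<^sup>2)))
      = (\<Sum>i<n. \<theta> * ((snd \<omega> i)\<^sup>2 / (2 * \<sigma>\<^sup>2)
          - (snd \<omega> i + block_sum n c J (fst \<omega>) i)\<^sup>2 / (2 * (\<sigma>\<^sup>2 + \<tau>\<^sup>2))))"
      unfolding sum_divide_distrib sum_subtractf[symmetric] sum_distrib_left ..
    also have "\<dots> = - (\<Sum>i<n. a * (block_sum n c J (fst \<omega>) i)\<^sup>2
        + 2 * (a * snd \<omega> i) * block_sum n c J (fst \<omega>) i + d * (snd \<omega> i)\<^sup>2) / 2"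
      unfolding * by (simp only: sum_divide_distrib[symmetric] sum_negf)
    finally show "\<theta> * ((\<Sum>i<n. (snd \<omega> i)\<^sup>2) / (2 * \<sigma>\<^sup>2)
      - (\<Sum>i<n. (snd \<omega> i + block_sum n c J (fst \<omega>) i)\<^sup>2) / (2 * (\<sigma>\<^sup>2 + \<tau>\<^sup>2)))
      = - (\<Sum>i<n. a * (block_sum n c J (fst \<omega>) i)\<^sup>2
        + 2 * (a * snd \<omega> i) * block_sum n c J (fst \<omega>) i + d * (snd \<omega> i)\<^sup>2) / 2" .
  qed
  also have "\<dots> = ennreal (1 / sqrt (1 - \<theta>\<^sup>2 * (\<tau>\<^sup>2 / (\<sigma>\<^sup>2 + \<tau>\<^sup>2))) ^ n)"
    using nn_integral_exp_quadratic_block[OF J c, of a d a] p1 p2 id unfolding \<tau>_def by simp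
  finally show ?thesis
    using lt inverse_sqrt_power_eq_exp[of "1 - \<theta>\<^sup>2 * (\<tau>\<^sup>2 / (\<sigma>\<^sup>2 + \<tau>\<^sup>2))" n] by simp
qed

text \<open>With X and X0 the sums over \<open>J\<close> and \<open>J0\<close>, \<alpha> is the
  share of X in the variance of X + X0, so w + \<alpha> (X + X0) has the same covariance with w + X
  as with itself, namely \<sigma>^2 + \<alpha>^2 p. Hence \<rho>^2 = (\<sigma>^2 + \<alpha>^2 p) /
  (\<sigma>^2 + \<alpha> p). Of the three independent variables, X0 is integrated out first.\<close>

lemma split_mgf:
  assumes J: "J \<subseteq> {..<C}" "J \<noteq> {}" and J0: "J0 \<subseteq> {..<C}" "J0 \<noteq> {}" "J0 \<inter> J = {}" and c: "c > 0"
  defines "p \<equiv> c\<^sup>2 * s\<^sup>2 * card (J \<union> J0)" and "\<alpha> \<equiv> card J / card (J \<union> J0)"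
  assumes \<theta>: "0 \<le> \<theta>" "\<theta> \<le> 1"
  shows "(\<integral>\<^sup>+\<omega>. ennreal (exp (\<theta> * ((\<Sum>i<n. (snd \<omega> i + block_sum n (\<alpha> * c) (J \<union> J0) (fst \<omega>) i)\<^sup>2) / (2 * (\<sigma>\<^sup>2 + \<alpha>\<^sup>2 * p))
      - (\<Sum>i<n. (snd \<omega> i + block_sum n c J (fst \<omega>) i)\<^sup>2) / (2 * (\<sigma>\<^sup>2 + \<alpha> * p))))) \<partial>chan)
    = ennreal (exp (- (real n / 2) * ln (1 - \<theta>\<^sup>2 * (\<alpha> * (1 - \<alpha>) * p / (\<sigma>\<^sup>2 + \<alpha> * p)))))"
proof -
  have fin: "finite J" "finite J0" using J J0 finite_subset by blast+
  have cJ: "card J > 0" "card J0 > 0" using fin J J0 by (auto simp: card_gt_0_iff)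
  have cU: "card (J \<union> J0) = card J + card J0"
    using fin J0 by (subst card_Un_disjoint) auto
  have \<alpha>: "0 < \<alpha>" "\<alpha> < 1" using cJ cU by (auto simp: \<alpha>_def)
  have p: "p > 0" using c s cJ cU by (simp add: p_def)
  define \<tau>0 where "\<tau>0 = c * s * sqrt (card J0)"
  define \<tau> where "\<tau> = c * s * sqrt (card J)"
  have t0: "\<tau>0 > 0" using c s cJ by (simp add: \<tau>0_def)
  have \<tau>2: "\<tau>\<^sup>2 = \<alpha> * p" using cJ cU by (simp add: \<tau>_def p_def \<alpha>_def power_mult_distrib)
  have \<tau>02: "\<tau>0\<^sup>2 = (1 - \<alpha>) * p"
    using cJ cU by (simp add: \<tau>0_def p_def \<alpha>_def power_mult_distrib field_simps)
  define V where "V = \<sigma>\<^sup>2 + \<alpha>\<^sup>2 * p"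
  define U where "U = \<sigma>\<^sup>2 + \<alpha> * p"
  have \<sigma>2: "\<sigma>\<^sup>2 > 0" using \<sigma> by simp
  have V: "V > 0" and U: "U > 0"
  proof -
    have "V \<ge> \<sigma>\<^sup>2" "U \<ge> \<sigma>\<^sup>2" using p \<alpha> by (simp_all add: V_def U_def)
    then show "V > 0" "U > 0" using \<sigma>2 by linarith+
  qed
  \<comment> \<open>\<open>q / V\<close> is the factor left by integrating out X0, whose square
    carries a negative coefficient; \<theta> \<le> 1 keeps \<open>q\<close> positive.\<close>
  define q where "q = V - \<theta> * \<alpha>\<^sup>2 * ((1 - \<alpha>) * p)"
  have qge: "q \<ge> \<sigma>\<^sup>2 + \<alpha>^3 * p"
  proof -
    have "\<theta> * (\<alpha>\<^sup>2 * ((1 - \<alpha>) * p)) \<le> 1 * (\<alpha>\<^sup>2 * ((1 - \<alpha>) * p))"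
      using \<theta> \<alpha> p by (intro mult_right_mono) auto
    then show ?thesis by (simp add: q_def V_def algebra_simps power2_eq_square power3_eq_cube)
  qed
  have q: "q > 0"
  proof -
    have "\<alpha>^3 * p \<ge> 0" using p \<alpha> by simp
    then show ?thesis using qge \<sigma>2 by linarith
  qed
  \<comment> \<open>After that integration the form is \<eta> (w + x)^2 - \<kappa> (w + \<alpha>
    x)^2; expanding it gives the coefficients \<open>a\<close>, \<open>b\<close> and
    \<open>d\<close> below.\<close>
  define \<kappa> where "\<kappa> = \<theta> / q"
  define \<eta> where "\<eta> = \<theta> / U"
  have E1: "1 + (- (\<theta> * \<alpha>\<^sup>2 / V)) * \<tau>0\<^sup>2 = q / V"
    using V by (simp add: q_def \<tau>02 field_simps)
  define a b d where "a = \<eta> - \<kappa> * \<alpha>\<^sup>2" and "b = \<eta> - \<kappa> * \<alpha>" and "d = \<eta> - \<kappa>"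
  have F1: "1 + a * \<tau>\<^sup>2 > 0"
  proof -
    have "\<kappa> * (\<alpha>\<^sup>2 * (\<alpha> * p)) < 1"
    proof -
      have "\<theta> * (\<alpha>\<^sup>2 * (\<alpha> * p)) \<le> 1 * (\<alpha>\<^sup>2 * (\<alpha> * p))"
        using \<theta> \<alpha> p by (intro mult_right_mono) auto
      also have "\<dots> < q" using qge \<sigma>2 by (simp add: power2_eq_square power3_eq_cube algebra_simps)
      finally show ?thesis using q by (simp add: \<kappa>_def)
    qed
    moreover have "\<eta> * (\<alpha> * p) \<ge> 0" using \<theta> U \<alpha> p by (simp add: \<eta>_def)
    ultimately show ?thesis unfolding a_def \<tau>2 by (simp add: algebra_simps)
  qed
  have u1: "\<theta>\<^sup>2 * (\<alpha> * (1 - \<alpha>) * p / U) < 1"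
  proof -
    have "\<theta>\<^sup>2 \<le> 1" using \<theta> by (simp add: power_le_one)
    moreover have "\<alpha> * (1 - \<alpha>) * p / U < 1"
    proof -
      have "\<alpha> * p * (1 - \<alpha>) \<le> \<alpha> * p * 1" using \<alpha> p by (intro mult_left_mono) auto
      also have "\<dots> < U" using \<sigma>2 unfolding U_def by linarith
      finally have "\<alpha> * (1 - \<alpha>) * p < U" by (simp only: mult.assoc mult.commute[of p])
      then show ?thesis using U by simp
    qed
    moreover have "\<alpha> * (1 - \<alpha>) * p / U \<ge> 0" using \<alpha> p U by simp
    ultimately show ?thesis using mult_left_le_one_le[of "\<alpha> * (1 - \<alpha>) * p / U" "\<theta>\<^sup>2"] by simp
  qed
  have id: "q / V * ((1 + a * \<tau>\<^sup>2) * (1 + (d - b\<^sup>2 * \<tau>\<^sup>2 / (1 + a * \<tau>\<^sup>2)) * \<sigma>\<^sup>2)) = 1 - \<theta>\<^sup>2 * (\<alpha> * (1 - \<alpha>) * p / U)"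
  proof -
    have "(1 + a * \<tau>\<^sup>2) * (1 + (d - b\<^sup>2 * \<tau>\<^sup>2 / (1 + a * \<tau>\<^sup>2)) * \<sigma>\<^sup>2)
      = (1 + a * \<tau>\<^sup>2) * (1 + d * \<sigma>\<^sup>2) - b\<^sup>2 * \<tau>\<^sup>2 * \<sigma>\<^sup>2"
      using F1 by (simp add: field_simps)
    also have "\<dots> = 1 + \<eta> * U - \<kappa> * (\<alpha>\<^sup>2 * \<tau>\<^sup>2 + \<sigma>\<^sup>2) - \<eta> * \<kappa> * (1 - \<alpha>)\<^sup>2 * \<sigma>\<^sup>2 * \<tau>\<^sup>2"
      by (simp add: a_def b_def d_def U_def \<tau>2[symmetric] algebra_simps power2_eq_square)
    also have "\<eta> * U = \<theta>" using U by (simp add: \<eta>_def)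
    finally have X: "(1 + a * \<tau>\<^sup>2) * (1 + (d - b\<^sup>2 * \<tau>\<^sup>2 / (1 + a * \<tau>\<^sup>2)) * \<sigma>\<^sup>2)
      = 1 + \<theta> - \<kappa> * (\<alpha>\<^sup>2 * \<tau>\<^sup>2 + \<sigma>\<^sup>2) - \<eta> * \<kappa> * (1 - \<alpha>)\<^sup>2 * \<sigma>\<^sup>2 * \<tau>\<^sup>2" .
    have "q / V * ((1 + a * \<tau>\<^sup>2) * (1 + (d - b\<^sup>2 * \<tau>\<^sup>2 / (1 + a * \<tau>\<^sup>2)) * \<sigma>\<^sup>2))
      = (q * (1 + \<theta>) - (q * \<kappa>) * (\<alpha>\<^sup>2 * \<tau>\<^sup>2 + \<sigma>\<^sup>2) - \<eta> * (q * \<kappa>) * (1 - \<alpha>)\<^sup>2 * \<sigma>\<^sup>2 * \<tau>\<^sup>2) / V"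
      unfolding X by (simp add: algebra_simps add_divide_distrib diff_divide_distrib)
    also have "q * \<kappa> = \<theta>" using q by (simp add: \<kappa>_def)
    finally have *: "q / V * ((1 + a * \<tau>\<^sup>2) * (1 + (d - b\<^sup>2 * \<tau>\<^sup>2 / (1 + a * \<tau>\<^sup>2)) * \<sigma>\<^sup>2))
      = (q * (1 + \<theta>) - \<theta> * (\<alpha>\<^sup>2 * \<tau>\<^sup>2 + \<sigma>\<^sup>2) - \<eta> * \<theta> * (1 - \<alpha>)\<^sup>2 * \<sigma>\<^sup>2 * \<tau>\<^sup>2) / V" .
    have "U * (q * (1 + \<theta>) - \<theta> * (\<alpha>\<^sup>2 * \<tau>\<^sup>2 + \<sigma>\<^sup>2)) - \<theta>\<^sup>2 * (1 - \<alpha>)\<^sup>2 * \<sigma>\<^sup>2 * \<tau>\<^sup>2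
      = (U - \<theta>\<^sup>2 * (\<alpha> * (1 - \<alpha>) * p)) * V"
      unfolding q_def \<tau>2 V_def U_def by algebra
    moreover have "(q * (1 + \<theta>) - \<theta> * (\<alpha>\<^sup>2 * \<tau>\<^sup>2 + \<sigma>\<^sup>2) - \<eta> * \<theta> * (1 - \<alpha>)\<^sup>2 * \<sigma>\<^sup>2 * \<tau>\<^sup>2) * U
      = U * (q * (1 + \<theta>) - \<theta> * (\<alpha>\<^sup>2 * \<tau>\<^sup>2 + \<sigma>\<^sup>2)) - (\<eta> * U) * \<theta> * (1 - \<alpha>)\<^sup>2 * \<sigma>\<^sup>2 * \<tau>\<^sup>2"
      by algebra
    moreover have "\<eta> * U = \<theta>" using U by (simp add: \<eta>_def)
    ultimately have "(q * (1 + \<theta>) - \<theta> * (\<alpha>\<^sup>2 * \<tau>\<^sup>2 + \<sigma>\<^sup>2) - \<eta> * \<theta> * (1 - \<alpha>)\<^sup>2 * \<sigma>\<^sup>2 * \<tau>\<^sup>2) * U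
      = (U - \<theta>\<^sup>2 * (\<alpha> * (1 - \<alpha>) * p)) * V"
      by (simp only: power2_eq_square)
    then have "q / V * ((1 + a * \<tau>\<^sup>2) * (1 + (d - b\<^sup>2 * \<tau>\<^sup>2 / (1 + a * \<tau>\<^sup>2)) * \<sigma>\<^sup>2))
      = (U - \<theta>\<^sup>2 * (\<alpha> * (1 - \<alpha>) * p)) / U"
      unfolding * using U V by (simp add: field_simps)
    also have "\<dots> = 1 - \<theta>\<^sup>2 * (\<alpha> * (1 - \<alpha>) * p / U)" using U by (simp add: diff_divide_distrib)
    finally show ?thesis .
  qed
  have qV: "q / V > 0" using q V by simp
  have F2: "1 + (d - b\<^sup>2 * \<tau>\<^sup>2 / (1 + a * \<tau>\<^sup>2)) * \<sigma>\<^sup>2 > 0"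
    using id u1 qV F1 by (metis diff_gt_0_iff_gt zero_less_mult_pos)
  have mx [measurable]: "(\<lambda>x. x i) \<in> borel_measurable rows" if "i < n" for i
    using that by simp
  note measurable_block_sum_comp[OF _ J(1), measurable]
  define A0 where "A0 = - (\<theta> * \<alpha>\<^sup>2 / V)"
  define B0 where "B0 \<omega> i = - (\<theta> * \<alpha> / V * (snd \<omega> i + \<alpha> * block_sum n c J (fst \<omega>) i))"
    for \<omega> :: "(nat \<times> nat \<Rightarrow> real) \<times> (nat \<Rightarrow> real)" and i
  define D0 where "D0 \<omega> i = \<theta> / U * (snd \<omega> i + block_sum n c J (fst \<omega>) i)\<^sup>2
      - \<theta> / V * (snd \<omega> i + \<alpha> * block_sum n c J (fst \<omega>) i)\<^sup>2"
    for \<omega> :: "(nat \<times> nat \<Rightarrow> real) \<times> (nat \<Rightarrow> real)" and i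
  have mB [measurable]: "(\<lambda>\<omega>. B0 \<omega> i) \<in> borel_measurable chan" if "i < n" for i
    unfolding B0_def using that by measurable
  have mD [measurable]: "(\<lambda>\<omega>. D0 \<omega> i) \<in> borel_measurable chan" if "i < n" for i
    unfolding D0_def using that by measurable
  let ?\<Phi> = "\<lambda>\<omega> x. ennreal (exp (- (\<Sum>i<n. A0 * (x i)\<^sup>2 + 2 * B0 \<omega> i * x i + D0 \<omega> i) / 2))"
  have "(\<integral>\<^sup>+\<omega>. ennreal (exp (\<theta> * ((\<Sum>i<n. (snd \<omega> i + block_sum n (\<alpha> * c) (J \<union> J0) (fst \<omega>) i)\<^sup>2) / (2 * (\<sigma>\<^sup>2 + \<alpha>\<^sup>2 * p))
      - (\<Sum>i<n. (snd \<omega> i + block_sum n c J (fst \<omega>) i)\<^sup>2) / (2 * (\<sigma>\<^sup>2 + \<alpha> * p))))) \<partial>chan)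
    = (\<integral>\<^sup>+\<omega>. ?\<Phi> \<omega> (block_sum n c J0 (fst \<omega>)) \<partial>chan)"
    unfolding V_def[symmetric] U_def[symmetric]
  proof (intro nn_integral_cong arg_cong[where f="\<lambda>x. ennreal (exp x)"])
    fix \<omega> :: "(nat \<times> nat \<Rightarrow> real) \<times> (nat \<Rightarrow> real)"
    have bsU: "block_sum n (\<alpha> * c) (J \<union> J0) (fst \<omega>) i
        = \<alpha> * block_sum n c J (fst \<omega>) i + \<alpha> * block_sum n c J0 (fst \<omega>) i" if "i < n" for i
      using that fin J0(3)
      by (simp add: block_sum_def sum.union_disjoint Int_commute algebra_simps)
    have *: "\<theta> * ((w + (\<alpha> * x + \<alpha> * x0))\<^sup>2 / (2 * V) - (w + x)\<^sup>2 / (2 * U))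
        = - (A0 * x0\<^sup>2 + 2 * (- (\<theta> * \<alpha> / V * (w + \<alpha> * x))) * x0 + (\<theta> / U * (w + x)\<^sup>2 - \<theta> / V * (w + \<alpha> * x)\<^sup>2)) / 2"
        for w x x0 :: real
      by (simp add: A0_def add_divide_distrib diff_divide_distrib algebra_simps power2_eq_square)
    have "\<theta> * ((\<Sum>i<n. (snd \<omega> i + block_sum n (\<alpha> * c) (J \<union> J0) (fst \<omega>) i)\<^sup>2) / (2 * V)
      - (\<Sum>i<n. (snd \<omega> i + block_sum n c J (fst \<omega>) i)\<^sup>2) / (2 * U))
      = (\<Sum>i<n. \<theta> * ((snd \<omega> i + block_sum n (\<alpha> * c) (J \<union> J0) (fst \<omega>) i)\<^sup>2 / (2 * V)
          - (snd \<omega> i + block_sum n c J (fst \<omega>) i)\<^sup>2 / (2 * U)))"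
      unfolding sum_divide_distrib sum_subtractf[symmetric] sum_distrib_left ..
    also have "\<dots> = (\<Sum>i<n. - (A0 * (block_sum n c J0 (fst \<omega>) i)\<^sup>2
        + 2 * B0 \<omega> i * block_sum n c J0 (fst \<omega>) i + D0 \<omega> i) / 2)"
      by (intro sum.cong refl) (simp only: bsU * lessThan_iff B0_def D0_def)
    also have "\<dots> = - (\<Sum>i<n. A0 * (block_sum n c J0 (fst \<omega>) i)\<^sup>2
        + 2 * B0 \<omega> i * block_sum n c J0 (fst \<omega>) i + D0 \<omega> i) / 2"
      by (simp only: sum_divide_distrib[symmetric] sum_negf)
    finally show "\<theta> * ((\<Sum>i<n. (snd \<omega> i + block_sum n (\<alpha> * c) (J \<union> J0) (fst \<omega>) i)\<^sup>2) / (2 * V)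
      - (\<Sum>i<n. (snd \<omega> i + block_sum n c J (fst \<omega>) i)\<^sup>2) / (2 * U))
      = - (\<Sum>i<n. A0 * (block_sum n c J0 (fst \<omega>) i)\<^sup>2
        + 2 * B0 \<omega> i * block_sum n c J0 (fst \<omega>) i + D0 \<omega> i) / 2" .
  qed
  also have "\<dots> = (\<integral>\<^sup>+\<omega>. \<integral>\<^sup>+x. ?\<Phi> \<omega> x \<partial>gauss_vec n \<tau>0 \<partial>chan)"
    unfolding \<tau>0_def
  proof (rule nn_integral_resample[OF J0(1,2) c])
    show "case_prod ?\<Phi> \<in> borel_measurable (chan \<Otimes>\<^sub>M rows)"
      unfolding case_prod_beta' by measurable
    fix A A' :: "nat \<times> nat \<Rightarrow> real" and w x
    assume eq: "\<And>i j. j \<notin> J0 \<Longrightarrow> A (i, j) = A' (i, j)"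
    have "block_sum n c J A = block_sum n c J A'"
      by (rule block_sum_cong) (use eq J0 in blast)
    then show "?\<Phi> (A, w) x = ?\<Phi> (A', w) x" by (simp add: B0_def D0_def)
  qed
  also have "\<dots> = (\<integral>\<^sup>+\<omega>. ennreal (exp (- (\<Sum>i<n. D0 \<omega> i - (B0 \<omega> i)\<^sup>2 * \<tau>0\<^sup>2 / (1 + A0 * \<tau>0\<^sup>2)) / 2)
      / sqrt (1 + A0 * \<tau>0\<^sup>2) ^ n) \<partial>chan)"
    by (intro nn_integral_cong nn_integral_gauss_vec_exp_quadratic t0) (use E1 qV in \<open>simp add: A0_def\<close>)
  also have "\<dots> = (\<integral>\<^sup>+\<omega>. ennreal (1 / sqrt (q / V) ^ n) * ennreal (exp (- (\<Sum>i<n. a * (block_sum n c J (fst \<omega>) i)\<^sup>2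
        + 2 * (b * snd \<omega> i) * block_sum n c J (fst \<omega>) i + d * (snd \<omega> i)\<^sup>2) / 2)) \<partial>chan)"
  proof (intro nn_integral_cong)
    fix \<omega> :: "(nat \<times> nat \<Rightarrow> real) \<times> (nat \<Rightarrow> real)"
    have E1': "1 + A0 * \<tau>0\<^sup>2 = q / V" using E1 by (simp add: A0_def)
    have "D0 \<omega> i - (B0 \<omega> i)\<^sup>2 * \<tau>0\<^sup>2 / (q / V)
      = a * (block_sum n c J (fst \<omega>) i)\<^sup>2
        + 2 * (b * snd \<omega> i) * block_sum n c J (fst \<omega>) i + d * (snd \<omega> i)\<^sup>2" for i
    proof -
      let ?w = "snd \<omega> i" and ?x = "block_sum n c J (fst \<omega>) i"
      have k: "\<theta> / V + (\<theta> * \<alpha> / V)\<^sup>2 * \<tau>0\<^sup>2 / (q / V) = \<kappa>"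
      proof -
        have "(\<theta> * \<alpha> / V)\<^sup>2 * \<tau>0\<^sup>2 / (q / V) = \<theta> * (\<theta> * \<alpha>\<^sup>2 * ((1 - \<alpha>) * p)) / (V * q)"
          unfolding \<tau>02 using V q by (simp add: power2_eq_square field_simps)
        also have "\<theta> * \<alpha>\<^sup>2 * ((1 - \<alpha>) * p) = V - q" by (simp add: q_def)
        also have "\<theta> / V + \<theta> * (V - q) / (V * q) = \<theta> / q" using V q by (simp add: field_simps)
        finally show ?thesis by (simp add: \<kappa>_def)
      qed
      have "D0 \<omega> i - (B0 \<omega> i)\<^sup>2 * \<tau>0\<^sup>2 / (q / V)
        = \<eta> * (?w + ?x)\<^sup>2 - (\<theta> / V + (\<theta> * \<alpha> / V)\<^sup>2 * \<tau>0\<^sup>2 / (q / V)) * (?w + \<alpha> * ?x)\<^sup>2"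
      proof -
        have "(B0 \<omega> i)\<^sup>2 = (\<theta> * \<alpha> / V)\<^sup>2 * (?w + \<alpha> * ?x)\<^sup>2"
          unfolding B0_def power2_minus power_mult_distrib ..
        then show ?thesis by (simp add: D0_def \<eta>_def distrib_right)
      qed
      then show ?thesis
        unfolding k by (simp add: a_def b_def d_def power2_eq_square algebra_simps)
    qed
    then show "ennreal (exp (- (\<Sum>i<n. D0 \<omega> i - (B0 \<omega> i)\<^sup>2 * \<tau>0\<^sup>2 / (1 + A0 * \<tau>0\<^sup>2)) / 2)
      / sqrt (1 + A0 * \<tau>0\<^sup>2) ^ n) = ennreal (1 / sqrt (q / V) ^ n)
      * ennreal (exp (- (\<Sum>i<n. a * (block_sum n c J (fst \<omega>) i)\<^sup>2
        + 2 * (b * snd \<omega> i) * block_sum n c J (fst \<omega>) i + d * (snd \<omega> i)\<^sup>2) / 2))"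
      unfolding E1' using qV by (simp only: ) (subst ennreal_mult''[symmetric], simp, simp)
  qed
  also have "\<dots> = ennreal (1 / sqrt (q / V) ^ n) * (\<integral>\<^sup>+\<omega>. ennreal (exp (- (\<Sum>i<n. a * (block_sum n c J (fst \<omega>) i)\<^sup>2
        + 2 * (b * snd \<omega> i) * block_sum n c J (fst \<omega>) i + d * (snd \<omega> i)\<^sup>2) / 2)) \<partial>chan)"
    by (rule nn_integral_cmult) measurable
  also have "\<dots> = ennreal (1 / sqrt (q / V) ^ n) * ennreal (1 / sqrt ((1 + a * \<tau>\<^sup>2) * (1 + (d - b\<^sup>2 * \<tau>\<^sup>2 / (1 + a * \<tau>\<^sup>2)) * \<sigma>\<^sup>2)) ^ n)"
    using nn_integral_exp_quadratic_block[OF J c, of a d b] F1 F2 unfolding \<tau>_def by simp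
  also have "\<dots> = ennreal (1 / sqrt (1 - \<theta>\<^sup>2 * (\<alpha> * (1 - \<alpha>) * p / U)) ^ n)"
    using qV q V F1 F2 unfolding id[symmetric]
    by (subst ennreal_mult'[symmetric]) (simp_all add: real_sqrt_mult real_sqrt_divide power_mult_distrib power_divide)
  finally show ?thesis
    using u1 inverse_sqrt_power_eq_exp[of "1 - \<theta>\<^sup>2 * (\<alpha> * (1 - \<alpha>) * p / U)" n] by (simp add: U_def)
qed

section \<open>Error probability for one fixed set of wrong sections\<close>

text \<open>With \<open>Q\<close> the scaled noise energy and threshold 0,
  \<open>union_bound\<close> describes a candidate at least as close as the true codeword, and
  \<open>noise_mgf\<close> evaluates the remaining expectation.\<close>

lemma direct_bound:
  fixes K :: real and J' :: "'m \<Rightarrow> nat set"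
  assumes Ms: "finite Ms" "card Ms \<le> K" and K: "K > 0" and \<theta>: "0 \<le> \<theta>" "\<theta> \<le> 1"
    and J: "J \<subseteq> {..<C}" "card J = k" and c: "c > 0" and k: "k \<ge> 1"
    and J': "\<And>m. m \<in> Ms \<Longrightarrow> J' m \<subseteq> {..<C} \<and> card (J' m) = k \<and> J' m \<inter> J = {}"
  defines "\<tau> \<equiv> c * s * sqrt k"
  shows "emeasure chan {\<omega> \<in> space chan. \<exists>m\<in>Ms.
      (\<Sum>i<n. (snd \<omega> i + block_sum n c J (fst \<omega>) i - block_sum n c (J' m) (fst \<omega>) i)\<^sup>2)
        \<le> (\<Sum>i<n. (snd \<omega> i)\<^sup>2)}
    \<le> ennreal (exp (\<theta> * ln K - n / 2 * (\<theta> * ln (1 + \<tau>\<^sup>2 / \<sigma>\<^sup>2))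
        - n / 2 * ln (1 - \<theta>\<^sup>2 * (\<tau>\<^sup>2 / (\<sigma>\<^sup>2 + \<tau>\<^sup>2)))))"
proof -
  define Q where "Q \<omega> = (\<Sum>i<n. (snd \<omega> i)\<^sup>2) / (2 * \<sigma>\<^sup>2)"
    for \<omega> :: "(nat \<times> nat \<Rightarrow> real) \<times> (nat \<Rightarrow> real)"
  have mQ: "Q \<in> borel_measurable chan" unfolding Q_def by measurable
  have \<tau>: "\<tau> > 0" using c s k by (simp add: \<tau>_def)
  have Jne: "J \<noteq> {}" using J k by auto
  have pos: "1 + \<tau>\<^sup>2 / \<sigma>\<^sup>2 > 0" by (simp add: add_pos_nonneg)
  have pos2: "\<sigma>\<^sup>2 + \<tau>\<^sup>2 > 0" using \<sigma> by (simp add: add_pos_nonneg)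
  have lt: "\<theta>\<^sup>2 * (\<tau>\<^sup>2 / (\<sigma>\<^sup>2 + \<tau>\<^sup>2)) < 1"
  proof -
    have "\<theta>\<^sup>2 * (\<tau>\<^sup>2 / (\<sigma>\<^sup>2 + \<tau>\<^sup>2)) \<le> 1 * (\<tau>\<^sup>2 / (\<sigma>\<^sup>2 + \<tau>\<^sup>2))"
      using \<theta> by (intro mult_right_mono) (auto simp: power_le_one)
    also have "\<dots> < 1" using \<sigma> pos2 by simp
    finally show ?thesis .
  qed
  have "emeasure chan {\<omega> \<in> space chan. \<exists>m\<in>Ms.
      (\<Sum>i<n. (snd \<omega> i + block_sum n c J (fst \<omega>) i - block_sum n c (J' m) (fst \<omega>) i)\<^sup>2)
        \<le> (\<Sum>i<n. (snd \<omega> i)\<^sup>2)}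
    = emeasure chan {\<omega> \<in> space chan. \<exists>m\<in>Ms.
      (\<Sum>i<n. (snd \<omega> i + block_sum n c J (fst \<omega>) i - block_sum n c (J' m) (fst \<omega>) i)\<^sup>2) / (2 * \<sigma>\<^sup>2)
        - Q \<omega> \<le> 0}"
    using \<sigma> by (simp add: Q_def divide_le_cancel)
  also have "\<dots> \<le> (\<integral>\<^sup>+\<omega>. ennreal ((K * (exp (0 + Q \<omega> - (\<Sum>i<n. (snd \<omega> i + block_sum n c J (fst \<omega>) i)\<^sup>2) / (2 * (\<sigma>\<^sup>2 + \<tau>\<^sup>2)))
        / sqrt (1 + \<tau>\<^sup>2 / \<sigma>\<^sup>2) ^ n)) powr \<theta>) \<partial>chan)"
    unfolding \<tau>_def by (rule union_bound[OF Ms K \<theta> J(1) c k mQ J']) (auto simp: Q_def)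
  also have "\<dots> = (\<integral>\<^sup>+\<omega>. ennreal (exp (\<theta> * (ln K + 0) - n / 2 * (\<theta> * ln (1 + \<tau>\<^sup>2 / \<sigma>\<^sup>2)))) *
      ennreal (exp (\<theta> * ((\<Sum>i<n. (snd \<omega> i)\<^sup>2) / (2 * \<sigma>\<^sup>2)
      - (\<Sum>i<n. (snd \<omega> i + block_sum n c J (fst \<omega>) i)\<^sup>2) / (2 * (\<sigma>\<^sup>2 + \<tau>\<^sup>2))))) \<partial>chan)"
    unfolding add_diff_eq[symmetric] powr_exp_div_sqrt_power[OF K pos] Q_def
    by (subst ennreal_mult'[symmetric]) auto
  also have "\<dots> = ennreal (exp (\<theta> * (ln K + 0) - n / 2 * (\<theta> * ln (1 + \<tau>\<^sup>2 / \<sigma>\<^sup>2)))) *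
     (\<integral>\<^sup>+\<omega>. ennreal (exp (\<theta> * ((\<Sum>i<n. (snd \<omega> i)\<^sup>2) / (2 * \<sigma>\<^sup>2)
      - (\<Sum>i<n. (snd \<omega> i + block_sum n c J (fst \<omega>) i)\<^sup>2) / (2 * (\<sigma>\<^sup>2 + \<tau>\<^sup>2))))) \<partial>chan)"
    by (intro nn_integral_cmult measurable_compose[OF _ measurable_ennreal] borel_measurable_exp
        borel_measurable_times borel_measurable_const borel_measurable_diff borel_measurable_divide
        borel_measurable_sum borel_measurable_power borel_measurable_add measurable_block_sum_comp
        measurable_noise J measurable_compose[OF _ borel_measurable_exp]) auto
  also have "\<dots> = ennreal (exp (\<theta> * (ln K + 0) - n / 2 * (\<theta> * ln (1 + \<tau>\<^sup>2 / \<sigma>\<^sup>2)))) *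
      ennreal (exp (- (real n / 2) * ln (1 - \<theta>\<^sup>2 * (\<tau>\<^sup>2 / (\<sigma>\<^sup>2 + \<tau>\<^sup>2)))))"
    using noise_mgf[OF J(1) Jne c \<theta>(1)] lt by (simp add: \<tau>_def J(2))
  finally show ?thesis
    by (simp add: ennreal_mult'[symmetric] mult_exp_exp)
qed

text \<open>\<open>Q\<close> now contains all columns of the true message, so the candidates'
  columns must avoid \<open>J0\<close> as well for \<open>Q\<close> to survive the resampling. Here
  \<open>p\<close> is the total power of these columns, and \<alpha> the share of the wrong ones in
  it.\<close>

lemma split_bound:
  fixes K :: real and J' :: "'m \<Rightarrow> nat set"
  assumes Ms: "finite Ms" "card Ms \<le> K" and K: "K > 0" and \<theta>: "0 \<le> \<theta>" "\<theta> \<le> 1"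
    and J: "J \<subseteq> {..<C}" "card J = k" and J0: "J0 \<subseteq> {..<C}" "J0 \<noteq> {}" "J0 \<inter> J = {}"
    and c: "c > 0" and k: "k \<ge> 1"
    and J': "\<And>m. m \<in> Ms \<Longrightarrow> J' m \<subseteq> {..<C} \<and> card (J' m) = k \<and> J' m \<inter> (J \<union> J0) = {}"
  defines "p \<equiv> c\<^sup>2 * s\<^sup>2 * card (J \<union> J0)" and "\<alpha> \<equiv> k / card (J \<union> J0)"
  shows "emeasure chan {\<omega> \<in> space chan. \<exists>m\<in>Ms.
      (\<Sum>i<n. (snd \<omega> i + block_sum n c J (fst \<omega>) i - block_sum n c (J' m) (fst \<omega>) i)\<^sup>2) / (2 * \<sigma>\<^sup>2)
        - (\<Sum>i<n. (snd \<omega> i + block_sum n (\<alpha> * c) (J \<union> J0) (fst \<omega>) i)\<^sup>2) / (2 * (\<sigma>\<^sup>2 + \<alpha>\<^sup>2 * p)) \<le> T}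
    \<le> ennreal (exp (\<theta> * (ln K + T) - n / 2 * (\<theta> * ln (1 + \<alpha> * p / \<sigma>\<^sup>2))
        - n / 2 * ln (1 - \<theta>\<^sup>2 * (\<alpha> * (1 - \<alpha>) * p / (\<sigma>\<^sup>2 + \<alpha> * p)))))"
proof -
  have fin: "finite J" "finite J0" using J J0 finite_subset by blast+
  have JU: "J \<union> J0 \<subseteq> {..<C}" using J J0 by auto
  define Q where "Q \<omega> = (\<Sum>i<n. (snd \<omega> i + block_sum n (\<alpha> * c) (J \<union> J0) (fst \<omega>) i)\<^sup>2) / (2 * (\<sigma>\<^sup>2 + \<alpha>\<^sup>2 * p))"
    for \<omega> :: "(nat \<times> nat \<Rightarrow> real) \<times> (nat \<Rightarrow> real)"
  note ms = borel_measurable_exp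
        borel_measurable_times borel_measurable_const borel_measurable_diff borel_measurable_divide
        borel_measurable_sum borel_measurable_power borel_measurable_add measurable_block_sum_comp
        measurable_noise
  have mQ: "Q \<in> borel_measurable chan" unfolding Q_def by (intro ms JU) auto
  define \<tau> where "\<tau> = c * s * sqrt k"
  have \<tau>: "\<tau> > 0" using c s k by (simp add: \<tau>_def)
  have Jne: "J \<noteq> {}" using J k by auto
  have cU: "card (J \<union> J0) > 0" using fin Jne by (simp add: card_gt_0_iff)
  have \<tau>2: "\<tau>\<^sup>2 = \<alpha> * p" using cU by (simp add: \<tau>_def \<alpha>_def p_def power_mult_distrib)
  have pos: "1 + \<alpha> * p / \<sigma>\<^sup>2 > 0" unfolding \<tau>2[symmetric] by (simp add: add_pos_nonneg)
  have "emeasure chan {\<omega> \<in> space chan. \<exists>m\<in>Ms.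
      (\<Sum>i<n. (snd \<omega> i + block_sum n c J (fst \<omega>) i - block_sum n c (J' m) (fst \<omega>) i)\<^sup>2) / (2 * \<sigma>\<^sup>2)
        - Q \<omega> \<le> T}
     \<le> (\<integral>\<^sup>+\<omega>. ennreal ((K * (exp (T + Q \<omega> - (\<Sum>i<n. (snd \<omega> i + block_sum n c J (fst \<omega>) i)\<^sup>2) / (2 * (\<sigma>\<^sup>2 + \<alpha> * p)))
        / sqrt (1 + \<alpha> * p / \<sigma>\<^sup>2) ^ n)) powr \<theta>) \<partial>chan)"
    unfolding \<tau>2[symmetric] \<tau>_def
  proof (rule union_bound[OF Ms K \<theta> J(1) c k mQ])
    fix m assume m: "m \<in> Ms"
    show "J' m \<subseteq> {..<C} \<and> card (J' m) = k \<and> J' m \<inter> J = {}" using J'[OF m] by blast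
    fix A A' :: "nat \<times> nat \<Rightarrow> real" and w
    assume eq: "\<And>i j. j \<notin> J' m \<Longrightarrow> A (i, j) = A' (i, j)"
    have "block_sum n (\<alpha> * c) (J \<union> J0) A = block_sum n (\<alpha> * c) (J \<union> J0) A'"
      by (rule block_sum_cong) (use eq J'[OF m] in blast)
    then show "Q (A, w) = Q (A', w)" by (simp add: Q_def)
  qed
  also have "\<dots> = (\<integral>\<^sup>+\<omega>. ennreal (exp (\<theta> * (ln K + T) - n / 2 * (\<theta> * ln (1 + \<alpha> * p / \<sigma>\<^sup>2)))) *
      ennreal (exp (\<theta> * (Q \<omega>
      - (\<Sum>i<n. (snd \<omega> i + block_sum n c J (fst \<omega>) i)\<^sup>2) / (2 * (\<sigma>\<^sup>2 + \<alpha> * p))))) \<partial>chan)"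
    unfolding add_diff_eq[symmetric] powr_exp_div_sqrt_power[OF K pos]
    by (subst ennreal_mult'[symmetric]) auto
  also have "\<dots> = ennreal (exp (\<theta> * (ln K + T) - n / 2 * (\<theta> * ln (1 + \<alpha> * p / \<sigma>\<^sup>2)))) *
     (\<integral>\<^sup>+\<omega>. ennreal (exp (\<theta> * (Q \<omega>
      - (\<Sum>i<n. (snd \<omega> i + block_sum n c J (fst \<omega>) i)\<^sup>2) / (2 * (\<sigma>\<^sup>2 + \<alpha> * p))))) \<partial>chan)"
    by (intro nn_integral_cmult measurable_compose[OF _ measurable_ennreal] ms mQ J
        measurable_compose[OF _ borel_measurable_exp]) auto
  also have "\<dots> = ennreal (exp (\<theta> * (ln K + T) - n / 2 * (\<theta> * ln (1 + \<alpha> * p / \<sigma>\<^sup>2)))) *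
      ennreal (exp (- (real n / 2) * ln (1 - \<theta>\<^sup>2 * (\<alpha> * (1 - \<alpha>) * p / (\<sigma>\<^sup>2 + \<alpha> * p)))))"
    using split_mgf[OF J(1) Jne J0 c \<theta>] by (simp add: Q_def p_def \<alpha>_def J(2))
  finally show ?thesis
    by (simp add: ennreal_mult'[symmetric] mult_exp_exp Q_def)
qed

text \<open>The price of the split: an exponential Markov inequality with multiplier \<theta>.
  \<open>J\<close> will be the set of all columns of the transmitted message, so that the event is
  the same for every set of wrong sections.\<close>

lemma common_statistic_bound:
  assumes J: "J \<subseteq> {..<C}" "J \<noteq> {}" and c: "c > 0" and \<alpha>: "\<alpha> > 0" and \<theta>: "\<theta> \<ge> 0"
  defines "p \<equiv> c\<^sup>2 * s\<^sup>2 * card J"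
  assumes lt: "\<theta>\<^sup>2 * (\<alpha>\<^sup>2 * p / (\<sigma>\<^sup>2 + \<alpha>\<^sup>2 * p)) < 1"
  shows "emeasure chan {\<omega> \<in> space chan.
      (\<Sum>i<n. (snd \<omega> i + block_sum n (\<alpha> * c) J (fst \<omega>) i)\<^sup>2) / (2 * (\<sigma>\<^sup>2 + \<alpha>\<^sup>2 * p))
        - (\<Sum>i<n. (snd \<omega> i)\<^sup>2) / (2 * \<sigma>\<^sup>2) \<le> - T}
    \<le> ennreal (exp (- \<theta> * T - n / 2 * ln (1 - \<theta>\<^sup>2 * (\<alpha>\<^sup>2 * p / (\<sigma>\<^sup>2 + \<alpha>\<^sup>2 * p)))))"
proof -
  note ms = borel_measurable_exp
        borel_measurable_times borel_measurable_const borel_measurable_diff borel_measurable_divide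
        borel_measurable_sum borel_measurable_power borel_measurable_add measurable_block_sum_comp
        measurable_noise
  define \<tau> where "\<tau> = \<alpha> * c * s * sqrt (card J)"
  have \<tau>2: "\<alpha>\<^sup>2 * p = \<tau>\<^sup>2" by (simp add: \<tau>_def p_def power_mult_distrib)
  define W where "W \<omega> = (\<Sum>i<n. (snd \<omega> i)\<^sup>2) / (2 * \<sigma>\<^sup>2)
      - (\<Sum>i<n. (snd \<omega> i + block_sum n (\<alpha> * c) J (fst \<omega>) i)\<^sup>2) / (2 * (\<sigma>\<^sup>2 + \<tau>\<^sup>2))"
    for \<omega> :: "(nat \<times> nat \<Rightarrow> real) \<times> (nat \<Rightarrow> real)"
  have mW [measurable]: "W \<in> borel_measurable chan" unfolding W_def by (intro ms J) auto
  have \<alpha>c: "\<alpha> * c > 0" using \<alpha> c by simp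
  have "emeasure chan {\<omega> \<in> space chan.
      (\<Sum>i<n. (snd \<omega> i + block_sum n (\<alpha> * c) J (fst \<omega>) i)\<^sup>2) / (2 * (\<sigma>\<^sup>2 + \<alpha>\<^sup>2 * p))
        - (\<Sum>i<n. (snd \<omega> i)\<^sup>2) / (2 * \<sigma>\<^sup>2) \<le> - T} = emeasure chan {\<omega> \<in> space chan. T \<le> W \<omega>}"
    unfolding W_def \<tau>2 by (intro arg_cong[where f="emeasure chan"] Collect_cong conj_cong refl) linarith
  also have "\<dots> = (\<integral>\<^sup>+\<omega>. indicator {\<omega> \<in> space chan. T \<le> W \<omega>} \<omega> \<partial>chan)"
    by (rule nn_integral_indicator[symmetric]) measurable
  also have "\<dots> \<le> (\<integral>\<^sup>+\<omega>. ennreal (exp (- \<theta> * T)) * ennreal (exp (\<theta> * W \<omega>)) \<partial>chan)"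
  proof (intro nn_integral_mono)
    fix \<omega>
    have "1 \<le> exp (- \<theta> * T) * exp (\<theta> * W \<omega>)" if "T \<le> W \<omega>"
      using mult_left_mono[OF that \<theta>] by (simp add: mult_exp_exp)
    then show "indicator {\<omega> \<in> space chan. T \<le> W \<omega>} \<omega> \<le> ennreal (exp (- \<theta> * T)) * ennreal (exp (\<theta> * W \<omega>))"
      by (auto simp: indicator_def ennreal_mult'[symmetric] simp flip: ennreal_1 intro!: ennreal_leI)
  qed
  also have "\<dots> = ennreal (exp (- \<theta> * T)) * (\<integral>\<^sup>+\<omega>. ennreal (exp (\<theta> * W \<omega>)) \<partial>chan)"
    by (rule nn_integral_cmult) measurable
  also have "\<dots> = ennreal (exp (- \<theta> * T)) *
      ennreal (exp (- (real n / 2) * ln (1 - \<theta>\<^sup>2 * (\<tau>\<^sup>2 / (\<sigma>\<^sup>2 + \<tau>\<^sup>2)))))"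
    using noise_mgf[OF J \<alpha>c \<theta>] lt unfolding W_def \<tau>2 by (simp add: \<tau>_def)
  finally show ?thesis
    by (simp add: ennreal_mult'[symmetric] mult_exp_exp \<tau>2)
qed

end

section \<open>Sparse regression codes\<close>

definition msg_cols :: "nat \<Rightarrow> (nat \<Rightarrow> nat) \<Rightarrow> nat set \<Rightarrow> nat set" where
  "msg_cols M m D = (\<lambda>l. l * M + m l) ` D"

lemma sparc_msgs_less: "m \<in> sparc_msgs L M \<Longrightarrow> l < L \<Longrightarrow> m l < M"
  by (auto simp: sparc_msgs_def)

lemma finite_sparc_msgs: "finite (sparc_msgs L M)"
  by (simp add: sparc_msgs_def finite_PiE)

lemma mult_add_less_cancel:
  fixes l l' M x x' :: nat
  assumes "x < M" "x' < M" "l * M + x = l' * M + x'"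
  shows "l = l' \<and> x = x'"
proof -
  have "(l * M + x) div M = l" "(l' * M + x') div M = l'" using assms(1,2) by auto
  then have "l = l'" using assms(3) by metis
  then show ?thesis using assms(3) by simp
qed

lemma card_msg_cols:
  assumes "m \<in> sparc_msgs L M" "D \<subseteq> {..<L}"
  shows "card (msg_cols M m D) = card D"
  unfolding msg_cols_def
proof (rule card_image, rule inj_onI)
  fix x y assume "x \<in> D" "y \<in> D" "x * M + m x = y * M + m y"
  then show "x = y"
    using mult_add_less_cancel[of "m x" M "m y"] sparc_msgs_less[OF assms(1)] assms(2) by blast
qed

lemma msg_cols_subset:
  assumes "m \<in> sparc_msgs L M" "D \<subseteq> {..<L}"
  shows "msg_cols M m D \<subseteq> {..<M * L}"
proof
  fix j assume "j \<in> msg_cols M m D"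
  then obtain l where l: "l < L" "j = l * M + m l" using assms by (auto simp: msg_cols_def)
  have "j < (l + 1) * M" using l sparc_msgs_less[OF assms(1), of l] by simp
  also have "\<dots> \<le> L * M" using l by (intro mult_right_mono) auto
  finally show "j \<in> {..<M * L}" by (simp add: mult.commute)
qed

lemma msg_cols_disjoint:
  assumes "m \<in> sparc_msgs L M" "m' \<in> sparc_msgs L M" "D \<subseteq> {..<L}" "D' \<subseteq> {..<L}"
    and "\<And>l. l \<in> D \<Longrightarrow> l \<in> D' \<Longrightarrow> m l \<noteq> m' l"
  shows "msg_cols M m D \<inter> msg_cols M m' D' = {}"
proof -
  have False if "l \<in> D" "l' \<in> D'" "l * M + m l = l' * M + m' l'" for l l'
  proof -
    have "m l < M" "m' l' < M" using that assms sparc_msgs_less by blast+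
    with that assms(5) mult_add_less_cancel show False by metis
  qed
  then show ?thesis by (auto simp: msg_cols_def)
qed

lemma sparc_codeword_eq_block_sum:
  assumes m: "m \<in> sparc_msgs L M" and i: "i < n"
  shows "sparc_codeword n P L M A m i
    = block_sum n (sqrt (real n * P / real L)) (msg_cols M m {..<L}) A i"
proof -
  have eq: "{j \<in> {..<M * L}. \<exists>l<L. j = l * M + m l} = msg_cols M m {..<L}"
    using msg_cols_subset[OF m, of "{..<L}"] by (auto simp: msg_cols_def)
  have "sparc_codeword n P L M A m i
    = (\<Sum>j<M*L. if \<exists>l<L. j = l * M + m l then A (i, j) * sqrt (real n * P / real L) else 0)"
    unfolding sparc_codeword_def by (intro sum.cong) auto
  also have "\<dots> = (\<Sum>j\<in>msg_cols M m {..<L}. A (i, j) * sqrt (real n * P / real L))"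
    unfolding eq[symmetric] by (rule sum.inter_filter[symmetric]) simp
  finally show ?thesis
    using i by (simp add: block_sum_def sum_distrib_left mult.commute)
qed

lemma msg_cols_Un: "msg_cols M m (D \<union> D') = msg_cols M m D \<union> msg_cols M m D'"
  by (auto simp: msg_cols_def)

lemma finite_msg_cols: "finite D \<Longrightarrow> finite (msg_cols M m D)"
  by (simp add: msg_cols_def)

lemma block_sum_Un:
  assumes "finite J" "finite J'" "J \<inter> J' = {}" "i < n"
  shows "block_sum n c (J \<union> J') A i = block_sum n c J A i + block_sum n c J' A i"
  using assms by (simp add: block_sum_def sum.union_disjoint distrib_left)

text \<open>Sections outside \<open>S\<close> select the same columns in both messages and
  cancel.\<close>

lemma sparc_sqdist_eq:
  fixes P :: real and n L M :: nat
  assumes m: "m \<in> sparc_msgs L M" and m': "m' \<in> sparc_msgs L M"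
  defines "S \<equiv> {l \<in> {..<L}. m' l \<noteq> m l}" and "c \<equiv> sqrt (real n * P / real L)"
  shows "sparc_sqdist n P L M A (\<lambda>i. sparc_codeword n P L M A m i + w i) m'
    = (\<Sum>i<n. (w i + block_sum n c (msg_cols M m S) A i - block_sum n c (msg_cols M m' S) A i)\<^sup>2)"
proof -
  have SU: "{..<L} = S \<union> ({..<L} - S)" by (auto simp: S_def)
  have split: "block_sum n c (msg_cols M \<mu> {..<L}) A i
      = block_sum n c (msg_cols M \<mu> S) A i + block_sum n c (msg_cols M \<mu> ({..<L} - S)) A i"
    if "\<mu> \<in> sparc_msgs L M" "i < n" for \<mu> i
  proof -
    have "msg_cols M \<mu> S \<inter> msg_cols M \<mu> ({..<L} - S) = {}"
      by (rule msg_cols_disjoint[OF that(1) that(1)]) (auto simp: S_def)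
    moreover have "finite S" by (simp add: S_def)
    ultimately show ?thesis
      using that(2) unfolding arg_cong[OF SU, of "msg_cols M \<mu>"] msg_cols_Un
      by (simp add: block_sum_Un finite_msg_cols)
  qed
  have same: "msg_cols M m' ({..<L} - S) = msg_cols M m ({..<L} - S)"
    unfolding msg_cols_def by (intro image_cong) (auto simp: S_def)
  show ?thesis
    unfolding sparc_sqdist_def
  proof (intro sum.cong refl)
    fix i assume "i \<in> {..<n}"
    then have i: "i < n" by simp
    show "(sparc_codeword n P L M A m i + w i - sparc_codeword n P L M A m' i)\<^sup>2
      = (w i + block_sum n c (msg_cols M m S) A i - block_sum n c (msg_cols M m' S) A i)\<^sup>2"
      unfolding sparc_codeword_eq_block_sum[OF m i] sparc_codeword_eq_block_sum[OF m' i] c_def[symmetric]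
        split[OF m i] split[OF m' i] same
      by (simp add: algebra_simps)
  qed
qed

lemma sparc_sqdist_true:
  assumes m: "m \<in> sparc_msgs L M"
  shows "sparc_sqdist n P L M A (\<lambda>i. sparc_codeword n P L M A m i + w i) m = (\<Sum>i<n. (w i)\<^sup>2)"
  by (simp add: sparc_sqdist_def)

section \<open>Union over the sets of wrong sections and over their number\<close>

locale sparc =
  fixes n L M :: nat and P \<sigma> :: real
  assumes n1: "n \<ge> 1" and L1: "L \<ge> 1" and M1: "M \<ge> 1" and P0: "P > 0" and \<sigma>0: "\<sigma> > 0"
begin

sublocale gauss_channel n "M * L" "sqrt (1 / real n)" \<sigma>
  using n1 \<sigma>0 by unfold_locales auto

abbreviation amp :: real where "amp \<equiv> sqrt (real n * P / real L)"

lemma amp: "amp > 0" using n1 L1 P0 by simp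

abbreviation snr :: real where "snr \<equiv> P / \<sigma>\<^sup>2"

abbreviation rate :: real where "rate \<equiv> real L * ln (real M) / real n"

text \<open>A minimiser of the distance is in particular no farther away than the transmitted
  message. Comparing with that message alone avoids any reference to further messages and counts
  ties as errors.\<close>

definition err :: "nat \<Rightarrow> (nat \<Rightarrow> nat) \<Rightarrow> ((nat \<times> nat \<Rightarrow> real) \<times> (nat \<Rightarrow> real)) set" where
  "err k m = {(A, w) \<in> space chan. \<exists>m'\<in>sparc_msgs L M. card {l \<in> {..<L}. m' l \<noteq> m l} = k \<and>
     sparc_sqdist n P L M A (\<lambda>i. sparc_codeword n P L M A m i + w i) m'
      \<le> sparc_sqdist n P L M A (\<lambda>i. sparc_codeword n P L M A m i + w i) m}"

definition cands :: "nat set \<Rightarrow> (nat \<Rightarrow> nat) \<Rightarrow> (nat \<Rightarrow> nat) set" where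
  "cands S m = {m' \<in> sparc_msgs L M. {l \<in> {..<L}. m' l \<noteq> m l} = S}"

lemma measurable_sqdist:
  assumes m: "m \<in> sparc_msgs L M" and m': "m' \<in> sparc_msgs L M"
  shows "(\<lambda>\<omega>. sparc_sqdist n P L M (fst \<omega>) (\<lambda>i. sparc_codeword n P L M (fst \<omega>) m i + snd \<omega> i) m')
    \<in> borel_measurable chan"
  unfolding sparc_sqdist_eq[OF m m']
  by (intro borel_measurable_sum borel_measurable_power borel_measurable_diff borel_measurable_add
      measurable_noise measurable_block_sum_comp msg_cols_subset m m') auto

lemma err_sets:
  assumes m: "m \<in> sparc_msgs L M"
  shows "err k m \<in> sets chan"
proof -
  have "err k m = (\<Union>m'\<in>{m'\<in>sparc_msgs L M. card {l \<in> {..<L}. m' l \<noteq> m l} = k}.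
    {\<omega> \<in> space chan. sparc_sqdist n P L M (fst \<omega>) (\<lambda>i. sparc_codeword n P L M (fst \<omega>) m i + snd \<omega> i) m'
      \<le> sparc_sqdist n P L M (fst \<omega>) (\<lambda>i. sparc_codeword n P L M (fst \<omega>) m i + snd \<omega> i) m})"
    by (auto simp: err_def)
  also have "\<dots> \<in> sets chan"
    by (intro sets.finite_UN borel_measurable_le measurable_sqdist m) (auto simp: finite_sparc_msgs)
  finally show ?thesis .
qed

lemma finite_cands: "finite (cands S m)"
  by (simp add: cands_def finite_sparc_msgs)

text \<open>Off \<open>S\<close> a candidate agrees with \<open>m\<close>, and off
  \<open>{..<L}\<close> all messages are \<open>undefined\<close>, so restriction to
  \<open>S\<close> is injective.\<close>

lemma card_cands_le:
  assumes "S \<subseteq> {..<L}"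
  shows "card (cands S m) \<le> M ^ card S"
proof -
  have fS: "finite S" using assms finite_subset by blast
  have "inj_on (\<lambda>m'. restrict m' S) (cands S m)"
  proof (rule inj_onI)
    fix x y assume x: "x \<in> cands S m" and y: "y \<in> cands S m" and eq: "restrict x S = restrict y S"
    show "x = y"
    proof
      fix l
      consider "l \<in> S" | "l \<in> {..<L} - S" | "l \<notin> {..<L}" by blast
      then show "x l = y l"
      proof cases
        case 1 then show ?thesis using eq by (metis restrict_apply')
      next
        case 2
        have "x l = m l" if "x \<in> cands S m" for x
        proof -
          have "l \<notin> {l \<in> {..<L}. x l \<noteq> m l}" using that 2 by (simp add: cands_def)
          then show ?thesis using 2 by simp
        qed
        from this[OF x] this[OF y] show ?thesis by simp
      next
        case 3 then show ?thesis using x y by (auto simp: cands_def sparc_msgs_def PiE_def extensional_def)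
      qed
    qed
  qed
  moreover have "(\<lambda>m'. restrict m' S) ` cands S m \<subseteq> S \<rightarrow>\<^sub>E {..<M}"
    using assms by (auto simp: cands_def sparc_msgs_def)
  ultimately have "card (cands S m) \<le> card (S \<rightarrow>\<^sub>E {..<M})"
    using fS by (intro card_inj_on_le finite_PiE) auto
  then show ?thesis using fS by (simp add: card_PiE)
qed

text \<open>Disjointness from all columns of \<open>m\<close>, and not just from those in
  \<open>S\<close>, is what the split needs.\<close>

lemma cands_cols:
  assumes m: "m \<in> sparc_msgs L M" and S: "S \<subseteq> {..<L}" "card S = k" and m': "m' \<in> cands S m"
  shows "msg_cols M m' S \<subseteq> {..<M * L} \<and> card (msg_cols M m' S) = k \<and> msg_cols M m' S \<inter> msg_cols M m {..<L} = {}"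
proof -
  have m'2: "m' \<in> sparc_msgs L M" and eq: "S = {l \<in> {..<L}. m' l \<noteq> m l}"
    using m' by (auto simp: cands_def)
  show ?thesis
    using S m m'2 by (intro conjI msg_cols_subset msg_cols_disjoint) (auto simp: card_msg_cols eq)
qed

lemma amp_power: "amp\<^sup>2 * (sqrt (1 / real n))\<^sup>2 = P / real L"
  using n1 L1 P0 by simp

lemma snr_frac: "x * snr / (1 + y * snr) = x * P / (\<sigma>\<^sup>2 + y * P)"
proof -
  have \<sigma>2: "\<sigma>\<^sup>2 \<noteq> 0" using \<sigma>0 by simp
  have "1 + y * snr = (\<sigma>\<^sup>2 + y * P) / \<sigma>\<^sup>2" using \<sigma>2 by (simp add: add_divide_distrib)
  then show ?thesis using \<sigma>2 by (simp add: divide_divide_eq_right)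
qed

lemma ln_pow_M: "ln (real M ^ k) = real n * (real k / real L * rate)"
  using n1 L1 M1 by (simp add: ln_realpow)

lemma emeasure_le_binomial:
  assumes sub: "E \<subseteq> (\<Union>S\<in>{S. S \<subseteq> {..<L} \<and> card S = k}. F S)"
    and F: "\<And>S. S \<subseteq> {..<L} \<Longrightarrow> card S = k \<Longrightarrow> F S \<in> sets chan"
    and le: "\<And>S. S \<subseteq> {..<L} \<Longrightarrow> card S = k \<Longrightarrow> emeasure chan (F S) \<le> ennreal B"
    and k: "k \<le> L"
  shows "emeasure chan E \<le> ennreal (exp (ln (real (L choose k))) * B)"
proof -
  let ?\<S> = "{S. S \<subseteq> {..<L} \<and> card S = k}"
  have fin: "finite ?\<S>" by simp
  have "emeasure chan E \<le> emeasure chan (\<Union>S\<in>?\<S>. F S)"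
    using F by (intro emeasure_mono sub sets.finite_UN fin) auto
  also have "\<dots> \<le> (\<Sum>S\<in>?\<S>. emeasure chan (F S))"
    using F by (intro emeasure_subadditive_finite fin) auto
  also have "\<dots> \<le> (\<Sum>S\<in>?\<S>. ennreal B)" by (intro sum_mono le) auto
  also have "\<dots> = of_nat (L choose k) * ennreal B"
    using n_subsets[of "{..<L}" k] by simp
  also have "\<dots> = ennreal (exp (ln (real (L choose k))) * B)"
    using k by (simp add: ennreal_of_nat_eq_real_of_nat ennreal_mult')
  finally show ?thesis .
qed

lemma in_err_cands:
  assumes m: "m \<in> sparc_msgs L M" and "\<omega> \<in> err k m"
  obtains S m' where "S \<subseteq> {..<L}" "card S = k" "m' \<in> cands S m" "\<omega> \<in> space chan"
    "(\<Sum>i<n. (snd \<omega> i + block_sum n amp (msg_cols M m S) (fst \<omega>) i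
        - block_sum n amp (msg_cols M m' S) (fst \<omega>) i)\<^sup>2) \<le> (\<Sum>i<n. (snd \<omega> i)\<^sup>2)"
proof -
  from assms(2) obtain m' where m': "m' \<in> sparc_msgs L M" "card {l \<in> {..<L}. m' l \<noteq> m l} = k"
    and le: "sparc_sqdist n P L M (fst \<omega>) (\<lambda>i. sparc_codeword n P L M (fst \<omega>) m i + snd \<omega> i) m'
      \<le> sparc_sqdist n P L M (fst \<omega>) (\<lambda>i. sparc_codeword n P L M (fst \<omega>) m i + snd \<omega> i) m"
    and sp: "\<omega> \<in> space chan"
    by (auto simp: err_def)
  show thesis
    by (rule that[of "{l \<in> {..<L}. m' l \<noteq> m l}" m'])
      (use m' le sp in \<open>auto simp: cands_def sparc_sqdist_eq[OF m m'(1)] sparc_sqdist_true[OF m]\<close>)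
qed

lemma exponent_rearrange:
  "A + (\<theta> * (N * (\<alpha> * R)) - N / 2 * (\<theta> * c) - N / 2 * d) = A - N * (\<theta> * (c / 2 - \<alpha> * R) + d / 2)"
  "A + (\<theta> * (N * (\<alpha> * R) + N * t) - N / 2 * (\<theta> * c) - N / 2 * d)
    = A - N * (\<theta> * (c / 2 - \<alpha> * R - t) + d / 2)"
  for A N R c d t \<alpha> \<theta> :: real
  by (simp_all add: algebra_simps)

text \<open>Here K is \<open>M ^ k\<close>, and its logarithm is n \<alpha> times
  \<open>rate\<close>; the binomial coefficient counts the sets \<open>S\<close>.\<close>

lemma err_direct_bound:
  assumes m: "m \<in> sparc_msgs L M" and k: "1 \<le> k" "k \<le> L" and \<theta>: "0 \<le> \<theta>" "\<theta> \<le> 1"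
  defines "\<alpha> \<equiv> real k / real L"
  shows "measure chan (err k m) \<le> exp (ln (real (L choose k))
    - n * (\<theta> * (cap_alpha \<alpha> snr - \<alpha> * rate) + ln (1 - \<theta>\<^sup>2 * (\<alpha> * snr / (1 + \<alpha> * snr))) / 2))"
proof -
  interpret c: prob_space chan by (rule prob_space_chan)
  define F where "F S = {\<omega> \<in> space chan. \<exists>m'\<in>cands S m.
      (\<Sum>i<n. (snd \<omega> i + block_sum n amp (msg_cols M m S) (fst \<omega>) i
        - block_sum n amp (msg_cols M m' S) (fst \<omega>) i)\<^sup>2) \<le> (\<Sum>i<n. (snd \<omega> i)\<^sup>2)}" for S
  define \<tau> where "\<tau> = amp * sqrt (1 / real n) * sqrt k"
  have \<tau>2: "\<tau>\<^sup>2 = \<alpha> * P"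
    unfolding \<tau>_def power_mult_distrib amp_power by (simp add: \<alpha>_def)
  have \<sigma>2: "\<sigma>\<^sup>2 > 0" using \<sigma>0 by simp
  have e1: "1 + \<tau>\<^sup>2 / \<sigma>\<^sup>2 = 1 + \<alpha> * snr" by (simp add: \<tau>2)
  have e2: "\<tau>\<^sup>2 / (\<sigma>\<^sup>2 + \<tau>\<^sup>2) = \<alpha> * snr / (1 + \<alpha> * snr)"
    by (simp only: \<tau>2 snr_frac)
  have "emeasure chan (err k m) \<le> ennreal (exp (ln (real (L choose k))) *
     exp (\<theta> * ln (real M ^ k) - n / 2 * (\<theta> * ln (1 + \<tau>\<^sup>2 / \<sigma>\<^sup>2))
        - n / 2 * ln (1 - \<theta>\<^sup>2 * (\<tau>\<^sup>2 / (\<sigma>\<^sup>2 + \<tau>\<^sup>2)))))"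
  proof (rule emeasure_le_binomial[OF _ _ _ k(2), where F=F])
    show "err k m \<subseteq> (\<Union>S\<in>{S. S \<subseteq> {..<L} \<and> card S = k}. F S)"
    proof
      fix \<omega> assume "\<omega> \<in> err k m"
      then show "\<omega> \<in> (\<Union>S\<in>{S. S \<subseteq> {..<L} \<and> card S = k}. F S)"
        by (rule in_err_cands[OF m]) (auto simp: F_def)
    qed
    fix S assume S: "S \<subseteq> {..<L}" "card S = k"
    have mS: "msg_cols M m S \<subseteq> {..<M * L}" by (rule msg_cols_subset[OF m S(1)])
    have sub: "msg_cols M m S \<subseteq> msg_cols M m {..<L}" using S by (auto simp: msg_cols_def)
    have "F S = (\<Union>m'\<in>cands S m. {\<omega> \<in> space chan.
      (\<Sum>i<n. (snd \<omega> i + block_sum n amp (msg_cols M m S) (fst \<omega>) i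
        - block_sum n amp (msg_cols M m' S) (fst \<omega>) i)\<^sup>2) \<le> (\<Sum>i<n. (snd \<omega> i)\<^sup>2)})"
      by (auto simp: F_def)
    also have "\<dots> \<in> sets chan"
      using cands_cols[OF m S] mS
      by (intro sets.finite_UN finite_cands borel_measurable_le borel_measurable_sum borel_measurable_power
          borel_measurable_diff borel_measurable_add measurable_noise measurable_block_sum_comp) auto
    finally show "F S \<in> sets chan" .
    show "emeasure chan (F S) \<le> ennreal (exp (\<theta> * ln (real M ^ k) - n / 2 * (\<theta> * ln (1 + \<tau>\<^sup>2 / \<sigma>\<^sup>2))
        - n / 2 * ln (1 - \<theta>\<^sup>2 * (\<tau>\<^sup>2 / (\<sigma>\<^sup>2 + \<tau>\<^sup>2)))))"
      unfolding \<tau>_def F_def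
    proof (rule direct_bound)
      show "real (card (cands S m)) \<le> real M ^ k"
        using card_cands_le[OF S(1), of m] S by (simp add: of_nat_power[symmetric] del: of_nat_power)
      show "card (msg_cols M m S) = k" using card_msg_cols[OF m S(1)] S by simp
      fix m' assume "m' \<in> cands S m"
      then show "msg_cols M m' S \<subseteq> {..<M * L} \<and> card (msg_cols M m' S) = k \<and>
         msg_cols M m' S \<inter> msg_cols M m S = {}"
        using cands_cols[OF m S] sub by blast
    qed (use finite_cands M1 \<theta> mS amp k in auto)
  qed
  also have "exp (ln (real (L choose k))) * exp (\<theta> * ln (real M ^ k) - n / 2 * (\<theta> * ln (1 + \<tau>\<^sup>2 / \<sigma>\<^sup>2))
        - n / 2 * ln (1 - \<theta>\<^sup>2 * (\<tau>\<^sup>2 / (\<sigma>\<^sup>2 + \<tau>\<^sup>2))))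
    = exp (ln (real (L choose k))
    - n * (\<theta> * (cap_alpha \<alpha> snr - \<alpha> * rate) + ln (1 - \<theta>\<^sup>2 * (\<alpha> * snr / (1 + \<alpha> * snr))) / 2))"
    unfolding e1 e2 ln_pow_M \<alpha>_def[symmetric]
    by (simp only: cap_alpha_def mult_exp_exp exponent_rearrange)
  finally show ?thesis by (simp add: c.emeasure_eq_measure)
qed

text \<open>Off the event \<open>G\<close> the scaled noise energy is at most Q + n t, so
  \<open>split_bound\<close> applies to each \<open>S\<close>. \<open>G\<close> involves only the
  noise and the whole codeword of \<open>m\<close>; it stays outside the union over \<open>S\<close>
  and escapes the binomial factor. The condition \<open>k < L\<close> leaves a correct section, so
  that the block \<open>J0\<close> is not empty.\<close>

lemma err_split_bound:
  assumes m: "m \<in> sparc_msgs L M" and k: "1 \<le> k" "k < L" and \<theta>: "0 \<le> \<theta>" "\<theta> \<le> 1"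
  defines "\<alpha> \<equiv> real k / real L"
  assumes \<mu>: "\<mu> \<ge> 0" "\<mu>\<^sup>2 * (\<alpha>\<^sup>2 * snr / (1 + \<alpha>\<^sup>2 * snr)) < 1"
  shows "measure chan (err k m) \<le> exp (ln (real (L choose k))
    - n * (\<theta> * (cap_alpha \<alpha> snr - \<alpha> * rate - t)
        + ln (1 - \<theta>\<^sup>2 * (\<alpha> * (1 - \<alpha>) * snr / (1 + \<alpha> * snr))) / 2))
    + exp (- real n * (\<mu> * t + ln (1 - \<mu>\<^sup>2 * (\<alpha>\<^sup>2 * snr / (1 + \<alpha>\<^sup>2 * snr))) / 2))"
proof -
  let ?all = "msg_cols M m {..<L}"
  define Q where "Q \<omega> = (\<Sum>i<n. (snd \<omega> i + block_sum n (\<alpha> * amp) ?all (fst \<omega>) i)\<^sup>2) / (2 * (\<sigma>\<^sup>2 + \<alpha>\<^sup>2 * P))"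
    for \<omega> :: "(nat \<times> nat \<Rightarrow> real) \<times> (nat \<Rightarrow> real)"
  define F where "F S = {\<omega> \<in> space chan. \<exists>m'\<in>cands S m.
      (\<Sum>i<n. (snd \<omega> i + block_sum n amp (msg_cols M m S) (fst \<omega>) i
        - block_sum n amp (msg_cols M m' S) (fst \<omega>) i)\<^sup>2) / (2 * \<sigma>\<^sup>2) - Q \<omega> \<le> n * t}" for S
  define G where "G = {\<omega> \<in> space chan. Q \<omega> - (\<Sum>i<n. (snd \<omega> i)\<^sup>2) / (2 * \<sigma>\<^sup>2) \<le> - (n * t)}"
  have \<sigma>2: "\<sigma>\<^sup>2 > 0" using \<sigma>0 by simp
  have allsub: "?all \<subseteq> {..<M * L}" by (rule msg_cols_subset[OF m]) simp
  have call: "card ?all = L" using card_msg_cols[OF m, of "{..<L}"] by simp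
  have p: "amp\<^sup>2 * (sqrt (1 / real n))\<^sup>2 * real L = P"
    unfolding amp_power using L1 by simp
  have snr1: "1 + \<alpha> * P / \<sigma>\<^sup>2 = 1 + \<alpha> * snr" by simp
  have \<alpha>0: "\<alpha> > 0" using k by (simp add: \<alpha>_def)
  note ms = borel_measurable_divide borel_measurable_sum borel_measurable_power borel_measurable_const
    borel_measurable_diff borel_measurable_add measurable_noise measurable_block_sum_comp
  have mQ: "Q \<in> borel_measurable chan" unfolding Q_def by (intro ms allsub) auto
  have mG: "G \<in> sets chan" unfolding G_def by (intro borel_measurable_le ms mQ) auto
  have mF: "F S \<in> sets chan" if S: "S \<subseteq> {..<L}" "card S = k" for S
  proof -
    have mS: "msg_cols M m S \<subseteq> {..<M * L}" by (rule msg_cols_subset[OF m S(1)])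
    have "F S = (\<Union>m'\<in>cands S m. {\<omega> \<in> space chan.
      (\<Sum>i<n. (snd \<omega> i + block_sum n amp (msg_cols M m S) (fst \<omega>) i
        - block_sum n amp (msg_cols M m' S) (fst \<omega>) i)\<^sup>2) / (2 * \<sigma>\<^sup>2) - Q \<omega> \<le> n * t})"
      by (auto simp: F_def)
    also have "\<dots> \<in> sets chan"
      using cands_cols[OF m S] mS
      by (intro sets.finite_UN finite_cands borel_measurable_le ms mQ) auto
    finally show ?thesis .
  qed
  let ?UF = "\<Union>S\<in>{S. S \<subseteq> {..<L} \<and> card S = k}. F S"
  have mUF: "?UF \<in> sets chan" using mF by (intro sets.finite_UN) auto
  have sub: "err k m \<subseteq> ?UF \<union> G"
  proof
    fix \<omega> assume "\<omega> \<in> err k m"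
    then show "\<omega> \<in> ?UF \<union> G"
    proof (rule in_err_cands[OF m])
      fix S m' assume S: "S \<subseteq> {..<L}" "card S = k" and m': "m' \<in> cands S m" and sp: "\<omega> \<in> space chan"
        and le: "(\<Sum>i<n. (snd \<omega> i + block_sum n amp (msg_cols M m S) (fst \<omega>) i
        - block_sum n amp (msg_cols M m' S) (fst \<omega>) i)\<^sup>2) \<le> (\<Sum>i<n. (snd \<omega> i)\<^sup>2)"
      have le': "(\<Sum>i<n. (snd \<omega> i + block_sum n amp (msg_cols M m S) (fst \<omega>) i
        - block_sum n amp (msg_cols M m' S) (fst \<omega>) i)\<^sup>2) / (2 * \<sigma>\<^sup>2) \<le> (\<Sum>i<n. (snd \<omega> i)\<^sup>2) / (2 * \<sigma>\<^sup>2)"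
        using le \<sigma>2 by (intro divide_right_mono) auto
      show ?thesis
      proof (cases "\<omega> \<in> G")
        case False
        then have "(\<Sum>i<n. (snd \<omega> i)\<^sup>2) / (2 * \<sigma>\<^sup>2) - Q \<omega> \<le> n * t"
          using sp by (simp add: G_def)
        then have "\<omega> \<in> F S" unfolding F_def using m' sp le' by (auto intro!: bexI[of _ m'])
        then show ?thesis using S by auto
      qed simp
    qed
  qed
  have "emeasure chan ?UF \<le> ennreal (exp (ln (real (L choose k))) *
     exp (\<theta> * (ln (real M ^ k) + n * t) - n / 2 * (\<theta> * ln (1 + \<alpha> * P / \<sigma>\<^sup>2))
        - n / 2 * ln (1 - \<theta>\<^sup>2 * (\<alpha> * (1 - \<alpha>) * P / (\<sigma>\<^sup>2 + \<alpha> * P)))))"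
  proof (rule emeasure_le_binomial[OF subset_refl mF])
    fix S assume S: "S \<subseteq> {..<L}" "card S = k"
    have mS: "msg_cols M m S \<subseteq> {..<M * L}" by (rule msg_cols_subset[OF m S(1)])
    let ?J0 = "msg_cols M m ({..<L} - S)"
    have J0: "?J0 \<subseteq> {..<M * L}" by (rule msg_cols_subset[OF m]) auto
    have un: "msg_cols M m S \<union> ?J0 = ?all" using S by (auto simp: msg_cols_Un[symmetric] Un_absorb1)
    have "{..<L} - S \<noteq> {}" using S k by (metis Diff_eq_empty_iff card_lessThan card_mono finite_subset finite_lessThan not_less)
    then have J0ne: "?J0 \<noteq> {}" by (simp add: msg_cols_def)
    have dis: "?J0 \<inter> msg_cols M m S = {}"
      using S by (intro msg_cols_disjoint[OF m m]) auto
    \<comment> \<open>This is \<open>split_bound\<close> with its abbreviations written out; they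
      simplify once the number of columns is replaced by \<open>L\<close> and the total power by
      \<open>P\<close>.\<close>
    have "emeasure chan {\<omega> \<in> space chan. \<exists>m'\<in>cands S m.
      (\<Sum>i<n. (snd \<omega> i + block_sum n amp (msg_cols M m S) (fst \<omega>) i
        - block_sum n amp ((\<lambda>m'. msg_cols M m' S) m') (fst \<omega>) i)\<^sup>2) / (2 * \<sigma>\<^sup>2)
        - (\<Sum>i<n. (snd \<omega> i + block_sum n (real k / real (card (msg_cols M m S \<union> ?J0)) * amp) (msg_cols M m S \<union> ?J0) (fst \<omega>) i)\<^sup>2)
          / (2 * (\<sigma>\<^sup>2 + (real k / real (card (msg_cols M m S \<union> ?J0)))\<^sup>2 * (amp\<^sup>2 * (sqrt (1 / real n))\<^sup>2 * real (card (msg_cols M m S \<union> ?J0))))) \<le> n * t}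
      \<le> ennreal (exp (\<theta> * (ln (real M ^ k) + n * t) - n / 2 * (\<theta> * ln (1 + real k / real (card (msg_cols M m S \<union> ?J0)) * (amp\<^sup>2 * (sqrt (1 / real n))\<^sup>2 * real (card (msg_cols M m S \<union> ?J0))) / \<sigma>\<^sup>2))
        - n / 2 * ln (1 - \<theta>\<^sup>2 * (real k / real (card (msg_cols M m S \<union> ?J0)) * (1 - real k / real (card (msg_cols M m S \<union> ?J0)))
           * (amp\<^sup>2 * (sqrt (1 / real n))\<^sup>2 * real (card (msg_cols M m S \<union> ?J0)))
           / (\<sigma>\<^sup>2 + real k / real (card (msg_cols M m S \<union> ?J0)) * (amp\<^sup>2 * (sqrt (1 / real n))\<^sup>2 * real (card (msg_cols M m S \<union> ?J0))))))))"
    proof (rule split_bound)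
      show "real (card (cands S m)) \<le> real M ^ k"
        using card_cands_le[OF S(1), of m] S by (simp add: of_nat_power[symmetric] del: of_nat_power)
      show "card (msg_cols M m S) = k" using card_msg_cols[OF m S(1)] S by simp
      fix m' assume "m' \<in> cands S m"
      then show "msg_cols M m' S \<subseteq> {..<M * L} \<and> card (msg_cols M m' S) = k \<and>
         msg_cols M m' S \<inter> (msg_cols M m S \<union> ?J0) = {}"
        unfolding un by (rule cands_cols[OF m S])
    qed (use finite_cands M1 \<theta> mS J0 J0ne dis amp k in auto)
    then show "emeasure chan (F S) \<le> ennreal (exp (\<theta> * (ln (real M ^ k) + n * t) - n / 2 * (\<theta> * ln (1 + \<alpha> * P / \<sigma>\<^sup>2))
        - n / 2 * ln (1 - \<theta>\<^sup>2 * (\<alpha> * (1 - \<alpha>) * P / (\<sigma>\<^sup>2 + \<alpha> * P)))))"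
      unfolding un call p \<alpha>_def[symmetric] F_def Q_def .
  qed (use k in auto)
  also have "exp (ln (real (L choose k))) * exp (\<theta> * (ln (real M ^ k) + n * t) - n / 2 * (\<theta> * ln (1 + \<alpha> * P / \<sigma>\<^sup>2))
        - n / 2 * ln (1 - \<theta>\<^sup>2 * (\<alpha> * (1 - \<alpha>) * P / (\<sigma>\<^sup>2 + \<alpha> * P))))
     = exp (ln (real (L choose k))
    - n * (\<theta> * (cap_alpha \<alpha> snr - \<alpha> * rate - t)
        + ln (1 - \<theta>\<^sup>2 * (\<alpha> * (1 - \<alpha>) * snr / (1 + \<alpha> * snr))) / 2))"
    unfolding snr_frac ln_pow_M \<alpha>_def[symmetric]
    by (simp only: cap_alpha_def mult_exp_exp exponent_rearrange snr1)
  finally have UF: "emeasure chan ?UF \<le> ennreal (exp (ln (real (L choose k))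
    - n * (\<theta> * (cap_alpha \<alpha> snr - \<alpha> * rate - t)
        + ln (1 - \<theta>\<^sup>2 * (\<alpha> * (1 - \<alpha>) * snr / (1 + \<alpha> * snr))) / 2)))" .
  have allne: "?all \<noteq> {}" using L1 by (auto simp: msg_cols_def lessThan_empty_iff)
  have "emeasure chan G \<le> ennreal (exp (- \<mu> * (n * t) - n / 2 * ln (1 - \<mu>\<^sup>2 * (\<alpha>\<^sup>2 * P / (\<sigma>\<^sup>2 + \<alpha>\<^sup>2 * P)))))"
    using common_statistic_bound[OF allsub allne amp \<alpha>0 \<mu>(1), of "n * t"] \<mu>(2)
    unfolding call p snr_frac G_def Q_def by simp
  also have "- \<mu> * (n * t) - n / 2 * ln (1 - \<mu>\<^sup>2 * (\<alpha>\<^sup>2 * P / (\<sigma>\<^sup>2 + \<alpha>\<^sup>2 * P)))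
    = - real n * (\<mu> * t + ln (1 - \<mu>\<^sup>2 * (\<alpha>\<^sup>2 * snr / (1 + \<alpha>\<^sup>2 * snr))) / 2)"
    unfolding snr_frac by (simp add: algebra_simps)
  finally have Gle: "emeasure chan G \<le> ennreal (exp (- real n * (\<mu> * t + ln (1 - \<mu>\<^sup>2 * (\<alpha>\<^sup>2 * snr / (1 + \<alpha>\<^sup>2 * snr))) / 2)))" .
  interpret c: prob_space chan by (rule prob_space_chan)
  have "measure chan (err k m) \<le> measure chan (?UF \<union> G)"
    using mUF mG by (intro c.finite_measure_mono sub) auto
  also have "\<dots> \<le> measure chan ?UF + measure chan G"
    by (rule measure_Un_le[OF mUF mG])
  also have "\<dots> \<le> exp (ln (real (L choose k))
    - n * (\<theta> * (cap_alpha \<alpha> snr - \<alpha> * rate - t)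
        + ln (1 - \<theta>\<^sup>2 * (\<alpha> * (1 - \<alpha>) * snr / (1 + \<alpha> * snr))) / 2))
    + exp (- real n * (\<mu> * t + ln (1 - \<mu>\<^sup>2 * (\<alpha>\<^sup>2 * snr / (1 + \<alpha>\<^sup>2 * snr))) / 2))"
    using UF Gle by (intro add_mono) (simp_all add: c.emeasure_eq_measure)
  finally show ?thesis .
qed

text \<open>The bound holds for every message, so averaging over the uniform message preserves it.
  The factor \<open>L\<close> counts the possible numbers of wrong sections: \<epsilon> > 0 excludes
  0, and \<open>B\<close> is the same for all \<open>k\<close>.\<close>

lemma sparc_err_event_bound:
  assumes le: "\<And>m k. m \<in> sparc_msgs L M \<Longrightarrow> 1 \<le> k \<Longrightarrow> k \<le> L \<Longrightarrow> \<epsilon> \<le> real k / real L \<Longrightarrow> measure chan (err k m) \<le> B"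
    and \<epsilon>: "\<epsilon> > 0" and B: "B \<ge> 0"
  shows "sparc_err_event n P L M \<sigma> \<epsilon> \<in> sets (sparc_space n L M \<sigma>) \<and>
    measure (sparc_space n L M \<sigma>) (sparc_err_event n P L M \<sigma> \<epsilon>) \<le> real L * B"
proof -
  let ?msgs = "sparc_msgs L M" and ?U = "uniform_count_measure (sparc_msgs L M)"
  have ne: "?msgs \<noteq> {}" using M1 by (auto simp: sparc_msgs_def PiE_eq_empty_iff lessThan_empty_iff)
  interpret u: prob_space ?U by (rule prob_space_uniform_count_measure[OF finite_sparc_msgs ne])
  interpret c: prob_space chan by (rule prob_space_chan)
  interpret uc: pair_prob_space ?U chan ..
  have space: "sparc_space n L M \<sigma> = ?U \<Otimes>\<^sub>M chan" by (simp add: sparc_space_def)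
  let ?sq = "\<lambda>m \<omega> m'. sparc_sqdist n P L M (fst \<omega>) (\<lambda>i. sparc_codeword n P L M (fst \<omega>) m i + snd \<omega> i) m'"
  define E where "E m = {\<omega> \<in> space chan. \<exists>m'\<in>?msgs. (\<forall>m''\<in>?msgs. ?sq m \<omega> m' \<le> ?sq m \<omega> m'') \<and> sec_err L m m' \<ge> \<epsilon>}" for m
  have mE: "E m \<in> sets chan" if m: "m \<in> ?msgs" for m
  proof -
    have "E m = (\<Union>m'\<in>{m'\<in>?msgs. sec_err L m m' \<ge> \<epsilon>}. \<Inter>m''\<in>?msgs. {\<omega> \<in> space chan. ?sq m \<omega> m' \<le> ?sq m \<omega> m''})"
      using ne by (auto simp: E_def)
    also have "\<dots> \<in> sets chan"
      using m by (intro sets.finite_UN sets.finite_INT borel_measurable_le measurable_sqdist ne finite_sparc_msgs)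
        (auto simp: finite_sparc_msgs)
    finally show ?thesis .
  qed
  have Ele: "measure chan (E m) \<le> real L * B" if m: "m \<in> ?msgs" for m
  proof -
    let ?K = "{k \<in> {1..L}. \<epsilon> \<le> real k / real L}"
    have "E m \<subseteq> (\<Union>k\<in>?K. err k m)"
    proof
      fix \<omega> assume "\<omega> \<in> E m"
      then obtain m' where sp: "\<omega> \<in> space chan" and m': "m' \<in> ?msgs"
        and opt: "\<forall>m''\<in>?msgs. ?sq m \<omega> m' \<le> ?sq m \<omega> m''" and se: "\<epsilon> \<le> sec_err L m m'"
        by (auto simp: E_def)
      define k where "k = card {l \<in> {..<L}. m' l \<noteq> m l}"
      have k\<epsilon>: "\<epsilon> \<le> real k / real L" using se by (simp add: sec_err_def k_def)
      then have "k \<noteq> 0" using \<epsilon> by (intro notI) simp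
      moreover have "k \<le> L" unfolding k_def using card_mono[of "{..<L}" "{l \<in> {..<L}. m' l \<noteq> m l}"] by auto
      ultimately have "k \<in> ?K" using k\<epsilon> by auto
      moreover have "\<omega> \<in> err k m" using sp m' opt m by (auto simp: err_def k_def case_prod_beta')
      ultimately show "\<omega> \<in> (\<Union>k\<in>?K. err k m)" by blast
    qed
    then have "measure chan (E m) \<le> measure chan (\<Union>k\<in>?K. err k m)"
      using m by (intro c.finite_measure_mono sets.finite_UN err_sets) auto
    also have "\<dots> \<le> (\<Sum>k\<in>?K. measure chan (err k m))"
      using m err_sets by (intro measure_UNION_le) auto
    also have "\<dots> \<le> (\<Sum>k\<in>?K. B)" by (intro sum_mono le m) auto
    also have "\<dots> = real (card ?K) * B" by simp
    also have "\<dots> \<le> real (card {1..L}) * B" using B by (intro mult_right_mono of_nat_mono card_mono) auto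
    finally show ?thesis by simp
  qed
  have ev: "sparc_err_event n P L M \<sigma> \<epsilon> = (\<Union>m\<in>?msgs. {m} \<times> E m)"
  proof -
    have "(m, A, w) \<in> sparc_err_event n P L M \<sigma> \<epsilon> \<longleftrightarrow> m \<in> ?msgs \<and> (A, w) \<in> E m" for m A w
      by (simp add: sparc_err_event_def space space_pair_measure space_uniform_count_measure E_def Let_def)
    then show ?thesis by (auto simp del: split_paired_Ex)
  qed
  have mev: "sparc_err_event n P L M \<sigma> \<epsilon> \<in> sets (?U \<Otimes>\<^sub>M chan)"
    unfolding ev by (intro sets.finite_UN finite_sparc_msgs pair_measureI mE) (auto simp: sets_uniform_count_measure)
  have "emeasure (?U \<Otimes>\<^sub>M chan) (sparc_err_event n P L M \<sigma> \<epsilon>)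
    = (\<integral>\<^sup>+m. emeasure chan (Pair m -` sparc_err_event n P L M \<sigma> \<epsilon>) \<partial>?U)"
    by (rule c.emeasure_pair_measure_alt[OF mev])
  also have "\<dots> \<le> (\<integral>\<^sup>+m. ennreal (real L * B) \<partial>?U)"
  proof (rule nn_integral_mono)
    fix m assume "m \<in> space ?U"
    then have m: "m \<in> ?msgs" by (simp add: space_uniform_count_measure)
    have "Pair m -` sparc_err_event n P L M \<sigma> \<epsilon> = E m" using m by (auto simp: ev)
    then show "emeasure chan (Pair m -` sparc_err_event n P L M \<sigma> \<epsilon>) \<le> ennreal (real L * B)"
      using Ele[OF m] by (simp add: c.emeasure_eq_measure ennreal_leI)
  qed
  also have "\<dots> = ennreal (real L * B)" by (simp add: u.emeasure_space_1)
  finally have "measure (?U \<Otimes>\<^sub>M chan) (sparc_err_event n P L M \<sigma> \<epsilon>) \<le> real L * B"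
    using B by (simp add: uc.P.emeasure_eq_measure)
  then show ?thesis unfolding space using mev by simp
qed

end

section \<open>Exponents\<close>

lemma ln_one_minus_ge:
  fixes y :: real
  assumes "y < 1"
  shows "ln (1 - y) \<ge> - y / (1 - y)"
proof -
  have "ln (1 / (1 - y)) \<le> 1 / (1 - y) - 1"
    using assms by (intro ln_le_minus_one) simp
  then show ?thesis using assms by (simp add: ln_div field_simps)
qed

lemma ln_one_plus_ge_quadratic:
  fixes x :: real
  assumes "x \<ge> 0"
  shows "ln (1 + x) \<ge> x - x\<^sup>2 / 2"
proof -
  have "ln (1 + 0) - 0 + 0\<^sup>2 / 2 \<le> ln (1 + x) - x + x\<^sup>2 / 2"
  proof (rule DERIV_nonneg_imp_nondecreasing[OF assms, where f="\<lambda>s. ln (1 + s) - s + s\<^sup>2 / 2"])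
    fix s :: real assume s: "0 \<le> s" "s \<le> x"
    have "DERIV (\<lambda>s. ln (1 + s) - s + s\<^sup>2 / 2) s :> 1 / (1 + s) - 1 + s"
      using s by (auto intro!: derivative_eq_intros)
    moreover have "1 / (1 + s) - 1 + s = s\<^sup>2 / (1 + s)"
      using s by (simp add: field_simps power2_eq_square)
    ultimately show "\<exists>y. DERIV (\<lambda>s. ln (1 + s) - s + s\<^sup>2 / 2) s :> y \<and> 0 \<le> y"
      using s by (intro exI[of _ "1 / (1 + s) - 1 + s"]) auto
  qed
  then show ?thesis by simp
qed

text \<open>Apply ln z \<le> z - 1 to the quotient of the two arguments. The estimate serves twice:
  with \<open>r\<close> a critical point it proves maximality, and with \<open>r\<close> an overshot
  multiplier it bounds the cost of overshooting.\<close>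

lemma chernoff_exponent_diff:
  fixes t r \<delta> u :: real
  assumes "t\<^sup>2 * u < 1" "r\<^sup>2 * u < 1"
  shows "(t * \<delta> + ln (1 - t\<^sup>2 * u) / 2) - (r * \<delta> + ln (1 - r\<^sup>2 * u) / 2)
    \<le> (t - r) * (\<delta> - (t + r) * u / (2 * (1 - r\<^sup>2 * u)))"
proof -
  have p: "1 - r\<^sup>2 * u > 0" using assms by simp
  have "ln (1 - t\<^sup>2 * u) - ln (1 - r\<^sup>2 * u) = ln ((1 - t\<^sup>2 * u) / (1 - r\<^sup>2 * u))"
    using assms by (simp add: ln_div)
  also have "\<dots> \<le> (1 - t\<^sup>2 * u) / (1 - r\<^sup>2 * u) - 1"
    using assms by (intro ln_le_minus_one) simp
  also have "\<dots> = - 2 * ((t - r) * ((t + r) * u / (2 * (1 - r\<^sup>2 * u))))"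
    using p by (simp add: field_simps power2_eq_square)
  finally show ?thesis
    unfolding right_diff_distrib left_diff_distrib[of t r \<delta>] by linarith
qed

section \<open>The multiplier attaining \<open>D1\<close> and a lower bound for it\<close>

text \<open>Up to the positive factor 1 - t^2 u, the function \<open>g\<close> is the derivative of
  the exponent. Either it is nonnegative at 1, or it vanishes somewhere on the interval; the last
  two conclusions record this first-order condition.\<close>

lemma D1_maximiser:
  fixes u \<delta> :: real
  assumes u: "0 < u" "u < 1" and \<delta>: "\<delta> > 0"
  obtains r where "0 < r" "r \<le> 1" "D1 \<delta> u = r * \<delta> + ln (1 - r\<^sup>2 * u) / 2"
    "r * u \<le> \<delta> * (1 - r\<^sup>2 * u)" "r < 1 \<Longrightarrow> r * u = \<delta> * (1 - r\<^sup>2 * u)"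
proof -
  define g where "g t = \<delta> * (1 - t\<^sup>2 * u) - t * u" for t
  have "\<exists>r. 0 \<le> r \<and> r \<le> 1 \<and> g r \<ge> 0 \<and> (r < 1 \<longrightarrow> g r = 0)"
  proof (cases "g 1 \<ge> 0")
    case True
    then show ?thesis by (intro exI[of _ 1]) auto
  next
    case False
    have "\<exists>x\<ge>0. x \<le> 1 \<and> g x = 0"
      by (rule IVT2') (use False \<delta> in \<open>auto simp: g_def intro!: continuous_intros\<close>)
    then show ?thesis by auto
  qed
  then obtain r where r: "0 \<le> r" "r \<le> 1" "g r \<ge> 0" "r < 1 \<longrightarrow> g r = 0" by blast
  have r0: "r > 0" using r \<delta> by (cases "r = 0") (auto simp: g_def)
  have lt: "t\<^sup>2 * u < 1" if "0 \<le> t" "t \<le> 1" for t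
  proof -
    have "t\<^sup>2 * u \<le> 1 * u" using that u by (intro mult_right_mono) (auto simp: power_le_one)
    then show ?thesis using u by linarith
  qed
  have p: "1 - r\<^sup>2 * u > 0" using lt[of r] r by simp
  have max: "t * \<delta> + ln (1 - t\<^sup>2 * u) / 2 \<le> r * \<delta> + ln (1 - r\<^sup>2 * u) / 2" if t: "0 \<le> t" "t \<le> 1" for t
  proof -
    let ?b = "\<delta> - (t + r) * u / (2 * (1 - r\<^sup>2 * u))"
    have b: "?b = (2 * (\<delta> * (1 - r\<^sup>2 * u)) - (t + r) * u) / (2 * (1 - r\<^sup>2 * u))"
      using p by (simp add: field_simps)
    have "(t - r) * ?b \<le> 0"
    proof (cases "t \<le> r")
      case True
      have "(t + r) * u \<le> 2 * (r * u)" using True u by (simp add: algebra_simps)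
      also have "\<dots> \<le> 2 * (\<delta> * (1 - r\<^sup>2 * u))" using r by (simp add: g_def)
      finally have "?b \<ge> 0" unfolding b using p by simp
      then show ?thesis using True by (simp add: mult_nonpos_nonneg)
    next
      case False
      then have "r < 1" using t by simp
      then have eq: "\<delta> * (1 - r\<^sup>2 * u) = r * u" using r by (simp add: g_def)
      have "2 * (r * u) \<le> (t + r) * u" using False u by (simp add: algebra_simps)
      then have "?b \<le> 0" unfolding b eq using p by (intro divide_nonpos_nonneg) auto
      then show ?thesis using False by (simp add: mult_nonneg_nonpos)
    qed
    then show ?thesis using chernoff_exponent_diff[OF lt[OF t] lt[OF r(1,2)], of \<delta>] by linarith
  qed
  have D: "D1 \<delta> u = r * \<delta> + ln (1 - r\<^sup>2 * u) / 2"
    unfolding D1_def by (rule cSup_eq_maximum) (use max r in auto)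
  show thesis
    by (rule that[OF r0 r(2) D]) (use r in \<open>auto simp: g_def\<close>)
qed

text \<open>The difference of both sides vanishes at snr 0 and has a nonnegative derivative in the
  snr. The bound makes \<delta> / u, which approximates the maximiser in \<open>D1\<close>,
  comparable with \<open>w_fun\<close>.\<close>

lemma cap_gap_ge:
  fixes \<alpha> v :: real
  assumes \<alpha>: "0 \<le> \<alpha>" "\<alpha> \<le> 1" and v: "v \<ge> 0"
  shows "cap_alpha \<alpha> v - \<alpha> * cap_alpha 1 v \<ge> v / (4 * (1 + v)) * (\<alpha> * (1 - \<alpha>) * v / (1 + \<alpha> * v))"
proof -
  let ?h = "\<lambda>s. ln (1 + \<alpha> * s) - \<alpha> * ln (1 + s) - \<alpha> * (1 - \<alpha>) / 2 * (s\<^sup>2 / ((1 + s) * (1 + \<alpha> * s)))"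
  have "?h 0 \<le> ?h v"
  proof (rule DERIV_nonneg_imp_nondecreasing[OF v])
    fix s assume s: "0 \<le> s" "s \<le> v"
    have p: "1 + s > 0" "1 + \<alpha> * s > 0" using s \<alpha> by (auto simp: add_pos_nonneg)
    let ?d = "\<alpha> / (1 + \<alpha> * s) - \<alpha> / (1 + s) - \<alpha> * (1 - \<alpha>) / 2 *
      ((2 * s * ((1 + s) * (1 + \<alpha> * s)) - s\<^sup>2 * ((1 + \<alpha> * s) + (1 + s) * \<alpha>)) / ((1 + s) * (1 + \<alpha> * s))\<^sup>2)"
    have d1: "DERIV (\<lambda>s. s\<^sup>2 / ((1 + s) * (1 + \<alpha> * s))) s :>
      (2 * s * ((1 + s) * (1 + \<alpha> * s)) - s\<^sup>2 * ((1 + \<alpha> * s) + (1 + s) * \<alpha>)) / ((1 + s) * (1 + \<alpha> * s))\<^sup>2"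
      using p by (auto intro!: derivative_eq_intros simp: power2_eq_square)
    have d2: "DERIV (\<lambda>s. ln (1 + \<alpha> * s) - \<alpha> * ln (1 + s)) s :> \<alpha> / (1 + \<alpha> * s) - \<alpha> / (1 + s)"
      using p by (auto intro!: derivative_eq_intros)
    have der: "DERIV ?h s :> ?d"
      by (rule DERIV_diff[OF d2 DERIV_cmult[OF d1]])
    have "?d = \<alpha> * (1 - \<alpha>) / 2 * (s * (2 * (1 + s) * (1 + \<alpha> * s) - (2 + (1 + \<alpha>) * s)) / ((1 + s) * (1 + \<alpha> * s))\<^sup>2)"
    proof -
      have "\<alpha> / (1 + \<alpha> * s) - \<alpha> / (1 + s) = \<alpha> * (1 - \<alpha>) * s / ((1 + s) * (1 + \<alpha> * s))"
        using p by (simp add: field_simps)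
      also have "\<dots> = \<alpha> * (1 - \<alpha>) / 2 * (s * (2 * (1 + s) * (1 + \<alpha> * s)) / ((1 + s) * (1 + \<alpha> * s))\<^sup>2)"
      proof -
        define q where "q = (1 + s) * (1 + \<alpha> * s)"
        have q: "q > 0" using p by (simp add: q_def)
        have q2: "2 * (1 + s) * (1 + \<alpha> * s) = 2 * q" by (simp add: q_def)
        show ?thesis unfolding q_def[symmetric] q2 using q by (simp add: power2_eq_square)
      qed
      finally have e: "\<alpha> / (1 + \<alpha> * s) - \<alpha> / (1 + s) = \<alpha> * (1 - \<alpha>) / 2 * (s * (2 * (1 + s) * (1 + \<alpha> * s)) / ((1 + s) * (1 + \<alpha> * s))\<^sup>2)" .
      have e2: "2 * s * ((1 + s) * (1 + \<alpha> * s)) - s\<^sup>2 * ((1 + \<alpha> * s) + (1 + s) * \<alpha>) = s * (2 + (1 + \<alpha>) * s)"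
        by (simp add: algebra_simps power2_eq_square)
      show ?thesis unfolding e e2
        by (simp only: right_diff_distrib[symmetric] diff_divide_distrib[symmetric])
    qed
    moreover have "2 * (1 + s) * (1 + \<alpha> * s) - (2 + (1 + \<alpha>) * s) \<ge> 0"
    proof -
      have "2 * (1 + s) * (1 + \<alpha> * s) - (2 + (1 + \<alpha>) * s) = s + \<alpha> * s + 2 * (\<alpha> * s\<^sup>2)"
        by (simp add: algebra_simps power2_eq_square)
      then show ?thesis using s \<alpha> by simp
    qed
    ultimately have "?d \<ge> 0" using s \<alpha> by (auto intro!: mult_nonneg_nonneg divide_nonneg_nonneg)
    with der show "\<exists>y. DERIV ?h s :> y \<and> y \<ge> 0" by blast
  qed
  then have "ln (1 + \<alpha> * v) - \<alpha> * ln (1 + v) \<ge> \<alpha> * (1 - \<alpha>) / 2 * (v\<^sup>2 / ((1 + v) * (1 + \<alpha> * v)))"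
    by simp
  moreover have "v / (4 * (1 + v)) * (\<alpha> * (1 - \<alpha>) * v / (1 + \<alpha> * v))
    = \<alpha> * (1 - \<alpha>) / 2 * (v\<^sup>2 / ((1 + v) * (1 + \<alpha> * v))) / 2"
  proof -
    define V X where "V = 1 + v" and "X = 1 + \<alpha> * v"
    show ?thesis unfolding V_def[symmetric] X_def[symmetric] by (simp add: power2_eq_square mult_ac)
  qed
  moreover have "z \<le> x / 2 - \<alpha> * (y / 2)" if "x - \<alpha> * y \<ge> e" "z = e / 2" for x y z e :: real
    using that by (simp add: field_simps)
  ultimately show ?thesis unfolding cap_alpha_def mult_1 by blast
qed

text \<open>Bounding the square root in \<open>w_fun\<close> from below by 2 leaves a spare factor 1
  + v in the second inequality, which becomes the margin in \<open>maximiser_ge\<close>. The third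
  one adds 4 v \<le> (1 + v)^2.\<close>

lemma w_fun_bounds:
  assumes v: "v > 0"
  shows "w_fun v > 0" "w_fun v * (1 + v) \<le> v / (4 * (1 + v))" "w_fun v \<le> 1 / 16"
proof -
  have s: "sqrt (4 + v^3 / (1 + v)) \<ge> 2"
    using v by (intro real_le_rsqrt) simp
  have s': "4 + v^3 / (1 + v) > 0" using v by (simp add: add_pos_nonneg)
  have p: "2 * (1 + v)\<^sup>2 > 0" using v by simp
  show "w_fun v > 0" unfolding w_fun_def using v s s' p by (intro divide_pos_pos mult_pos_pos) auto
  have "w_fun v \<le> v / (2 * (1 + v)\<^sup>2 * 2)"
    unfolding w_fun_def using v s s' p by (intro divide_left_mono mult_left_mono mult_pos_pos) auto
  then have le: "w_fun v \<le> v / (4 * (1 + v)\<^sup>2)" by simp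
  have "w_fun v * (1 + v) \<le> v / (4 * (1 + v)\<^sup>2) * (1 + v)"
    using le v by (intro mult_right_mono) auto
  also have "\<dots> = v / (4 * (1 + v))" using v by (simp add: power2_eq_square)
  finally show "w_fun v * (1 + v) \<le> v / (4 * (1 + v))" .
  have "v / (4 * (1 + v)\<^sup>2) \<le> 1 / 16"
  proof -
    have "(1 - v)\<^sup>2 \<ge> 0" by simp
    then have "4 * v \<le> (1 + v)\<^sup>2" by (simp add: power2_eq_square algebra_simps)
    then show ?thesis using v by (simp add: field_simps)
  qed
  then show "w_fun v \<le> 1 / 16" using le by linarith
qed

text \<open>A maximiser below 1 equals \<delta> (1 - r^2 u) / u, where \<delta> / u is at least c =
  v / (4 (1 + v)). If r < c, then 1 - r^2 u \<ge> 1 - c^2, and (1 + v) c^2 \<le> v / 16 turns the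
  spare factor 1 + v into 1 + 15 v / 16.\<close>

lemma maximiser_ge:
  fixes r u v \<delta> :: real
  assumes v: "v > 0" and u: "0 < u" "u < 1" and \<delta>: "\<delta> \<ge> v / (4 * (1 + v)) * u"
    and r: "0 < r" "r \<le> 1" "r < 1 \<Longrightarrow> r * u = \<delta> * (1 - r\<^sup>2 * u)"
  shows "r \<ge> w_fun v * (1 + 15 / 16 * v)"
proof -
  define c where "c = v / (4 * (1 + v))"
  note w = w_fun_bounds[OF v]
  have c: "c > 0" "c \<le> 1 / 4" using v by (auto simp: c_def field_simps)
  have wc: "w_fun v * (1 + v) \<le> c" using w by (simp add: c_def)
  have "w_fun v * (1 + 15 / 16 * v) \<le> w_fun v * (1 + v)" using w v by (intro mult_left_mono) auto
  then have wc': "w_fun v * (1 + 15 / 16 * v) \<le> c" using wc by linarith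
  show ?thesis
  proof (cases "r \<ge> c")
    case True then show ?thesis using wc' by linarith
  next
    case False
    then have "r < 1" using c by linarith
    from r(3)[OF this] have "r * u = \<delta> * (1 - r\<^sup>2 * u)" .
    moreover have r2: "r\<^sup>2 * u \<le> c\<^sup>2 * 1"
      using False r u by (intro mult_mono power_mono) auto
    have c2: "c\<^sup>2 \<le> 1" using c by (simp add: power_le_one)
    have "c * u * (1 - r\<^sup>2 * u) \<le> \<delta> * (1 - r\<^sup>2 * u)"
      using \<delta> r2 c2 by (intro mult_right_mono) (auto simp: c_def)
    ultimately have "c * (1 - r\<^sup>2 * u) * u \<le> r * u" by (simp add: algebra_simps)
    then have "c * (1 - r\<^sup>2 * u) \<le> r" using u by simp
    moreover have "c * (1 - c\<^sup>2) \<le> c * (1 - r\<^sup>2 * u)" using r2 c by (intro mult_left_mono) auto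
    moreover have "w_fun v * (1 + v) * (1 - c\<^sup>2) \<le> c * (1 - c\<^sup>2)"
      using wc c2 by (intro mult_right_mono) auto
    moreover have "(1 + v) * (1 - c\<^sup>2) \<ge> 1 + 15 / 16 * v"
    proof -
      have "(1 + v) * c = v / 4" using v by (simp add: c_def field_simps)
      then have "(1 + v) * c\<^sup>2 = v / 4 * c" by (simp add: power2_eq_square mult.assoc[symmetric])
      also have "\<dots> \<le> v / 4 * (1 / 4)" using c v by (intro mult_left_mono) auto
      finally show ?thesis by (simp add: algebra_simps)
    qed
    then have "w_fun v * (1 + 15 / 16 * v) \<le> w_fun v * ((1 + v) * (1 - c\<^sup>2))"
      using w by (intro mult_left_mono) auto
    ultimately show ?thesis by (simp add: mult.assoc)
  qed
qed

section \<open>The exponent of the common statistic and the loss of the direct bound\<close>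

lemma g_fun_le: "g_fun x \<le> 2 * x\<^sup>2"
proof -
  have "(1 + 2 * x\<^sup>2)\<^sup>2 = 1 + 4 * x\<^sup>2 + (2 * x\<^sup>2)\<^sup>2" by (simp add: power2_eq_square algebra_simps)
  then have "1 + 4 * x\<^sup>2 \<le> (1 + 2 * x\<^sup>2)\<^sup>2" by simp
  then have "sqrt (1 + 4 * x\<^sup>2) \<le> 1 + 2 * x\<^sup>2" by (intro real_le_lsqrt) auto
  then show ?thesis by (simp add: g_fun_def)
qed

text \<open>The multipliers \<theta> are chosen against this quadratic majorant; the exact
  \<open>g_fun\<close> term matters for the common statistic.\<close>

lemma g_fun_snr_le:
  assumes v: "v > 0"
  shows "g_fun (\<Delta> / (2 * sqrt v)) / 4 \<le> \<Delta>\<^sup>2 / (8 * v)"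
  using g_fun_le[of "\<Delta> / (2 * sqrt v)"] v by (simp add: power_divide power_mult_distrib)

text \<open>The threshold \<alpha> \<Delta> / 2 is half of the gap. With s = \<mu> sqrt u and x =
  \<Delta> / (2 sqrt v) the linear term is at least s x; here \<alpha> cancels, so the bound is
  uniform in \<alpha>. The choice s = g / (2 x) is the zero of the derivative of s x + ln (1 - s^2)
  / 2. Since 1 - s^2 = 1 / (1 + g / 2), the value there is g / 2 - ln (1 + g / 2) / 2, at least g /
  4.\<close>

lemma common_exponent_ge:
  fixes \<alpha> v \<Delta> :: real
  assumes \<alpha>: "\<alpha> > 0" and v: "v > 0" and \<Delta>: "\<Delta> > 0"
  obtains \<mu> where "\<mu> \<ge> 0" "\<mu>\<^sup>2 * (\<alpha>\<^sup>2 * v / (1 + \<alpha>\<^sup>2 * v)) < 1"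
    "\<mu> * (\<alpha> * \<Delta> / 2) + ln (1 - \<mu>\<^sup>2 * (\<alpha>\<^sup>2 * v / (1 + \<alpha>\<^sup>2 * v))) / 2 \<ge> g_fun (\<Delta> / (2 * sqrt v)) / 4"
proof -
  define x where "x = \<Delta> / (2 * sqrt v)"
  define g where "g = g_fun x"
  define u where "u = \<alpha>\<^sup>2 * v / (1 + \<alpha>\<^sup>2 * v)"
  define s where "s = g / (2 * x)"
  define \<mu> where "\<mu> = s / sqrt u"
  have x: "x > 0" using v \<Delta> by (simp add: x_def)
  have g1: "(g + 1)\<^sup>2 = 1 + 4 * x\<^sup>2" by (simp add: g_def g_fun_def)
  have "sqrt (1 + 4 * x\<^sup>2) > 1" using x by simp
  then have g: "g > 0" by (simp add: g_def g_fun_def)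
  have gg: "g * (g + 2) = 4 * x\<^sup>2" using g1 by (simp add: power2_eq_square algebra_simps)
  have pu: "1 + \<alpha>\<^sup>2 * v > 0" using v by (simp add: add_pos_nonneg)
  have u: "u > 0" unfolding u_def using \<alpha> v pu by simp
  have s0: "s > 0" using g x by (simp add: s_def)
  have s2: "s\<^sup>2 = g / (g + 2)"
  proof -
    have "s\<^sup>2 = g * g / (g * (g + 2))" unfolding gg by (simp add: s_def power_divide power_mult_distrib power2_eq_square)
    then show ?thesis using g by simp
  qed
  have mu2: "\<mu>\<^sup>2 * u = s\<^sup>2" using u by (simp add: \<mu>_def power_divide)
  have one: "1 - s\<^sup>2 = 1 / (1 + g / 2)" unfolding s2 using g by (simp add: field_simps)
  have lnb: "ln (1 - \<mu>\<^sup>2 * u) \<ge> - (g / 2)"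
  proof -
    have "ln (1 + g / 2) \<le> g / 2" using g by (intro ln_add_one_self_le_self) simp
    then show ?thesis unfolding mu2 one using g by (simp add: ln_div)
  qed
  have squ: "sqrt u = \<alpha> * sqrt v / sqrt (1 + \<alpha>\<^sup>2 * v)"
    using \<alpha> by (simp add: u_def real_sqrt_divide real_sqrt_mult)
  have "\<mu> * (\<alpha> * \<Delta> / 2) = s * x * sqrt (1 + \<alpha>\<^sup>2 * v)"
    using \<alpha> v by (simp add: \<mu>_def squ x_def mult_ac)
  also have "\<dots> \<ge> s * x * 1" using s0 x v by (intro mult_left_mono) auto
  finally have "\<mu> * (\<alpha> * \<Delta> / 2) \<ge> g / 2" using x by (simp add: s_def)
  then have fin: "\<mu> * (\<alpha> * \<Delta> / 2) + ln (1 - \<mu>\<^sup>2 * u) / 2 \<ge> g / 4" using lnb by linarith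
  show thesis
  proof (rule that[of \<mu>])
    show "\<mu> \<ge> 0" using s0 u by (simp add: \<mu>_def)
    show "\<mu>\<^sup>2 * (\<alpha>\<^sup>2 * v / (1 + \<alpha>\<^sup>2 * v)) < 1"
      unfolding u_def[symmetric] mu2 s2 using g by simp
    show "g_fun (\<Delta> / (2 * sqrt v)) / 4 \<le> \<mu> * (\<alpha> * \<Delta> / 2) + ln (1 - \<mu>\<^sup>2 * (\<alpha>\<^sup>2 * v / (1 + \<alpha>\<^sup>2 * v))) / 2"
      using fin unfolding u_def[symmetric] g_def x_def .
  qed
qed

text \<open>With x = \<alpha> v the argument of the logarithm is (1 + x - \<theta>^2 x) / (1 + x),
  and \<theta> \<le> 1 makes the numerator at least 1.\<close>

lemma ln_direct_ge:
  fixes \<theta> \<alpha> v :: real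
  assumes \<theta>: "0 \<le> \<theta>" "\<theta> \<le> 1" and \<alpha>: "0 \<le> \<alpha>" and v: "v > 0"
  shows "ln (1 - \<theta>\<^sup>2 * (\<alpha> * v / (1 + \<alpha> * v))) \<ge> - (\<theta>\<^sup>2 * (\<alpha> * v))"
proof -
  let ?x = "\<alpha> * v"
  have x: "?x \<ge> 0" using \<alpha> v by simp
  have t1: "\<theta>\<^sup>2 \<le> 1" using \<theta> by (simp add: power_le_one)
  have tx: "\<theta>\<^sup>2 * ?x \<le> 1 * ?x" using t1 x by (intro mult_right_mono) auto
  have e: "1 - \<theta>\<^sup>2 * (?x / (1 + ?x)) = (1 + ?x - \<theta>\<^sup>2 * ?x) / (1 + ?x)" using x by (simp add: field_simps)
  have p: "1 + ?x - \<theta>\<^sup>2 * ?x \<ge> 1" using tx by simp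
  have lt: "\<theta>\<^sup>2 * (?x / (1 + ?x)) < 1"
  proof -
    have "1 - \<theta>\<^sup>2 * (?x / (1 + ?x)) > 0" unfolding e using p x by (intro divide_pos_pos) auto
    then show ?thesis by simp
  qed
  have "ln (1 - \<theta>\<^sup>2 * (?x / (1 + ?x))) \<ge> - (\<theta>\<^sup>2 * (?x / (1 + ?x))) / (1 - \<theta>\<^sup>2 * (?x / (1 + ?x)))"
    by (rule ln_one_minus_ge[OF lt])
  moreover have "\<theta>\<^sup>2 * (?x / (1 + ?x)) / (1 - \<theta>\<^sup>2 * (?x / (1 + ?x))) \<le> \<theta>\<^sup>2 * ?x"
  proof -
    have "\<theta>\<^sup>2 * (?x / (1 + ?x)) / (1 - \<theta>\<^sup>2 * (?x / (1 + ?x))) = \<theta>\<^sup>2 * ?x / (1 + ?x - \<theta>\<^sup>2 * ?x)"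
      unfolding e using x p by simp
    also have "\<dots> \<le> \<theta>\<^sup>2 * ?x / 1" using p x by (intro divide_left_mono) auto
    finally show ?thesis by simp
  qed
  ultimately show ?thesis by simp
qed

text \<open>The price of u' in place of u: over the denominator 1 + \<alpha> v the two arguments
  have numerators \<open>A\<close> \<ge> 1 and A + \<theta>^2 \<alpha>^2 v.\<close>

lemma ln_direct_ge_split:
  fixes \<theta> \<alpha> v :: real
  assumes \<theta>: "0 \<le> \<theta>" "\<theta> \<le> 1" and \<alpha>: "0 \<le> \<alpha>" "\<alpha> \<le> 1" and v: "v > 0"
  shows "ln (1 - \<theta>\<^sup>2 * (\<alpha> * v / (1 + \<alpha> * v)))
    \<ge> ln (1 - \<theta>\<^sup>2 * (\<alpha> * (1 - \<alpha>) * v / (1 + \<alpha> * v))) - \<theta>\<^sup>2 * (\<alpha>\<^sup>2 * v)"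
proof -
  let ?x = "\<alpha> * v"
  have x: "?x \<ge> 0" using \<alpha> v by simp
  have t1: "\<theta>\<^sup>2 \<le> 1" using \<theta> by (simp add: power_le_one)
  have tx: "\<theta>\<^sup>2 * ?x \<le> 1 * ?x" using t1 x by (intro mult_right_mono) auto
  define A where "A = 1 + ?x - \<theta>\<^sup>2 * ?x"
  define B where "B = A + \<theta>\<^sup>2 * (\<alpha>\<^sup>2 * v)"
  have A: "A \<ge> 1" using tx by (simp add: A_def)
  have b0: "\<theta>\<^sup>2 * (\<alpha>\<^sup>2 * v) \<ge> 0" using v by simp
  have B: "B \<ge> 1" using A b0 by (simp add: B_def)
  have eA: "1 - \<theta>\<^sup>2 * (?x / (1 + ?x)) = A / (1 + ?x)" using x by (simp add: A_def field_simps)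
  have eB: "1 - \<theta>\<^sup>2 * (\<alpha> * (1 - \<alpha>) * v / (1 + ?x)) = B / (1 + ?x)"
    using x by (simp add: B_def A_def field_simps power2_eq_square)
  have "ln (B / A) \<le> B / A - 1" using A B by (intro ln_le_minus_one) simp
  also have "\<dots> = \<theta>\<^sup>2 * (\<alpha>\<^sup>2 * v) / A" using A by (simp add: B_def field_simps)
  also have "\<dots> \<le> \<theta>\<^sup>2 * (\<alpha>\<^sup>2 * v) / 1" using A b0 by (intro divide_left_mono) auto
  finally have "ln B - ln A \<le> \<theta>\<^sup>2 * (\<alpha>\<^sup>2 * v)" using A B by (simp add: ln_div)
  then show ?thesis unfolding eA eB using A B x by (simp add: ln_div)
qed

section \<open>Choice of the multiplier when all or a moderate fraction of the sections are
  wrong\<close>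

text \<open>For \<alpha> = 1 both \<delta> and the logarithm of the binomial coefficient vanish, and
  the exponent is at least the parabola \<theta> \<Delta> - \<theta>^2 v / 2. The multiplier 2 w
  yields \<Delta> w as soon as \<Delta> \<ge> 2 w v; for smaller \<Delta> the vertex \<Delta> / v
  yields \<Delta>^2 / (2 v).\<close>

lemma exponent_all_sections_wrong:
  fixes v \<Delta> H :: real
  assumes v: "v > 0" and \<Delta>: "\<Delta> > 0" and H: "H \<le> \<Delta> * w_fun v" "H \<le> \<Delta>\<^sup>2 / (8 * v)"
  shows "\<exists>\<theta>. 0 \<le> \<theta> \<and> \<theta> \<le> 1 \<and> \<theta> * \<Delta> + ln (1 - \<theta>\<^sup>2 * (v / (1 + v))) / 2 \<ge> H"
proof -
  note w = w_fun_bounds[OF v]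
  have l: "ln (1 - \<theta>\<^sup>2 * (v / (1 + v))) / 2 \<ge> - (\<theta>\<^sup>2 * v) / 2" if "0 \<le> \<theta>" "\<theta> \<le> 1" for \<theta>
    using ln_direct_ge[OF that, of 1 v] v by simp
  show ?thesis
  proof (cases "\<Delta> \<ge> 2 * w_fun v * v")
    case True
    have "w_fun v * (2 * w_fun v * v) \<le> w_fun v * \<Delta>" using True w by (intro mult_left_mono) auto
    then have "H \<le> 2 * w_fun v * \<Delta> - ((2 * w_fun v)\<^sup>2 * v) / 2"
      using H by (simp add: power2_eq_square algebra_simps)
    also have "\<dots> \<le> 2 * w_fun v * \<Delta> + ln (1 - (2 * w_fun v)\<^sup>2 * (v / (1 + v))) / 2"
      using l[of "2 * w_fun v"] w by simp
    finally show ?thesis using w by (intro exI[of _ "2 * w_fun v"]) auto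
  next
    case False
    let ?t = "\<Delta> / v"
    have "v * (2 * w_fun v) \<le> v * 1" using v w by (intro mult_left_mono) auto
    then have "\<Delta> \<le> v" using False by (simp add: mult_ac)
    then have t: "?t \<ge> 0" "?t \<le> 1" using \<Delta> v by auto
    have "H \<le> \<Delta>\<^sup>2 / (2 * v)"
    proof -
      have "\<Delta>\<^sup>2 / (8 * v) \<le> \<Delta>\<^sup>2 / (2 * v)" using v by (intro divide_left_mono) auto
      then show ?thesis using H by linarith
    qed
    also have "\<dots> = ?t * \<Delta> - ?t\<^sup>2 * v / 2" using v by (simp add: power2_eq_square field_simps)
    also have "\<dots> \<le> ?t * \<Delta> + ln (1 - ?t\<^sup>2 * (v / (1 + v))) / 2"
      using l[OF t] by simp
    finally show ?thesis using t by (intro exI[of _ ?t]) auto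
  qed
qed

text \<open>\<open>b\<close> stands for ln (L choose k) / n. The multiplier \<open>r\<close>
  attaining \<open>D1\<close> pays for \<open>b\<close>. What remains at this multiplier is r
  \<alpha> \<Delta> / 2 for the split, and at least r \<alpha> \<Delta> - r^2 \<alpha>^2 v / 2 for
  the direct bound.\<close>

lemma exponent_moderate_fraction:
  fixes \<alpha> v \<Delta> H b :: real
  defines "\<delta> \<equiv> cap_alpha \<alpha> v - \<alpha> * cap_alpha 1 v" and "u \<equiv> \<alpha> * (1 - \<alpha>) * v / (1 + \<alpha> * v)"
  assumes \<alpha>: "0 < \<alpha>" "\<alpha> < 1" and v: "v > 0" and \<Delta>: "\<Delta> > 0"
    and big: "1 / 20 \<le> \<alpha> \<or> 1 / 6 \<le> v" and b: "b \<le> D1 \<delta> u"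
    and H: "H \<le> \<alpha> * \<Delta> * w_fun v" "H \<le> \<Delta>\<^sup>2 / (8 * v)"
  shows "(\<exists>\<theta>. 0 \<le> \<theta> \<and> \<theta> \<le> 1 \<and> H \<le> \<theta> * (\<delta> + \<alpha> * \<Delta>) + ln (1 - \<theta>\<^sup>2 * (\<alpha> * v / (1 + \<alpha> * v))) / 2 - b)
    \<or> (\<exists>\<theta>. 0 \<le> \<theta> \<and> \<theta> \<le> 1 \<and> H \<le> \<theta> * (\<delta> + \<alpha> * \<Delta> / 2) + ln (1 - \<theta>\<^sup>2 * u) / 2 - b)"
proof -
  define w where "w = w_fun v"
  have w: "w > 0" "w * (1 + v) \<le> v / (4 * (1 + v))" "w \<le> 1 / 16"
    using w_fun_bounds[OF v] by (auto simp: w_def)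
  have x: "1 + \<alpha> * v > 1" using \<alpha> v by simp
  have num: "\<alpha> * (1 - \<alpha>) * v > 0" using \<alpha> v by simp
  have u0: "u > 0" unfolding u_def using num x by (intro divide_pos_pos) auto
  have u1: "u \<le> \<alpha> * (1 - \<alpha>) * v"
  proof -
    have "u \<le> \<alpha> * (1 - \<alpha>) * v / 1" unfolding u_def using num x by (intro divide_left_mono) auto
    then show ?thesis by simp
  qed
  have u2: "u < 1"
  proof -
    have "\<alpha> * v * (1 - \<alpha>) \<le> \<alpha> * v * 1" using \<alpha> v by (intro mult_left_mono) auto
    then have "\<alpha> * (1 - \<alpha>) * v < 1 + \<alpha> * v" by (simp add: mult_ac)
    then show ?thesis unfolding u_def using x by simp
  qed
  have \<delta>c: "\<delta> \<ge> v / (4 * (1 + v)) * u" unfolding \<delta>_def u_def using cap_gap_ge[of \<alpha> v] \<alpha> v by simp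
  have \<delta>0: "\<delta> > 0"
  proof -
    have "v / (4 * (1 + v)) * u > 0" using v u0 by simp
    then show ?thesis using \<delta>c by linarith
  qed
  obtain r where r: "0 < r" "r \<le> 1" "D1 \<delta> u = r * \<delta> + ln (1 - r\<^sup>2 * u) / 2"
    "r < 1 \<Longrightarrow> r * u = \<delta> * (1 - r\<^sup>2 * u)"
    by (rule D1_maximiser[OF u0 u2 \<delta>0]) blast
  have rge: "r \<ge> w * (1 + 15 / 16 * v)"
    unfolding w_def by (rule maximiser_ge[OF v u0 u2 \<delta>c r(1,2,4)])
  have "w * 1 \<le> w * (1 + 15 / 16 * v)" using w v by (intro mult_left_mono) auto
  then have rw: "r \<ge> w" using rge by linarith
  have direct: "\<theta> * (\<delta> + \<alpha> * \<Delta>) + ln (1 - \<theta>\<^sup>2 * (\<alpha> * v / (1 + \<alpha> * v))) / 2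
      \<ge> (\<theta> * \<delta> + ln (1 - \<theta>\<^sup>2 * u) / 2) + \<theta> * \<alpha> * \<Delta> - \<theta>\<^sup>2 * (\<alpha>\<^sup>2 * v) / 2" if "0 \<le> \<theta>" "\<theta> \<le> 1" for \<theta>
    using ln_direct_ge_split[OF that, of \<alpha> v] \<alpha> v unfolding u_def[symmetric] by (simp add: algebra_simps)
  show ?thesis
  \<comment> \<open>The threshold is where the gain r \<alpha> \<Delta> / 2 of the split equals
    \<Delta>^2 / (8 v).\<close>
  proof (cases "\<Delta> \<le> 4 * \<alpha> * v * r")
    case True
    have "H \<le> \<Delta> * \<Delta> / (8 * v)" using H by (simp add: power2_eq_square)
    also have "\<dots> \<le> \<Delta> * (4 * \<alpha> * v * r) / (8 * v)"
      using True \<Delta> v by (intro divide_right_mono mult_left_mono) auto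
    also have "\<dots> = r * (\<alpha> * \<Delta> / 2)" using v by simp
    also have "\<dots> \<le> r * (\<delta> + \<alpha> * \<Delta> / 2) + ln (1 - r\<^sup>2 * u) / 2 - b"
      using b r(3) by (simp add: algebra_simps)
    finally show ?thesis using r by (intro disjI2 exI[of _ r]) auto
  next
    case False
    show ?thesis
    \<comment> \<open>Beyond that threshold the loss r^2 \<alpha>^2 v / 2 is at most one eighth of r
      \<alpha> \<Delta>, and the remaining 7/8 suffice once r \<ge> 8/7 w.\<close>
    proof (cases "r \<ge> 8 / 7 * w")
      case True
      have "r * \<alpha> * (4 * \<alpha> * v * r) \<le> r * \<alpha> * \<Delta>" using False r \<alpha> by (intro mult_left_mono) auto
      then have loss: "r\<^sup>2 * (\<alpha>\<^sup>2 * v) / 2 \<le> r * \<alpha> * \<Delta> / 8" by (simp add: power2_eq_square mult_ac)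
      have "8 / 7 * w * (\<alpha> * \<Delta>) \<le> r * (\<alpha> * \<Delta>)" using True \<alpha> \<Delta> by (intro mult_right_mono) auto
      then have "\<alpha> * \<Delta> * w \<le> r * \<alpha> * \<Delta> - r * \<alpha> * \<Delta> / 8" by (simp add: algebra_simps)
      also have "\<dots> \<le> r * (\<delta> + \<alpha> * \<Delta>) + ln (1 - r\<^sup>2 * (\<alpha> * v / (1 + \<alpha> * v))) / 2 - b"
        using direct[of r] r b loss by linarith
      finally have "H \<le> r * (\<delta> + \<alpha> * \<Delta>) + ln (1 - r\<^sup>2 * (\<alpha> * v / (1 + \<alpha> * v))) / 2 - b"
        using H by (simp add: w_def)
      then show ?thesis using r by (intro disjI1 exI[of _ r]) auto
    next
      case r_small: False
      \<comment> \<open>A maximiser this close to \<open>w\<close> forces 15/16 v < 1/7, hence v <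
        1/6, and \<open>big\<close> leaves \<alpha> \<ge> 1/20.\<close>
      have "w * (1 + 15 / 16 * v) < w * (8 / 7)" using rge r_small by (simp add: mult.commute)
      then have "1 + 15 / 16 * v < 8 / 7" using w by simp
      then have \<alpha>20: "1 / 20 \<le> \<alpha>" using big by auto
      \<comment> \<open>The optimal \<open>r\<close> leaves no room for the loss in \<open>direct\<close>. Overshooting to \<open>7/6 w\<close> gains \<open>\<alpha> \<Delta> w / 6\<close>
        at a second-order cost in the exponent.\<close>
      define \<theta> where "\<theta> = 7 / 6 * w"
      have \<theta>: "0 \<le> \<theta>" "\<theta> \<le> 7 / 96" "\<theta> \<le> 1" using w by (auto simp: \<theta>_def)
      have \<theta>r: "0 \<le> \<theta> - r" "\<theta> - r \<le> w / 6" using r_small rw w by (auto simp: \<theta>_def)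
      have sm: "\<theta>\<^sup>2 * u \<le> 1 / 100"
      proof -
        have "\<theta>\<^sup>2 * u \<le> (7 / 96)\<^sup>2 * 1" using \<theta> u0 u2 by (intro mult_mono power_mono) auto
        also have "\<dots> \<le> 1 / 100" by (simp add: power2_eq_square)
        finally show ?thesis .
      qed
      have rsm: "r\<^sup>2 * u < 1"
      proof -
        have "r\<^sup>2 * u \<le> \<theta>\<^sup>2 * u" using \<theta>r r u0 by (intro mult_right_mono power_mono) auto
        then show ?thesis using sm by linarith
      qed
      define \<beta> where "\<beta> = (r + \<theta>) * u / (2 * (1 - \<theta>\<^sup>2 * u)) - \<delta>"
      \<comment> \<open>Since r \<le> \<theta> = 7/6 w and \<theta>^2 u \<le> 1/100, the first term
        of \<beta> is at most 7/6 times 100/99 of w u, while \<delta> \<ge> w u. The excess 106/594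
        is below 18/100.\<close>
      have \<beta>: "\<beta> \<le> (18 / 100) * (w * u)"
      proof -
        have "(r + \<theta>) * u / (2 * (1 - \<theta>\<^sup>2 * u)) \<le> (2 * \<theta>) * u / (2 * (99 / 100))"
          using \<theta>r r u0 sm \<theta> by (intro frac_le mult_right_mono) auto
        also have "\<dots> = (700 / 594) * (w * u)" by (simp add: \<theta>_def)
        finally have 1: "(r + \<theta>) * u / (2 * (1 - \<theta>\<^sup>2 * u)) \<le> (700 / 594) * (w * u)" .
        have "w * 1 \<le> w * (1 + v)" using w v by (intro mult_left_mono) auto
        then have "w \<le> v / (4 * (1 + v))" using w by linarith
        then have "w * u \<le> v / (4 * (1 + v)) * u" using u0 by (intro mult_right_mono) auto
        then have 2: "w * u \<le> \<delta>" using \<delta>c by linarith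
        have "w * u \<ge> 0" using w u0 by simp
        then show ?thesis unfolding \<beta>_def using 1 2 by linarith
      qed
      have "(r * \<delta> + ln (1 - r\<^sup>2 * u) / 2) - (\<theta> * \<delta> + ln (1 - \<theta>\<^sup>2 * u) / 2)
        \<le> (r - \<theta>) * (\<delta> - (r + \<theta>) * u / (2 * (1 - \<theta>\<^sup>2 * u)))"
        using rsm sm by (intro chernoff_exponent_diff) auto
      also have "\<dots> = (\<theta> - r) * \<beta>" unfolding \<beta>_def by (simp only: minus_diff_eq[symmetric, of r \<theta>] minus_diff_eq[symmetric, of \<delta>] minus_mult_minus)
      also have "\<dots> \<le> (\<theta> - r) * ((18 / 100) * (w * u))" using \<beta> \<theta>r by (intro mult_left_mono) auto
      also have "\<dots> \<le> (w / 6) * ((18 / 100) * (w * u))" using \<theta>r w u0 by (intro mult_right_mono) auto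
      also have "\<dots> = (3 / 100 * w * w) * u" by simp
      \<comment> \<open>For \<alpha> \<ge> 1/20 one has 1 - \<alpha> \<le> 19 \<alpha>, which brings
        \<open>u\<close> to the order \<alpha>^2 v of the other loss; 19 times 3/100 is the 57/100
        below.\<close>
      also have "\<dots> \<le> (3 / 100 * w * w) * (19 * \<alpha>\<^sup>2 * v)"
      proof (intro mult_left_mono)
        have "\<alpha> * v * (1 - \<alpha>) \<le> \<alpha> * v * (19 * \<alpha>)" using \<alpha>20 \<alpha> v by (intro mult_left_mono) auto
        then show "u \<le> 19 * \<alpha>\<^sup>2 * v" using u1 by (simp add: power2_eq_square mult_ac)
      qed (use w in auto)
      finally have lossr: "b \<le> (\<theta> * \<delta> + ln (1 - \<theta>\<^sup>2 * u) / 2) + (57 / 100) * (\<alpha> * w) * (\<alpha> * v * w)"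
        using b r(3) by (simp add: power2_eq_square mult_ac)
      define y where "y = \<alpha> * v * w"
      have y: "y > 0" using \<alpha> v w by (simp add: y_def)
      have "4 * (\<alpha> * v) * w \<le> 4 * (\<alpha> * v) * r" using rw \<alpha> v by (intro mult_left_mono) auto
      then have Dy: "\<Delta> > 4 * y" using False by (simp add: y_def mult_ac)
      \<comment> \<open>In the unit y = \<alpha> v w the net gain is \<alpha> w times this bracket;
        49/72 is half the square of 7/6. The two bounds on \<open>H\<close> cross at \<Delta> = 8
        y.\<close>
      have "H \<le> (\<alpha> * w) * (7 / 6 * \<Delta> - 49 / 72 * y - 57 / 100 * y)"
      proof (cases "\<Delta> \<ge> 8 * y")
        case True
        have "H \<le> (\<alpha> * w) * \<Delta>" using H by (simp add: w_def mult_ac)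
        also have "\<dots> \<le> (\<alpha> * w) * (7 / 6 * \<Delta> - 49 / 72 * y - 57 / 100 * y)"
          using True y \<alpha> w by (intro mult_left_mono) auto
        finally show ?thesis .
      next
        case D8: False
        \<comment> \<open>Between 4 y and 8 y the convex function \<Delta>^2 lies below its chord 12
          \<Delta> y - 32 y^2.\<close>
        have "(\<Delta> - 4 * y) * (8 * y - \<Delta>) \<ge> 0" using Dy D8 by (intro mult_nonneg_nonneg) auto
        then have sq: "\<Delta>\<^sup>2 \<le> 12 * (\<Delta> * y) - 32 * (y * y)" by (simp add: algebra_simps power2_eq_square)
        have "\<Delta> * y \<le> 8 * y * y" using D8 y by (intro mult_right_mono) auto
        then have "\<Delta>\<^sup>2 \<le> 8 * y * (7 / 6 * \<Delta> - 49 / 72 * y - 57 / 100 * y)"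
        proof -
          have "8 * y * (7 / 6 * \<Delta> - 49 / 72 * y - 57 / 100 * y) = 28 / 3 * (\<Delta> * y) - 8 * (49 / 72 + 57 / 100) * (y * y)"
            by (simp add: algebra_simps)
          moreover have "y * y > 0" using y by simp
          ultimately show ?thesis using sq \<open>\<Delta> * y \<le> 8 * y * y\<close> by simp
        qed
        then have "\<Delta>\<^sup>2 / (8 * y) \<le> 7 / 6 * \<Delta> - 49 / 72 * y - 57 / 100 * y"
          using y by (simp add: pos_divide_le_eq mult.commute)
        then have "(\<alpha> * w) * (\<Delta>\<^sup>2 / (8 * y)) \<le> (\<alpha> * w) * (7 / 6 * \<Delta> - 49 / 72 * y - 57 / 100 * y)"
          using \<alpha> w by (intro mult_left_mono) auto
        moreover have "(\<alpha> * w) * (\<Delta>\<^sup>2 / (8 * y)) = \<Delta>\<^sup>2 / (8 * v)" using \<alpha> w by (simp add: y_def)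
        ultimately show ?thesis using H by linarith
      qed
      also have "\<dots> = \<theta> * \<alpha> * \<Delta> - \<theta>\<^sup>2 * (\<alpha>\<^sup>2 * v) / 2 - (57 / 100) * (\<alpha> * w) * (\<alpha> * v * w)"
        by (simp add: \<theta>_def y_def power2_eq_square algebra_simps)
      also have "\<dots> \<le> \<theta> * (\<delta> + \<alpha> * \<Delta>) + ln (1 - \<theta>\<^sup>2 * (\<alpha> * v / (1 + \<alpha> * v))) / 2 - b"
        using direct[of \<theta>] \<theta> lossr by linarith
      finally show ?thesis using \<theta> by (intro disjI1 exI[of _ \<theta>]) auto
    qed
  qed
qed

section \<open>Few wrong sections at small snr\<close>

lemma ln_20_le: "ln (20 :: real) \<le> 31 / 10"
proof -
  have l16: "ln (16 :: real) = 4 * ln 2" using ln_realpow[of "2 :: real" 4] by simp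
  have "ln (20 :: real) = ln (16 * (5 / 4))" by simp
  also have "\<dots> = 4 * ln 2 + ln (5 / 4)" unfolding l16[symmetric] by (subst ln_mult) auto
  also have "ln (5 / 4 :: real) \<le> 1 / 4" using ln_le_minus_one[of "5 / 4 :: real"] by simp
  finally show ?thesis using ln2_le_25_over_36 by simp
qed

text \<open>The constant 2/13 is the value of 6/5 (2 k + 1) / (20 k - 1) at k = 2, and 31/10 is an
  upper bound for ln 20. In the induction the right side grows by ln (k + 1) \<ge> 1, the left side
  by at most 2/13 (41/10 + ln (k + 1)).\<close>

lemma ln_fact_ge:
  assumes "k \<ge> 2"
  shows "2 / 13 * real k * (31 / 10 + ln (real k)) \<le> ln 2 + ln (fact k :: real)"
  using assms
proof (induction k rule: nat_induct_at_least)
  case base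
  have "fact 2 = (2 :: real)" by (simp add: fact_numeral)
  then show ?case using ln2_ge_two_thirds by simp
next
  case (Suc k)
  have k: "real k > 0" using Suc by simp
  have "real k * (ln (real (Suc k)) - ln (real k)) \<le> 1"
  proof -
    have "ln (real (Suc k)) - ln (real k) = ln (real (Suc k) / real k)" using k by (simp add: ln_div)
    also have "\<dots> \<le> real (Suc k) / real k - 1" using k by (intro ln_le_minus_one) simp
    also have "\<dots> = 1 / real k" using k by (simp add: field_simps)
    finally have "real k * (ln (real (Suc k)) - ln (real k)) \<le> real k * (1 / real k)"
      using k by (intro mult_left_mono) auto
    then show ?thesis using k by simp
  qed
  moreover have "ln (real (Suc k)) \<ge> 1"
  proof -
    have "exp 1 \<le> real (Suc k)" using exp_le Suc by linarith
    then show ?thesis using ln_ge_iff[of "real (Suc k)" 1] by simp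
  qed
  moreover have "2 / 13 * real (Suc k) * (31 / 10 + ln (real (Suc k)))
    = 2 / 13 * real k * (31 / 10 + ln (real k))
      + 2 / 13 * (31 / 10 + ln (real (Suc k)) + real k * (ln (real (Suc k)) - ln (real k)))"
  proof -
    have "2 / 13 * (real k + 1) * (31 / 10 + X)
      = 2 / 13 * real k * (31 / 10 + Y) + 2 / 13 * (31 / 10 + X + real k * (X - Y))" for X Y :: real
      by (simp add: algebra_simps)
    from this[of "ln (real (Suc k))" "ln (real k)"] show ?thesis by (simp only: of_nat_Suc add.commute)
  qed
  moreover have "p \<le> q + x" if "y \<le> 1" "1 \<le> x" "p = q + 2 / 13 * (31 / 10 + x + y)" for p q x y :: real
    using that by (simp add: field_simps)
  ultimately have "2 / 13 * real (Suc k) * (31 / 10 + ln (real (Suc k)))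
    \<le> 2 / 13 * real k * (31 / 10 + ln (real k)) + ln (real (Suc k))"
    by blast
  also have "\<dots> \<le> ln 2 + ln (fact k :: real) + ln (real (Suc k))" using Suc by simp
  also have "ln (fact k :: real) = ln (fact (Suc k) :: real) - ln (real (Suc k))"
    by (simp add: ln_mult del: of_nat_Suc)
  finally show ?case by simp
qed

text \<open>For fixed \<open>k\<close> the quotient ln L / (L - 1) is largest at L = 20 k, after
  which only \<open>k\<close> is left. For k = 1 the factorial is 1 and ln 2 alone carries the
  estimate.\<close>

lemma section_count_le_fact:
  fixes k L :: nat
  assumes k: "k \<ge> 1" and L: "20 * k \<le> L"
  shows "6 / 5 * (2 * real k + 1) / (real L - 1) * (real k * ln (real L)) \<le> ln 2 + ln (fact k :: real)"
proof -
  define N where "N = 20 * real k"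
  have N: "N \<ge> 20" "N \<le> real L" using k L by (auto simp: N_def)
  have lnN: "ln N \<ge> 1"
  proof -
    have "exp 1 \<le> N" using exp_le N by linarith
    then show ?thesis using ln_ge_iff[of N 1] N by simp
  qed
  have q: "ln (real L) / (real L - 1) \<le> ln N / (N - 1)"
  proof -
    have "ln (real L) - ln N = ln (real L / N)" using N by (simp add: ln_div)
    also have "\<dots> \<le> real L / N - 1" using N by (intro ln_le_minus_one) simp
    also have "\<dots> = (real L - N) / N" using N by (simp add: field_simps)
    also have "\<dots> \<le> (real L - N) / (N - 1)" using N by (intro divide_left_mono) auto
    also have "\<dots> \<le> (real L - N) / (N - 1) * ln N" using N lnN
      by (intro mult_left_mono[of 1 "ln N", simplified]) auto
    finally have "ln (real L) \<le> ln N * (1 + (real L - N) / (N - 1))" by (simp add: algebra_simps)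
    also have "1 + (real L - N) / (N - 1) = (real L - 1) / (N - 1)" using N by (simp add: field_simps)
    finally show ?thesis using N by (simp add: field_simps)
  qed
  have "ln N = ln 20 + ln (real k)" using k by (simp add: N_def ln_mult)
  then have "ln N \<le> 31 / 10 + ln (real k)" using ln_20_le by simp
  then have "ln N / (N - 1) \<le> (31 / 10 + ln (real k)) / (N - 1)" using N by (intro divide_right_mono) auto
  then have q': "ln (real L) / (real L - 1) \<le> (31 / 10 + ln (real k)) / (N - 1)" using q by linarith
  have pos: "31 / 10 + ln (real k) \<ge> 0" using k by simp
  have "6 / 5 * (2 * real k + 1) / (real L - 1) * (real k * ln (real L))
     = 6 / 5 * (2 * real k + 1) * real k * (ln (real L) / (real L - 1))" by simp
  also have "\<dots> \<le> 6 / 5 * (2 * real k + 1) * real k * ((31 / 10 + ln (real k)) / (N - 1))"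
    using q' by (intro mult_left_mono) auto
  also have "\<dots> \<le> ln 2 + ln (fact k :: real)"
  proof (cases "k = 1")
    case True
    then show ?thesis using ln2_ge_two_thirds by (simp add: N_def)
  next
    case False
    then have k2: "k \<ge> 2" using k by simp
    have "6 / 5 * (2 * real k + 1) / (N - 1) \<le> 2 / 13" using k2 by (simp add: N_def field_simps)
    then have "6 / 5 * (2 * real k + 1) / (N - 1) * (real k * (31 / 10 + ln (real k))) \<le> 2 / 13 * (real k * (31 / 10 + ln (real k)))"
      using pos by (intro mult_right_mono) auto
    also have "\<dots> \<le> ln 2 + ln (fact k :: real)" using ln_fact_ge[OF k2] by (simp add: mult_ac)
    finally show ?thesis by (simp add: mult_ac)
  qed
  finally show ?thesis .
qed

text \<open>Here the margin comes from the condition on \<open>a\<close> for a single wrong section: it allows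
  \<open>L ^ k\<close> candidate sets of wrong sections, whereas there are at most \<open>L ^ k / k!\<close>.\<close>

lemma exponent_small_fraction:
  fixes n k L :: nat and v \<Delta> H :: real
  defines "\<alpha> \<equiv> real k / real L"
  assumes v: "v > 0" "v < 1 / 6" and k: "k \<ge> 1" "20 * k \<le> L" and \<Delta>: "\<Delta> > 0"
    and one: "ln (real L) \<le> real n * D1 (cap_alpha (1 / real L) v - 1 / real L * cap_alpha 1 v)
       (1 / real L * (1 - 1 / real L) * v / (1 + 1 / real L * v))"
    and H: "H \<le> \<alpha> * \<Delta> * w_fun v"
  shows "\<exists>\<theta>. 0 \<le> \<theta> \<and> \<theta> \<le> 1 \<and> ln (real (L choose k))
    - real n * (\<theta> * (cap_alpha \<alpha> v - \<alpha> * cap_alpha 1 v + \<alpha> * \<Delta>) + ln (1 - \<theta>\<^sup>2 * (\<alpha> * v / (1 + \<alpha> * v))) / 2)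
    \<le> ln 2 - real n * H"
proof -
  have L20: "real L \<ge> 20" using k by linarith
  \<comment> \<open>\<beta>, \<delta> and \<open>u\<close> belong to a single wrong section, as in
    \<open>one\<close>; the maximiser \<open>r\<close> found for it is the multiplier for
    \<open>k\<close> sections as well.\<close>
  define \<beta> where "\<beta> = 1 / real L"
  define \<delta> where "\<delta> = cap_alpha \<beta> v - \<beta> * cap_alpha 1 v"
  define u where "u = \<beta> * (1 - \<beta>) * v / (1 + \<beta> * v)"
  define \<delta>\<alpha> where "\<delta>\<alpha> = cap_alpha \<alpha> v - \<alpha> * cap_alpha 1 v"
  have \<beta>: "0 < \<beta>" "\<beta> < 1" using L20 by (auto simp: \<beta>_def)
  have Lv: "real L + v > 0" using L20 v by linarith
  have \<alpha>\<beta>: "\<alpha> = real k * \<beta>" by (simp add: \<alpha>_def \<beta>_def)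
  have \<alpha>0: "\<alpha> > 0" using k \<beta> by (simp add: \<alpha>\<beta>)
  have ueq: "u = v * (real L - 1) / (real L * (real L + v))"
  proof -
    have nz: "real L \<noteq> 0" "real L + v \<noteq> 0" using L20 Lv by auto
    have e: "1 - \<beta> = (real L - 1) / real L" "1 + \<beta> * v = (real L + v) / real L"
      using nz by (simp_all add: \<beta>_def field_simps)
    show ?thesis unfolding u_def e using nz by (simp add: \<beta>_def)
  qed
  have u0: "u > 0" unfolding ueq using L20 Lv v by (intro divide_pos_pos mult_pos_pos) auto
  have u2: "u < 1"
  proof -
    have "v * (real L - 1) \<le> 1 * real L" using v L20 by (intro mult_mono) auto
    also have "\<dots> < real L * (real L + v)" using L20 v by (simp add: mult_less_cancel_left1)
    finally show ?thesis unfolding ueq using L20 Lv by simp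
  qed
  have \<delta>c: "\<delta> \<ge> v / (4 * (1 + v)) * u" unfolding \<delta>_def u_def using cap_gap_ge[of \<beta> v] \<beta> v by simp
  have "v / (4 * (1 + v)) * u > 0" using v u0 by simp
  then have \<delta>0: "\<delta> > 0" using \<delta>c by linarith
  obtain r where r: "0 < r" "r \<le> 1" "D1 \<delta> u = r * \<delta> + ln (1 - r\<^sup>2 * u) / 2"
    "r * u \<le> \<delta> * (1 - r\<^sup>2 * u)" "r < 1 \<Longrightarrow> r * u = \<delta> * (1 - r\<^sup>2 * u)"
    by (rule D1_maximiser[OF u0 u2 \<delta>0]) blast
  have rge: "r \<ge> w_fun v * (1 + 15 / 16 * v)"
    by (rule maximiser_ge[OF v(1) u0 u2 \<delta>c r(1,2,5)])
  have "w_fun v * 1 \<le> w_fun v * (1 + 15 / 16 * v)"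
    using w_fun_bounds[OF v(1)] v by (intro mult_left_mono) auto
  then have rw: "r \<ge> w_fun v" using rge by linarith
  have r2u: "r\<^sup>2 * u < 1"
  proof -
    have "r\<^sup>2 * u \<le> 1 * u" using r u0 by (intro mult_right_mono) (auto simp: power_le_one)
    then show ?thesis using u2 by linarith
  qed
  define f where "f = r * \<delta> + ln (1 - r\<^sup>2 * u) / 2"
  have r2u_le: "r\<^sup>2 * u / (1 - r\<^sup>2 * u) \<le> r * \<delta>"
  proof -
    have "r * (r * u) \<le> r * (\<delta> * (1 - r\<^sup>2 * u))" using r by (intro mult_left_mono) auto
    then show ?thesis using r2u by (simp add: pos_divide_le_eq power2_eq_square mult_ac)
  qed
  \<comment> \<open>Both r \<delta> / 2 and r^2 u / 2 are at most \<open>f\<close>, so the losses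
    below can be measured in units of \<open>f\<close>.\<close>
  have f1: "f \<ge> r * \<delta> / 2"
  proof -
    have "ln (1 - r\<^sup>2 * u) \<ge> - (r\<^sup>2 * u / (1 - r\<^sup>2 * u))" using ln_one_minus_ge[OF r2u] by simp
    then show ?thesis using r2u_le unfolding f_def by linarith
  qed
  have f2: "f \<ge> r\<^sup>2 * u / 2"
  proof -
    have "r\<^sup>2 * u / 1 \<le> r\<^sup>2 * u / (1 - r\<^sup>2 * u)" using r2u u0 by (intro divide_left_mono) auto
    then show ?thesis using f1 r2u_le by linarith
  qed
  have f0: "f \<ge> 0" 
  proof -
    have "r * \<delta> \<ge> 0" using r \<delta>0 by simp
    then show ?thesis using f1 by linarith
  qed
  have fle: "f \<le> r * \<delta> - r\<^sup>2 * u / 2"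
    using ln_le_minus_one[of "1 - r\<^sup>2 * u"] r2u by (simp add: f_def)
  \<comment> \<open>The logarithm is concave, so \<delta> for \<open>k\<close> sections falls short
    of \<open>k\<close> times \<delta> for one; the shortfall is of second order in \<alpha>
    v.\<close>
  have curv: "real k * \<delta> - \<delta>\<alpha> \<le> \<alpha>\<^sup>2 * v\<^sup>2 / 4"
  proof -
    have "real k * \<delta> - \<delta>\<alpha> = (real k * ln (1 + \<beta> * v) - ln (1 + \<alpha> * v)) / 2"
      by (simp add: \<delta>_def \<delta>\<alpha>_def cap_alpha_def \<alpha>\<beta> algebra_simps add_divide_distrib diff_divide_distrib)
    moreover have "real k * ln (1 + \<beta> * v) \<le> real k * (\<beta> * v)"
      using \<beta> v by (intro mult_left_mono ln_add_one_self_le_self) auto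
    moreover have "ln (1 + \<alpha> * v) \<ge> \<alpha> * v - (\<alpha> * v)\<^sup>2 / 2"
      using \<alpha>0 v by (intro ln_one_plus_ge_quadratic) auto
    ultimately show ?thesis by (simp add: \<alpha>\<beta> power_mult_distrib mult_ac)
  qed
  \<comment> \<open>\<eta> bounds the loss relative to k f: the concavity contributes 2 k / (L - 1)
    and the passage from k u to \<alpha> v contributes 1 / (L - 1), each times
    \<open>\<eta>'\<close>. The value 6/5 is above 7/6 times 121/120, which bounds
    \<open>\<eta>'\<close>.\<close>
  define \<eta> where "\<eta> = 6 / 5 * (2 * real k + 1) / (real L - 1)"
  define \<eta>' where "\<eta>' = (1 + v) * (1 + v / real L)"
  have \<eta>': "\<eta>' \<le> 6 / 5"
  proof -
    have "v / real L \<le> (1 / 6) / 20" using v L20 by (intro frac_le) auto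
    then have "\<eta>' \<le> (1 + 1 / 6) * (1 + (1 / 6) / 20)" unfolding \<eta>'_def using v L20 by (intro mult_mono) auto
    then show ?thesis by simp
  qed
  have loss1: "r * (\<alpha>\<^sup>2 * v\<^sup>2 / 4) \<le> \<eta>' * (2 * real k) / (real L - 1) * (real k * f)"
  proof -
    have "v / (4 * (1 + v)) * u * (r / 2) \<le> \<delta> * (r / 2)" using \<delta>c r by (intro mult_right_mono) auto
    then have "v / (4 * (1 + v)) * u * (r / 2) \<le> f"
      by (rule order_trans) (use f1 in \<open>simp add: mult.commute\<close>)
    then have "\<eta>' * (2 * real k) / (real L - 1) * (real k * (v / (4 * (1 + v)) * u * (r / 2)))
      \<le> \<eta>' * (2 * real k) / (real L - 1) * (real k * f)"
      using L20 v by (intro mult_left_mono) (auto simp: \<eta>'_def)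
    moreover have "\<eta>' * (2 * real k) / (real L - 1) * (real k * (v / (4 * (1 + v)) * u * (r / 2)))
      = r * (\<alpha>\<^sup>2 * v\<^sup>2 / 4)"
    proof -
      define V A B where "V = 1 + v" and "A = real L - 1" and "B = real L + v"
      have nz: "V \<noteq> 0" "A \<noteq> 0" "B \<noteq> 0" "real L \<noteq> 0" using v L20 Lv by (auto simp: V_def A_def B_def)
      have e: "1 + v / real L = B / real L" using nz by (simp add: B_def field_simps)
      show ?thesis
        unfolding \<eta>'_def ueq e V_def[symmetric] A_def[symmetric] B_def[symmetric] \<alpha>_def
        using nz by (simp add: field_simps power2_eq_square)
    qed
    ultimately show ?thesis by simp
  qed
  have ku: "\<alpha> * v - real k * u = \<alpha> * v * (1 + v) / (real L + v)"
  proof -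
    have "real k * u = \<alpha> * v * (real L - 1) / (real L + v)" unfolding ueq by (simp add: \<alpha>_def mult_ac)
    moreover have "\<alpha> * v = \<alpha> * v * (real L + v) / (real L + v)" using Lv by simp
    ultimately have "\<alpha> * v - real k * u
      = (\<alpha> * v * (real L + v) - \<alpha> * v * (real L - 1)) / (real L + v)"
      by (simp only: diff_divide_distrib)
    then show ?thesis by (simp add: algebra_simps)
  qed
  have loss2: "r\<^sup>2 * (\<alpha> * v - real k * u) / 2 \<le> \<eta>' / (real L - 1) * (real k * f)"
  proof -
    have "\<eta>' / (real L - 1) * (real k * (r\<^sup>2 * u / 2)) \<le> \<eta>' / (real L - 1) * (real k * f)"
      using f2 L20 v by (intro mult_left_mono) (auto simp: \<eta>'_def)
    moreover have "\<eta>' / (real L - 1) * (real k * (r\<^sup>2 * u / 2)) = r\<^sup>2 * (\<alpha> * v * (1 + v) / real L) / 2"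
    proof -
      define A B where "A = real L - 1" and "B = real L + v"
      have nz: "A \<noteq> 0" "B \<noteq> 0" "real L \<noteq> 0" using v L20 Lv by (auto simp: A_def B_def)
      have e: "1 + v / real L = B / real L" using nz by (simp add: B_def field_simps)
      show ?thesis
        unfolding \<eta>'_def ueq e A_def[symmetric] B_def[symmetric] \<alpha>_def
        using nz by (simp add: field_simps power2_eq_square)
    qed
    moreover have "r\<^sup>2 * (\<alpha> * v * (1 + v) / (real L + v)) / 2 \<le> r\<^sup>2 * (\<alpha> * v * (1 + v) / real L) / 2"
      using \<alpha>0 v L20 Lv by (intro divide_right_mono mult_left_mono divide_left_mono) auto
    ultimately show ?thesis unfolding ku by linarith
  qed
  have loss: "r * (\<alpha>\<^sup>2 * v\<^sup>2 / 4) + r\<^sup>2 * (\<alpha> * v - real k * u) / 2 \<le> \<eta> * (real k * f)"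
  proof -
    have "\<eta>' * (2 * real k) / (real L - 1) * (real k * f) + \<eta>' / (real L - 1) * (real k * f)
      = \<eta>' * ((2 * real k + 1) / (real L - 1) * (real k * f))"
      by (simp add: add_divide_distrib distrib_right distrib_left)
    also have "\<dots> \<le> 6 / 5 * ((2 * real k + 1) / (real L - 1) * (real k * f))"
      using \<eta>' f0 L20 by (intro mult_right_mono) auto
    also have "\<dots> = \<eta> * (real k * f)" by (simp add: \<eta>_def)
    finally show ?thesis using loss1 loss2 by linarith
  qed
  have "\<theta>\<alpha>": "r * \<delta>\<alpha> + ln (1 - r\<^sup>2 * (\<alpha> * v / (1 + \<alpha> * v))) / 2 \<ge> (1 - \<eta>) * (real k * f)"
  proof -
    have 1: "ln (1 - r\<^sup>2 * (\<alpha> * v / (1 + \<alpha> * v))) \<ge> - (r\<^sup>2 * (\<alpha> * v))"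
      using r \<alpha>0 v by (intro ln_direct_ge) auto
    have 2: "r * (real k * \<delta> - \<delta>\<alpha>) \<le> r * (\<alpha>\<^sup>2 * v\<^sup>2 / 4)" using curv r by (intro mult_left_mono) auto
    have 3: "real k * f \<le> real k * (r * \<delta> - r\<^sup>2 * u / 2)" using fle by (intro mult_left_mono) auto
    have 4: "real k * (r * \<delta> - r\<^sup>2 * u / 2) = r * (real k * \<delta>) - r\<^sup>2 * (real k * u) / 2"
      by (simp add: algebra_simps)
    show ?thesis
      unfolding left_diff_distrib mult_1
      using 1 2[unfolded right_diff_distrib] 3[unfolded 4] loss[unfolded right_diff_distrib diff_divide_distrib]
      by linarith
  qed
  have \<eta>1: "\<eta> \<le> 1"
  proof -
    have "20 * real k \<le> real L" "real k \<ge> 1" using k(1) of_nat_mono[OF k(2), where 'a=real] by simp_all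
    then have "6 / 5 * (2 * real k + 1) \<le> real L - 1" by (simp add: field_simps)
    then show ?thesis using L20 by (simp add: \<eta>_def)
  qed
  \<comment> \<open>By \<open>one\<close> the exponent of a single wrong section pays for ln L, so
    that of \<open>k\<close> sections pays for ln (L ^ k) up to the fraction \<eta>. The factor 1 /
    k! in the binomial bound and the allowed ln 2 make up for \<eta> k ln L.\<close>
  have "real n * f \<ge> ln (real L)"
    using one r(3) unfolding \<beta>_def[symmetric] \<delta>_def[symmetric] u_def[symmetric] by (simp add: f_def)
  then have "(1 - \<eta>) * real k * ln (real L) \<le> (1 - \<eta>) * real k * (real n * f)"
    using \<eta>1 by (intro mult_left_mono) auto
  also have "\<dots> = real n * ((1 - \<eta>) * (real k * f))" by simp
  also have "\<dots> \<le> real n * (r * \<delta>\<alpha> + ln (1 - r\<^sup>2 * (\<alpha> * v / (1 + \<alpha> * v))) / 2)"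
    using "\<theta>\<alpha>" by (intro mult_left_mono) auto
  finally have main: "(1 - \<eta>) * real k * ln (real L) \<le> real n * (r * \<delta>\<alpha> + ln (1 - r\<^sup>2 * (\<alpha> * v / (1 + \<alpha> * v))) / 2)" .
  have binom: "ln (real (L choose k)) \<le> real k * ln (real L) - ln (fact k)"
  proof -
    have kL: "k \<le> L" using k by linarith
    have c: "real (L choose k) > 0" using kL by simp
    have "real ((L choose k) * fact k) \<le> real (L ^ k)"
      using binomial_fact_pow[of L k] by (intro of_nat_mono)
    then have "ln (real (L choose k) * fact k) \<le> ln (real L ^ k)"
      using c L20 by (subst ln_le_cancel_iff) auto
    then show ?thesis using c L20 by (simp add: ln_mult ln_realpow)
  qed
  have comb: "\<eta> * (real k * ln (real L)) \<le> ln 2 + ln (fact k :: real)"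
    unfolding \<eta>_def by (rule section_count_le_fact[OF k])
  have gain: "real n * H \<le> real n * (r * (\<alpha> * \<Delta>))"
  proof -
    have "\<alpha> * \<Delta> * w_fun v \<le> \<alpha> * \<Delta> * r" using rw \<alpha>0 \<Delta> by (intro mult_left_mono) auto
    then show ?thesis using H by (intro mult_left_mono) (auto simp: mult_ac)
  qed
  have "ln (real (L choose k)) - real n * (r * (\<delta>\<alpha> + \<alpha> * \<Delta>) + ln (1 - r\<^sup>2 * (\<alpha> * v / (1 + \<alpha> * v))) / 2)
    = ln (real (L choose k)) - real n * (r * \<delta>\<alpha> + ln (1 - r\<^sup>2 * (\<alpha> * v / (1 + \<alpha> * v))) / 2) - real n * (r * (\<alpha> * \<Delta>))"
    by (simp add: algebra_simps)
  also have "\<dots> \<le> ln 2 - real n * H"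
    using binom main gain comb by (simp add: algebra_simps)
  finally show ?thesis unfolding \<delta>\<alpha>_def using r by (intro exI[of _ r]) auto
qed

section \<open>The condition on \<open>a\<close> and the final bound\<close>

text \<open>The k-th term of the maximum is cleared of its denominator, which needs
  \<open>D1\<close> to be positive. Then L a ln L = L ln M = n R, and R > 0 cancels.\<close>

lemma a_star_D1:
  fixes n L M :: nat and R a v :: real
  assumes n: "n \<ge> 1" and L: "L \<ge> 2" and v: "v > 0" and R: "R > 0" and M: "real M = real L powr a"
    and rate: "real L * ln (real M) = real n * R" and a: "a \<ge> a_star L R v"
    and k: "1 \<le> k" "k < L"
  defines "\<alpha> \<equiv> real k / real L"
  shows "ln (real (L choose k)) \<le> real n * D1 (cap_alpha \<alpha> v - \<alpha> * cap_alpha 1 v) (\<alpha> * (1 - \<alpha>) * v / (1 + \<alpha> * v))"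
proof -
  define D where "D = D1 (cap_alpha \<alpha> v - \<alpha> * cap_alpha 1 v) (\<alpha> * (1 - \<alpha>) * v / (1 + \<alpha> * v))"
  have \<alpha>: "0 < \<alpha>" "\<alpha> < 1" using k by (auto simp: \<alpha>_def)
  have x: "1 + \<alpha> * v > 1" using \<alpha> v by simp
  have u0: "\<alpha> * (1 - \<alpha>) * v / (1 + \<alpha> * v) > 0"
  proof -
    have "1 + \<alpha> * v > 0" using x by linarith
    then show ?thesis using \<alpha> v by simp
  qed
  have u1: "\<alpha> * (1 - \<alpha>) * v / (1 + \<alpha> * v) < 1"
  proof -
    have "\<alpha> * v * (1 - \<alpha>) \<le> \<alpha> * v * 1" using \<alpha> v by (intro mult_left_mono) auto
    then have "\<alpha> * (1 - \<alpha>) * v < 1 + \<alpha> * v" by (simp add: mult_ac)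
    then show ?thesis using x by simp
  qed
  have \<delta>: "cap_alpha \<alpha> v - \<alpha> * cap_alpha 1 v > 0"
  proof -
    have "v / (4 * (1 + v)) * (\<alpha> * (1 - \<alpha>) * v / (1 + \<alpha> * v)) > 0"
      by (rule mult_pos_pos[OF _ u0]) (use v in simp)
    then show ?thesis using cap_gap_ge[of \<alpha> v] \<alpha> v by linarith
  qed
  obtain r where r: "0 < r" "D = r * (cap_alpha \<alpha> v - \<alpha> * cap_alpha 1 v)
      + ln (1 - r\<^sup>2 * (\<alpha> * (1 - \<alpha>) * v / (1 + \<alpha> * v))) / 2"
    "r * (\<alpha> * (1 - \<alpha>) * v / (1 + \<alpha> * v)) \<le> (cap_alpha \<alpha> v - \<alpha> * cap_alpha 1 v)
      * (1 - r\<^sup>2 * (\<alpha> * (1 - \<alpha>) * v / (1 + \<alpha> * v)))" "r \<le> 1"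
    using D1_maximiser[OF u0 u1 \<delta>] unfolding D_def by metis
  \<comment> \<open>By the first-order condition the logarithmic term costs at most half of r
    \<delta>.\<close>
  have Dpos: "D > 0"
  proof -
    define u where "u = \<alpha> * (1 - \<alpha>) * v / (1 + \<alpha> * v)"
    define \<delta> where "\<delta> = cap_alpha \<alpha> v - \<alpha> * cap_alpha 1 v"
    have uu: "0 < u" "u < 1" and dd: "\<delta> > 0" using u0 u1 \<delta> by (auto simp: u_def \<delta>_def)
    have "r\<^sup>2 * u \<le> 1 * u" using r uu by (intro mult_right_mono) (auto simp: power_le_one)
    then have lt: "r\<^sup>2 * u < 1" using uu by linarith
    have "r * (r * u) \<le> r * (\<delta> * (1 - r\<^sup>2 * u))" using r unfolding u_def \<delta>_def by (intro mult_left_mono) auto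
    then have "r\<^sup>2 * u / (1 - r\<^sup>2 * u) \<le> r * \<delta>"
      using lt by (simp add: pos_divide_le_eq power2_eq_square mult_ac)
    moreover have "ln (1 - r\<^sup>2 * u) \<ge> - (r\<^sup>2 * u / (1 - r\<^sup>2 * u))" using ln_one_minus_ge[OF lt] by simp
    moreover have "D = r * \<delta> + ln (1 - r\<^sup>2 * u) / 2" unfolding r(2) u_def \<delta>_def ..
    moreover have "r * \<delta> > 0" using r dd by simp
    ultimately show ?thesis by linarith
  qed
  have lnL: "ln (real L) > 0" using L by simp
  have "R * ln (real (L choose k)) / (D * real L * ln (real L)) \<le> a_star L R v"
    unfolding a_star_def
    by (rule Max_ge) (use k in \<open>auto simp: Let_def D_def \<alpha>_def intro!: image_eqI[of _ _ k]\<close>)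
  then have "R * ln (real (L choose k)) / (D * real L * ln (real L)) \<le> a" using a by linarith
  then have "R * ln (real (L choose k)) \<le> a * (D * real L * ln (real L))"
    using Dpos L lnL by (subst (asm) pos_divide_le_eq) auto
  also have "\<dots> = D * (real L * (a * ln (real L)))" by simp
  also have "a * ln (real L) = ln (real M)" using L by (simp add: M ln_powr)
  also have "D * (real L * ln (real M)) = R * (real n * D)" by (simp add: rate)
  finally have "ln (real (L choose k)) \<le> real n * D" using R by simp
  then show ?thesis by (simp add: D_def)
qed

context sparc
begin

text \<open>The factor 2 is filled by the two exponentials of the split, each at most exp (- n H);
  in the direct bound it is a slack of ln 2 in the exponent. With M \<ge> 2 the rate is positive, as
  is needed to divide the condition on \<open>a\<close> by it.\<close>

lemma err_bound:
  fixes \<epsilon> a :: real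
  defines "\<Delta> \<equiv> cap_alpha 1 snr - rate"
  defines "H \<equiv> min (\<epsilon> * \<Delta> * w_fun snr) (g_fun (\<Delta> / (2 * sqrt snr)) / 4)"
  assumes L: "L \<ge> 2" and M: "M \<ge> 2" "real M = real L powr a" and a: "a \<ge> a_star L rate snr"
    and \<Delta>: "\<Delta> > 0"
    and m: "m \<in> sparc_msgs L M" and k: "1 \<le> k" "k \<le> L" and \<epsilon>k: "\<epsilon> \<le> real k / real L"
  shows "measure chan (err k m) \<le> 2 * exp (- real n * H)"
proof -
  define \<alpha> where "\<alpha> = real k / real L"
  define v where "v = snr"
  have v: "v > 0" using P0 \<sigma>0 by (simp add: v_def)
  have nn: "real n > 0" using n1 by simp
  have R: "rate > 0" using n1 L M(1) by simp
  have rate: "real L * ln (real M) = real n * rate" using n1 by simp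
  have bin: "ln (real (L choose j)) \<le> real n * D1 (cap_alpha (real j / real L) v - real j / real L * cap_alpha 1 v)
       (real j / real L * (1 - real j / real L) * v / (1 + real j / real L * v))" if "1 \<le> j" "j < L" for j
    by (rule a_star_D1[OF n1 L v R M(2) rate _ that]) (use a in \<open>simp add: v_def\<close>)
  have \<alpha>0: "\<alpha> > 0" "\<alpha> \<le> 1" using k L by (auto simp: \<alpha>_def)
  note w = w_fun_bounds[OF v]
  have G: "g_fun (\<Delta> / (2 * sqrt v)) / 4 \<le> \<Delta>\<^sup>2 / (8 * v)" by (rule g_fun_snr_le[OF v])
  have Hg: "H \<le> g_fun (\<Delta> / (2 * sqrt v)) / 4" by (simp add: H_def v_def)
  have H1: "H \<le> \<alpha> * \<Delta> * w_fun v"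
  proof -
    have "\<epsilon> * (\<Delta> * w_fun v) \<le> \<alpha> * (\<Delta> * w_fun v)" using \<epsilon>k \<Delta> w by (intro mult_right_mono) (auto simp: \<alpha>_def)
    then show ?thesis by (simp add: H_def v_def mult.assoc)
  qed
  have H2: "H \<le> \<Delta>\<^sup>2 / (8 * v)" using G Hg by linarith
  have gap: "cap_alpha \<alpha> snr - \<alpha> * rate = cap_alpha \<alpha> v - \<alpha> * cap_alpha 1 v + \<alpha> * \<Delta>"
    by (simp add: \<Delta>_def v_def algebra_simps)
  have direct: ?thesis if \<theta>: "0 \<le> \<theta>" "\<theta> \<le> 1"
    and le: "ln (real (L choose k)) - real n * (\<theta> * (cap_alpha \<alpha> v - \<alpha> * cap_alpha 1 v + \<alpha> * \<Delta>)
      + ln (1 - \<theta>\<^sup>2 * (\<alpha> * v / (1 + \<alpha> * v))) / 2) \<le> ln 2 - real n * H" for \<theta>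
  proof -
    have "measure chan (err k m) \<le> exp (ln (real (L choose k)) - real n * (\<theta> * (cap_alpha \<alpha> v - \<alpha> * cap_alpha 1 v + \<alpha> * \<Delta>)
      + ln (1 - \<theta>\<^sup>2 * (\<alpha> * v / (1 + \<alpha> * v))) / 2))"
      using err_direct_bound[OF m k \<theta>] unfolding \<alpha>_def[symmetric] gap unfolding v_def .
    also have "\<dots> \<le> exp (ln 2 - real n * H)" using le by simp
    also have "\<dots> = 2 * exp (- real n * H)" by (simp add: exp_diff exp_minus field_simps)
    finally show ?thesis .
  qed
  show ?thesis
  proof (cases "k = L")
    case True
    then have \<alpha>1: "\<alpha> = 1" using L by (simp add: \<alpha>_def)
    obtain \<theta> where \<theta>: "0 \<le> \<theta>" "\<theta> \<le> 1" "H \<le> \<theta> * \<Delta> + ln (1 - \<theta>\<^sup>2 * (v / (1 + v))) / 2"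
      using exponent_all_sections_wrong[OF v \<Delta> _ H2] H1 \<alpha>1 by auto
    have "real n * H \<le> real n * (\<theta> * \<Delta> + ln (1 - \<theta>\<^sup>2 * (v / (1 + v))) / 2)"
      using \<theta> by (intro mult_left_mono) auto
    moreover have "ln (2::real) \<ge> 0" by simp
    moreover have "ln (real (L choose k)) - real n * (\<theta> * (cap_alpha \<alpha> v - \<alpha> * cap_alpha 1 v + \<alpha> * \<Delta>)
        + ln (1 - \<theta>\<^sup>2 * (\<alpha> * v / (1 + \<alpha> * v))) / 2) = - (real n * (\<theta> * \<Delta> + ln (1 - \<theta>\<^sup>2 * (v / (1 + v))) / 2))"
      by (simp add: \<alpha>1 True)
    ultimately show ?thesis
      by (intro direct[OF \<theta>(1,2)]) linarith
  next
    case False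
    then have kL: "k < L" using k by simp
    have \<alpha>1: "\<alpha> < 1" using kL by (simp add: \<alpha>_def)
    show ?thesis
    proof (cases "1 / 20 \<le> \<alpha> \<or> 1 / 6 \<le> v")
      case True
      define b where "b = ln (real (L choose k)) / real n"
      have nb: "real n * b = ln (real (L choose k))" using nn by (simp add: b_def)
      have b: "b \<le> D1 (cap_alpha \<alpha> v - \<alpha> * cap_alpha 1 v) (\<alpha> * (1 - \<alpha>) * v / (1 + \<alpha> * v))"
        using bin[OF k(1) kL] nn unfolding b_def \<alpha>_def by (simp add: pos_divide_le_eq mult.commute)
      from exponent_moderate_fraction[OF \<alpha>0(1) \<alpha>1 v \<Delta> True b H1 H2]
      show ?thesis
      proof (elim disjE exE conjE)
        fix \<theta> assume \<theta>: "0 \<le> \<theta>" "\<theta> \<le> 1"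
          and le: "H \<le> \<theta> * (cap_alpha \<alpha> v - \<alpha> * cap_alpha 1 v + \<alpha> * \<Delta>) + ln (1 - \<theta>\<^sup>2 * (\<alpha> * v / (1 + \<alpha> * v))) / 2 - b"
        have "real n * H \<le> real n * (\<theta> * (cap_alpha \<alpha> v - \<alpha> * cap_alpha 1 v + \<alpha> * \<Delta>)
          + ln (1 - \<theta>\<^sup>2 * (\<alpha> * v / (1 + \<alpha> * v))) / 2 - b)"
          using le by (intro mult_left_mono) auto
        then have "ln (real (L choose k)) - real n * (\<theta> * (cap_alpha \<alpha> v - \<alpha> * cap_alpha 1 v + \<alpha> * \<Delta>)
          + ln (1 - \<theta>\<^sup>2 * (\<alpha> * v / (1 + \<alpha> * v))) / 2) \<le> - (real n * H)"
          unfolding nb[symmetric] right_diff_distrib by linarith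
        moreover have "ln (2::real) \<ge> 0" by simp
        ultimately show ?thesis by (intro direct[OF \<theta>]) linarith
      next
        fix \<theta> assume \<theta>: "0 \<le> \<theta>" "\<theta> \<le> 1"
          and le: "H \<le> \<theta> * (cap_alpha \<alpha> v - \<alpha> * cap_alpha 1 v + \<alpha> * \<Delta> / 2)
            + ln (1 - \<theta>\<^sup>2 * (\<alpha> * (1 - \<alpha>) * v / (1 + \<alpha> * v))) / 2 - b"
        \<comment> \<open>The threshold \<alpha> \<Delta> / 2 leaves the other half of the gap to
          the union term, while the common statistic attains at least the \<open>g_fun\<close>
          term.\<close>
        obtain \<mu> where \<mu>: "\<mu> \<ge> 0" "\<mu>\<^sup>2 * (\<alpha>\<^sup>2 * v / (1 + \<alpha>\<^sup>2 * v)) < 1"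
          "\<mu> * (\<alpha> * \<Delta> / 2) + ln (1 - \<mu>\<^sup>2 * (\<alpha>\<^sup>2 * v / (1 + \<alpha>\<^sup>2 * v))) / 2 \<ge> g_fun (\<Delta> / (2 * sqrt v)) / 4"
          by (rule common_exponent_ge[OF \<alpha>0(1) v \<Delta>])
        have gap': "cap_alpha \<alpha> snr - \<alpha> * rate - \<alpha> * \<Delta> / 2 = cap_alpha \<alpha> v - \<alpha> * cap_alpha 1 v + \<alpha> * \<Delta> / 2"
          unfolding gap by simp
        have "real n * H \<le> real n * (\<theta> * (cap_alpha \<alpha> v - \<alpha> * cap_alpha 1 v + \<alpha> * \<Delta> / 2)
            + ln (1 - \<theta>\<^sup>2 * (\<alpha> * (1 - \<alpha>) * v / (1 + \<alpha> * v))) / 2 - b)"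
          using le by (intro mult_left_mono) auto
        then have 1: "ln (real (L choose k)) - real n * (\<theta> * (cap_alpha \<alpha> v - \<alpha> * cap_alpha 1 v + \<alpha> * \<Delta> / 2)
            + ln (1 - \<theta>\<^sup>2 * (\<alpha> * (1 - \<alpha>) * v / (1 + \<alpha> * v))) / 2) \<le> - real n * H"
          unfolding nb[symmetric] right_diff_distrib by linarith
        have "real n * H \<le> real n * (\<mu> * (\<alpha> * \<Delta> / 2) + ln (1 - \<mu>\<^sup>2 * (\<alpha>\<^sup>2 * v / (1 + \<alpha>\<^sup>2 * v))) / 2)"
          by (rule mult_left_mono[OF order_trans[OF Hg \<mu>(3)]]) simp
        then have 2: "- real n * (\<mu> * (\<alpha> * \<Delta> / 2) + ln (1 - \<mu>\<^sup>2 * (\<alpha>\<^sup>2 * v / (1 + \<alpha>\<^sup>2 * v))) / 2) \<le> - real n * H"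
          by simp
        have "measure chan (err k m) \<le> exp (ln (real (L choose k))
            - real n * (\<theta> * (cap_alpha \<alpha> v - \<alpha> * cap_alpha 1 v + \<alpha> * \<Delta> / 2)
            + ln (1 - \<theta>\<^sup>2 * (\<alpha> * (1 - \<alpha>) * v / (1 + \<alpha> * v))) / 2))
          + exp (- real n * (\<mu> * (\<alpha> * \<Delta> / 2) + ln (1 - \<mu>\<^sup>2 * (\<alpha>\<^sup>2 * v / (1 + \<alpha>\<^sup>2 * v))) / 2))"
          using err_split_bound[OF m k(1) kL \<theta> \<mu>(1), of "\<alpha> * \<Delta> / 2"] \<mu>(2)
          unfolding \<alpha>_def[symmetric] gap' unfolding v_def by blast
        also have "\<dots> \<le> exp (- real n * H) + exp (- real n * H)"
          using 1 2 by (intro add_mono) simp_all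
        finally show ?thesis by simp
      qed
    next
      case small: False
      have k20: "20 * k \<le> L"
      proof -
        have "20 * real k < real L" using small L by (simp add: \<alpha>_def field_simps)
        then show ?thesis by linarith
      qed
      have one: "ln (real L) \<le> real n * D1 (cap_alpha (1 / real L) v - 1 / real L * cap_alpha 1 v)
       (1 / real L * (1 - 1 / real L) * v / (1 + 1 / real L * v))"
        using bin[of 1] L by simp
      obtain \<theta> where "0 \<le> \<theta>" "\<theta> \<le> 1" "ln (real (L choose k))
        - real n * (\<theta> * (cap_alpha \<alpha> v - \<alpha> * cap_alpha 1 v + \<alpha> * \<Delta>) + ln (1 - \<theta>\<^sup>2 * (\<alpha> * v / (1 + \<alpha> * v))) / 2)
        \<le> ln 2 - real n * H"
        using exponent_small_fraction[OF v _ k(1) k20 \<Delta> one, of H] small H1 unfolding \<alpha>_def by auto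
      then show ?thesis by (rule direct)
    qed
  qed
qed

end

theorem mainTheorem2:
  fixes n L M :: nat and P \<sigma> R a \<epsilon> :: real
  assumes "n \<ge> 1" and "L \<ge> 2"
    and "P > 0" and "\<sigma> > 0"
    and "real M = real L powr a"
    and "real L * ln (real M) = real n * R"
    and "a \<ge> a_star L R (P / \<sigma>^2)"
    and "cap_alpha 1 (P / \<sigma>^2) - R > 0"
    and "\<epsilon> > 0"
  shows "sparc_err_event n P L M \<sigma> \<epsilon> \<in> sets (sparc_space n L M \<sigma>) \<and>
         measure (sparc_space n L M \<sigma>) (sparc_err_event n P L M \<sigma> \<epsilon>)
           \<le> exp (- real n * (min (\<epsilon> * (cap_alpha 1 (P / \<sigma>^2) - R) * w_fun (P / \<sigma>^2))
                                   (g_fun ((cap_alpha 1 (P / \<sigma>^2) - R) / (2 * sqrt (P / \<sigma>^2))) / 4)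
                              - ln (2 * real L) / real n))"
proof -
  have M1: "M \<ge> 1"
  proof -
    have "real M > 0" using assms by simp
    then show ?thesis by simp
  qed
  interpret sparc n L M P \<sigma>
    using assms M1 by unfold_locales auto
  have R: "R = rate" using assms by (simp add: field_simps)
  define H where "H = min (\<epsilon> * (cap_alpha 1 snr - rate) * w_fun snr)
      (g_fun ((cap_alpha 1 snr - rate) / (2 * sqrt snr)) / 4)"
  have "measure chan (err k m) \<le> 2 * exp (- real n * H)"
    if m: "m \<in> sparc_msgs L M" and k: "1 \<le> k" "k \<le> L" and \<epsilon>: "\<epsilon> \<le> real k / real L" for m k
  \<comment> \<open>At rate 0 the condition on \<open>a\<close> cannot be divided by
    \<open>R\<close>; but then there is only one message, so no section can be wrong.\<close>
  proof (cases "M = 1")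
    case True
    have "m' = m" if "m' \<in> sparc_msgs L M" for m'
    proof
      fix l
      show "m' l = m l"
        using that m True by (cases "l < L") (auto simp: sparc_msgs_def PiE_iff extensional_def)
    qed
    then have "err k m = {}" using k by (auto simp: err_def)
    then show ?thesis by simp
  next
    case False
    then have "M \<ge> 2" using M1 by simp
    then show ?thesis
      unfolding H_def using assms R by (intro err_bound[OF _ _ _ _ _ m k \<epsilon>]) auto
  qed
  then have "sparc_err_event n P L M \<sigma> \<epsilon> \<in> sets (sparc_space n L M \<sigma>) \<and>
    measure (sparc_space n L M \<sigma>) (sparc_err_event n P L M \<sigma> \<epsilon>) \<le> real L * (2 * exp (- real n * H))"
    using \<open>\<epsilon> > 0\<close> by (intro sparc_err_event_bound) auto
  moreover have "exp (- real n * (H - ln (2 * real L) / real n)) = real L * (2 * exp (- real n * H))"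
  proof -
    have "- real n * (H - ln (2 * real L) / real n) = ln (2 * real L) + - real n * H"
      using assms by (simp add: right_diff_distrib)
    then show ?thesis using assms by (simp only: exp_add) (simp add: mult_ac)
  qed
  ultimately show ?thesis unfolding H_def R by simp
qed

end
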